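(* Let $H$ be a computable Hilbert space and $(H_i)_{i\in\mathbb N}$ a sequence of computable Hilbert spaces, with $(e_{ik})_{k\in\mathbb N}$ a computable orthonormal basis of $H_i$ for each $i$. If a $g$-frame $\{\Lambda_i\in L(H,H_i):i\in\mathbb N\}$ is computable and $\{\|\Lambda_i^*e_{ik}\|:i,k\in\mathbb N\}$ is a computable double sequence of reals, then the synthesis operator $T:(\sum_{i\in\mathbb N}\oplus H_i)_{\ell^2}\to H$, $T((f_i))=\sum_{i=1}^\infty\Lambda_i^*f_i$, is computable.
   Context: Computability is in the sense of representation-based computable analysis (Type-2 Turing machines). A computable Hilbert space $(H,\langle\cdot,\cdot\rangle,e)$ is a separable Hilbert space with a sequence $e:\mathbb N\to H$ whose linear span is dense such that, for a standard enumeration $\alpha_e$ of finite linear combinations of the $e_i$ with coefficients from a standard countable dense subset of the scalar field, the distances $\|\alpha_e(n)-\alpha_e(m)\|$ form a computable double sequence; it is represented by its Cauchy representation $\delta_H$ (a name of $x$ encodes $(n_k)$ with $\|\alpha_e(n_k)-\alpha_e(n_l)\|<2^{-k}$ for $l>k$ and $x=\lim\alpha_e(n_k)$). An operator between computable Hilbert spaces is computable if it is computable with respect to their Cauchy representations; a (double) sequence is computable if the map from indices to elements is computable. $[\delta\to\delta']$ denotes the standard representation of continuous functions. $(\sum_{i\in\mathbb N}\oplus H_i)_{\ell^2}$ is the Hilbert space of sequences $(f_i)$ with $f_i\in H_i$ and $\sum_i\|f_i\|^2<\infty$, inner product $\sum_i\langle f_i,g_i\rangle$; it is the computable Hilbert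 space with fundamental sequence $(E_{ik})_{i,k}$, where $E_{ik}$ has $i$-th component $e_{ik}$ and all other components $0$. A sequence $\Lambda_i\in L(H,H_i)$ is a $g$-frame for $H$ with respect to $\{H_i\}$ if there are $0<A\le B<\infty$ with $A\|f\|^2\le\sum_i\|\Lambda_if\|^2\le B\|f\|^2$ for all $f\in H$; it is computable if $(\Lambda_i)$ is a computable sequence, i.e. from $i$ one can compute a $[\delta_H\to\delta_{H_i}]$-name of $\Lambda_i$. *)

theory Defs
  imports
    "HOL-Analysis.Abstract_Metric_Spaces"
    "HOL-Algebra.Module"
    "HOL-Library.Nat_Bijection"
begin

section \<open>Type-2 Turing machines\<close>

text \<open>
  Names are sequences of natural numbers. On a tape the sequence p is the infinite binary
  word consisting of p 0 times the letter 0, one letter 1, p 1 times the letter 0, one letter 1,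
  and so on (the letter 1 is \<^const>\<open>True\<close>).
\<close>

definition word_of :: "(nat \<Rightarrow> nat) \<Rightarrow> nat \<Rightarrow> bool" where
  "word_of p j \<longleftrightarrow> (\<exists>n. j = (\<Sum>i\<le>n. p i) + n)"

datatype move = Move_Left | Stay | Move_Right

fun shift :: "move \<Rightarrow> int" where
  "shift Move_Left = - 1"
| "shift Stay = 0"
| "shift Move_Right = 1"

text \<open>
  A machine has a read-only input tape, finitely many two-way infinite work tapes and a one-way
  write-only output tape. States and work symbols are natural numbers below the given
  bounds; the start state and the blank are 0. In one step the machine sees its state, the
  scanned input letter (\<^const>\<open>None\<close> to the left of the input word) and the scanned work symbols. It
  yields the next state, the move of the input head, for each work tape the symbol to
  write and the move, and possibly one letter to append to the output. Only finitely many
  arguments of \<open>delta\<close> matter.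
\<close>

record turing_machine =
  n_states :: nat
  n_symbols :: nat
  n_tapes :: nat
  delta :: "nat \<Rightarrow> bool option \<Rightarrow> nat list \<Rightarrow> nat \<times> move \<times> (nat \<times> move) list \<times> bool option"

definition wf_machine :: "turing_machine \<Rightarrow> bool" where
  "wf_machine M \<longleftrightarrow> 0 < n_states M \<and> 0 < n_symbols M \<and>
     (\<forall>s a ws s' m acts b.
        s < n_states M \<and> length ws = n_tapes M \<and> set ws \<subseteq> {..<n_symbols M} \<and>
        delta M s a ws = (s', m, acts, b) \<longrightarrow>
        s' < n_states M \<and> length acts = n_tapes M \<and> fst ` set acts \<subseteq> {..<n_symbols M})"

record config =
  cur_state :: nat
  input_pos :: int
  work_tapes :: "((int \<Rightarrow> nat) \<times> int) list"
  out_word :: "bool list"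

definition read_input :: "(nat \<Rightarrow> nat) \<Rightarrow> int \<Rightarrow> bool option" where
  "read_input p j = (if j < 0 then None else Some (word_of p (nat j)))"

definition init_config :: "turing_machine \<Rightarrow> config" where
  "init_config M = \<lparr>cur_state = 0, input_pos = 0,
     work_tapes = replicate (n_tapes M) (\<lambda>_. 0, 0), out_word = []\<rparr>"

definition step :: "turing_machine \<Rightarrow> (nat \<Rightarrow> nat) \<Rightarrow> config \<Rightarrow> config" where
  "step M p c =
     (case delta M (cur_state c) (read_input p (input_pos c)) (map (\<lambda>(t, h). t h) (work_tapes c)) of
        (s', m, acts, b) \<Rightarrow>
          \<lparr>cur_state = s',
           input_pos = input_pos c + shift m,
           work_tapes = map2 (\<lambda>(w, d) (t, h). (t(h := w), h + shift d)) acts (work_tapes c),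
           out_word = out_word c @ (case b of None \<Rightarrow> [] | Some x \<Rightarrow> [x])\<rparr>)"

definition out_after :: "turing_machine \<Rightarrow> (nat \<Rightarrow> nat) \<Rightarrow> nat \<Rightarrow> bool list" where
  "out_after M p t = out_word ((step M p ^^ t) (init_config M))"

text \<open>On input p the machine computes forever and in the long run writes the word of q.\<close>

definition transforms :: "turing_machine \<Rightarrow> (nat \<Rightarrow> nat) \<Rightarrow> (nat \<Rightarrow> nat) \<Rightarrow> bool" where
  "transforms M p q \<longleftrightarrow>
     (\<forall>t. \<forall>j < length (out_after M p t). out_after M p t ! j = word_of q j) \<and>
     (\<forall>n. \<exists>t. n \<le> length (out_after M p t))"

definition type2_computable :: "((nat \<Rightarrow> nat) \<rightharpoonup> (nat \<Rightarrow> nat)) \<Rightarrow> bool" where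
  "type2_computable F \<longleftrightarrow>
     (\<exists>M. wf_machine M \<and> (\<forall>p q. F p = Some q \<longleftrightarrow> transforms M p q))"


section \<open>Representations and computable maps\<close>

text \<open>\<open>\<delta> p x\<close> means that p is a name of x.\<close>

type_synonym 'a representation = "(nat \<Rightarrow> nat) \<Rightarrow> 'a \<Rightarrow> bool"

definition computable_map :: "'a representation \<Rightarrow> 'b representation \<Rightarrow> ('a \<Rightarrow> 'b) \<Rightarrow> bool" where
  "computable_map \<delta> \<delta>' f \<longleftrightarrow>
     (\<exists>F. type2_computable F \<and> (\<forall>p x. \<delta> p x \<longrightarrow> (\<exists>q. F p = Some q \<and> \<delta>' q (f x))))"

definition nat_rep :: "nat representation" where
  "nat_rep p n \<longleftrightarrow> p 0 = n"

text \<open>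
  Computable sequences; the n-th element may live in a represented space that depends on n.
  One machine has to serve all indices.
\<close>

definition computable_seq :: "(nat \<Rightarrow> 'a representation) \<Rightarrow> (nat \<Rightarrow> 'a) \<Rightarrow> bool" where
  "computable_seq \<delta> x \<longleftrightarrow>
     (\<exists>F. type2_computable F \<and> (\<forall>p n. nat_rep p n \<longrightarrow> (\<exists>q. F p = Some q \<and> \<delta> n q (x n))))"

definition computable_double_seq ::
    "(nat \<Rightarrow> nat \<Rightarrow> 'a representation) \<Rightarrow> (nat \<Rightarrow> nat \<Rightarrow> 'a) \<Rightarrow> bool" where
  "computable_double_seq \<delta> x \<longleftrightarrow>
     computable_seq (\<lambda>m. case prod_decode m of (i, k) \<Rightarrow> \<delta> i k)
                    (\<lambda>m. case prod_decode m of (i, k) \<Rightarrow> x i k)"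

text \<open>
  The continuous partial function on names coded by p (Kleene associate): the value at
  position n is m if on the shortest prefix of q on which p gives a positive answer for n, this answer is m + 1.
  It is undefined at q unless all positions receive a value.
\<close>

definition assoc_query :: "(nat \<Rightarrow> nat) \<Rightarrow> nat \<Rightarrow> nat \<Rightarrow> nat" where
  "assoc_query q n k = list_encode (n # map q [0..<k])"

definition assoc_fun :: "(nat \<Rightarrow> nat) \<Rightarrow> (nat \<Rightarrow> nat) \<rightharpoonup> (nat \<Rightarrow> nat)" where
  "assoc_fun p q =
     (if \<forall>n. \<exists>k. 0 < p (assoc_query q n k)
      then Some (\<lambda>n. p (assoc_query q n (LEAST k. 0 < p (assoc_query q n k))) - 1)
      else None)"

text \<open>
  The standard representation of the functions with a continuous realizer. As a relation
  it constrains f only on the elements that have a \<open>\<delta>\<close>-name.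
\<close>

definition fun_rep :: "'a representation \<Rightarrow> 'b representation \<Rightarrow> ('a \<Rightarrow> 'b) representation" where
  "fun_rep \<delta> \<delta>' p f \<longleftrightarrow>
     (\<forall>q x. \<delta> q x \<longrightarrow> (\<exists>r. assoc_fun p q = Some r \<and> \<delta>' r (f x)))"

definition cauchy_rep :: "'a set \<Rightarrow> ('a \<Rightarrow> 'a \<Rightarrow> real) \<Rightarrow> (nat \<Rightarrow> 'a) \<Rightarrow> 'a representation" where
  "cauchy_rep X d \<alpha> p x \<longleftrightarrow>
     (\<forall>k l. k < l \<longrightarrow> d (\<alpha> (p k)) (\<alpha> (p l)) < (1 / 2) ^ k) \<and>
     limitin (Metric_space.mtopology X d) (\<lambda>k. \<alpha> (p k)) x sequentially"

definition rat_enum :: "nat \<Rightarrow> real" where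
  "rat_enum n = (case prod_decode n of (a, b) \<Rightarrow> real_of_int (int_decode a) / real (Suc b))"

definition real_rep :: "real representation" where
  "real_rep = cauchy_rep UNIV dist rat_enum"


section \<open>Hilbert spaces\<close>

text \<open>
  The scalar field K is \<open>\<real>\<close> or all of \<open>\<complex>\<close>, both as subsets of the type \<^typ>\<open>complex\<close>, so that
  real and complex Hilbert spaces are treated at once. Spaces have explicit carriers, since
  the spaces \<open>H\<^sub>i\<close> of a sequence differ from each other. The inner product is linear in the first
  argument. The fields \<open>mult\<close> and \<open>one\<close> that a module record inherits from rings play no role.
\<close>

definition scalar_ring :: "complex set \<Rightarrow> complex ring" where
  "scalar_ring K = \<lparr>carrier = K, mult = (*), one = 1, zero = 0, add = (+)\<rparr>"

record 'a hspace = "(complex, 'a) module" +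
  ip :: "'a \<Rightarrow> 'a \<Rightarrow> complex"

definition hnorm :: "'a hspace \<Rightarrow> 'a \<Rightarrow> real" where
  "hnorm V x = sqrt (Re (ip V x x))"

text \<open>The locale \<open>Metric_space\<close> demands symmetry also outside the carrier.\<close>

definition hdist :: "'a hspace \<Rightarrow> 'a \<Rightarrow> 'a \<Rightarrow> real" where
  "hdist V x y = (if x \<in> carrier V \<and> y \<in> carrier V then hnorm V (x \<ominus>\<^bsub>V\<^esub> y) else 0)"

abbreviation htopology :: "'a hspace \<Rightarrow> 'a topology" where
  "htopology V \<equiv> Metric_space.mtopology (carrier V) (hdist V)"

definition hilbert_space :: "complex set \<Rightarrow> 'a hspace \<Rightarrow> bool" where
  "hilbert_space K V \<longleftrightarrow>
     (K = \<real> \<or> K = UNIV) \<and>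
     Module.module (scalar_ring K) V \<and>
     (\<forall>x\<in>carrier V. \<forall>y\<in>carrier V. ip V x y \<in> K) \<and>
     (\<forall>x\<in>carrier V. \<forall>y\<in>carrier V. ip V y x = cnj (ip V x y)) \<and>
     (\<forall>x\<in>carrier V. \<forall>y\<in>carrier V. \<forall>z\<in>carrier V.
        ip V (x \<oplus>\<^bsub>V\<^esub> y) z = ip V x z + ip V y z) \<and>
     (\<forall>c\<in>K. \<forall>x\<in>carrier V. \<forall>y\<in>carrier V. ip V (c \<odot>\<^bsub>V\<^esub> x) y = c * ip V x y) \<and>
     (\<forall>x\<in>carrier V. 0 \<le> Re (ip V x x)) \<and>
     (\<forall>x\<in>carrier V. ip V x x = 0 \<longrightarrow> x = \<zero>\<^bsub>V\<^esub>) \<and>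
     Metric_space.mcomplete (carrier V) (hdist V)"

definition hspan :: "complex set \<Rightarrow> 'a hspace \<Rightarrow> (nat \<Rightarrow> 'a) \<Rightarrow> 'a set" where
  "hspan K V e = {\<Oplus>\<^bsub>V\<^esub>i\<in>{..<n}. c i \<odot>\<^bsub>V\<^esub> e i | n c. range c \<subseteq> K}"

definition fundamental :: "complex set \<Rightarrow> 'a hspace \<Rightarrow> (nat \<Rightarrow> 'a) \<Rightarrow> bool" where
  "fundamental K V e \<longleftrightarrow>
     range e \<subseteq> carrier V \<and> (htopology V) closure_of (hspan K V e) = carrier V"

definition orthonormal_basis :: "complex set \<Rightarrow> 'a hspace \<Rightarrow> (nat \<Rightarrow> 'a) \<Rightarrow> bool" where
  "orthonormal_basis K V e \<longleftrightarrow>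
     fundamental K V e \<and> (\<forall>j k. ip V (e j) (e k) = (if j = k then 1 else 0))"

definition bounded_op :: "complex set \<Rightarrow> 'a hspace \<Rightarrow> 'b hspace \<Rightarrow> ('a \<Rightarrow> 'b) \<Rightarrow> bool" where
  "bounded_op K V W L \<longleftrightarrow>
     (\<forall>x\<in>carrier V. L x \<in> carrier W) \<and>
     (\<forall>x\<in>carrier V. \<forall>y\<in>carrier V. L (x \<oplus>\<^bsub>V\<^esub> y) = L x \<oplus>\<^bsub>W\<^esub> L y) \<and>
     (\<forall>c\<in>K. \<forall>x\<in>carrier V. L (c \<odot>\<^bsub>V\<^esub> x) = c \<odot>\<^bsub>W\<^esub> L x) \<and>
     (\<exists>B. \<forall>x\<in>carrier V. hnorm W (L x) \<le> B * hnorm V x)"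

definition adjoint_op :: "'a hspace \<Rightarrow> 'b hspace \<Rightarrow> ('a \<Rightarrow> 'b) \<Rightarrow> 'b \<Rightarrow> 'a" where
  "adjoint_op V W L y =
     (THE z. z \<in> carrier V \<and> (\<forall>x\<in>carrier V. ip W (L x) y = ip V x z))"

definition l2_sum :: "(nat \<Rightarrow> 'b hspace) \<Rightarrow> (nat \<Rightarrow> 'b) hspace" where
  "l2_sum W =
     \<lparr>carrier = {f. (\<forall>i. f i \<in> carrier (W i)) \<and> summable (\<lambda>i. (hnorm (W i) (f i))\<^sup>2)},
      mult = undefined,
      one = undefined,
      zero = (\<lambda>i. \<zero>\<^bsub>W i\<^esub>),
      add = (\<lambda>f g i. f i \<oplus>\<^bsub>W i\<^esub> g i),
      smult = (\<lambda>c f i. c \<odot>\<^bsub>W i\<^esub> f i),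
      ip = (\<lambda>f g. \<Sum>i. ip (W i) (f i) (g i))\<rparr>"

text \<open>The sequence \<open>E\<^sub>i\<^sub>k\<close>, indexed by the code of the pair (i, k).\<close>

definition l2_fundamental :: "(nat \<Rightarrow> 'b hspace) \<Rightarrow> (nat \<Rightarrow> nat \<Rightarrow> 'b) \<Rightarrow> nat \<Rightarrow> nat \<Rightarrow> 'b" where
  "l2_fundamental W e m =
     (case prod_decode m of (i, k) \<Rightarrow> (\<lambda>j. if j = i then e i k else \<zero>\<^bsub>W j\<^esub>))"


section \<open>Computable Hilbert spaces\<close>

definition scalar_enum :: "complex set \<Rightarrow> nat \<Rightarrow> complex" where
  "scalar_enum K n =
     (if K = \<real> then of_real (rat_enum n)
      else case prod_decode n of (a, b) \<Rightarrow> Complex (rat_enum a) (rat_enum b))"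

text \<open>The standard enumeration \<open>\<alpha>\<^sub>e\<close> of the rational finite linear combinations.\<close>

definition lincomb_enum :: "complex set \<Rightarrow> 'a hspace \<Rightarrow> (nat \<Rightarrow> 'a) \<Rightarrow> nat \<Rightarrow> 'a" where
  "lincomb_enum K V e n =
     (\<Oplus>\<^bsub>V\<^esub>i\<in>{..<length (list_decode n)}. scalar_enum K (list_decode n ! i) \<odot>\<^bsub>V\<^esub> e i)"

definition hilbert_rep :: "complex set \<Rightarrow> 'a hspace \<Rightarrow> (nat \<Rightarrow> 'a) \<Rightarrow> 'a representation" where
  "hilbert_rep K V e = cauchy_rep (carrier V) (hdist V) (lincomb_enum K V e)"

definition computable_hilbert_space :: "complex set \<Rightarrow> 'a hspace \<Rightarrow> (nat \<Rightarrow> 'a) \<Rightarrow> bool" where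
  "computable_hilbert_space K V e \<longleftrightarrow>
     hilbert_space K V \<and> fundamental K V e \<and>
     computable_double_seq (\<lambda>_ _. real_rep)
       (\<lambda>n m. hdist V (lincomb_enum K V e n) (lincomb_enum K V e m))"

text \<open>
  A sequence of computable Hilbert spaces: the distances are computable uniformly in the
  index i of the space.
\<close>

definition computable_hilbert_space_seq ::
    "complex set \<Rightarrow> (nat \<Rightarrow> 'b hspace) \<Rightarrow> (nat \<Rightarrow> nat \<Rightarrow> 'b) \<Rightarrow> bool" where
  "computable_hilbert_space_seq K W h \<longleftrightarrow>
     (\<forall>i. computable_hilbert_space K (W i) (h i)) \<and>
     computable_double_seq (\<lambda>_ _. real_rep)
       (\<lambda>i s. case prod_decode s of (n, m) \<Rightarrow>
          hdist (W i) (lincomb_enum K (W i) (h i) n) (lincomb_enum K (W i) (h i) m))"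


section \<open>g-frames\<close>

definition g_frame ::
    "complex set \<Rightarrow> 'a hspace \<Rightarrow> (nat \<Rightarrow> 'b hspace) \<Rightarrow> (nat \<Rightarrow> 'a \<Rightarrow> 'b) \<Rightarrow> bool" where
  "g_frame K V W \<Lambda> \<longleftrightarrow>
     (\<forall>i. bounded_op K V (W i) (\<Lambda> i)) \<and>
     (\<exists>A B. 0 < A \<and> A \<le> B \<and>
        (\<forall>f\<in>carrier V. summable (\<lambda>i. (hnorm (W i) (\<Lambda> i f))\<^sup>2) \<and>
           A * (hnorm V f)\<^sup>2 \<le> (\<Sum>i. (hnorm (W i) (\<Lambda> i f))\<^sup>2) \<and>
           (\<Sum>i. (hnorm (W i) (\<Lambda> i f))\<^sup>2) \<le> B * (hnorm V f)\<^sup>2))"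

text \<open>The value is the limit of the partial sums in the norm of V.\<close>

definition synthesis_op ::
    "'a hspace \<Rightarrow> (nat \<Rightarrow> 'b hspace) \<Rightarrow> (nat \<Rightarrow> 'a \<Rightarrow> 'b) \<Rightarrow> (nat \<Rightarrow> 'b) \<Rightarrow> 'a" where
  "synthesis_op V W \<Lambda> f =
     (THE y. limitin (htopology V)
        (\<lambda>n. \<Oplus>\<^bsub>V\<^esub>i\<in>{..<n}. adjoint_op V (W i) (\<Lambda> i) (f i)) y sequentially)"

end

theory Submission
  imports Defs "HOL-Library.More_List"
begin

text \<open>
  A name of \<open>T f\<close> is computed from a name p of f by applying T to the finite linear combinations
  that the entries of p stand for. As T is bounded, the entry \<open>p (n + c)\<close> determines \<open>T f\<close> up to
  \<open>1 / 2 ^ (n + 3)\<close> if c is large enough, so it remains to approximate the vectors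
  \<open>v = \<Lambda>\<^sub>i\<^sup>* e\<^sub>i\<^sub>k\<close>. Polarization in \<open>H\<^sub>i\<close> expresses the square of the distance of v to a vector x as
  \<open>\<parallel>x\<parallel>\<^sup>2 + \<parallel>v\<parallel>\<^sup>2 + \<parallel>\<Lambda>\<^sub>i x - e\<^sub>i\<^sub>k\<parallel>\<^sup>2 - \<parallel>\<Lambda>\<^sub>i x\<parallel>\<^sup>2 - 1\<close>, in which all terms are computable; hence one can search
  for a rational combination x close to v.

  For the machines, a function on natural numbers is called computable if a while program over
  counters computes it. Such a program becomes a Turing machine whose head positions are the
  counters. Conversely, the entries that a Turing machine writes on the input \<open>n, 0, 0, \<dots>\<close> are a
  computable function of n and the position, by simulation. So each of the given computable sequences
  is accessible through a computable function on natural numbers.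
\<close>

section \<open>While programs and their compilation to Turing machines\<close>

text \<open>The norm hypothesis is what makes the vectors
  \<open>v = \<Lambda>\<^sub>i\<^sup>* e\<^sub>i\<^sub>k\<close> accessible: through
  \<open>\<Lambda>\<close> alone their inner products with vectors of H are known, which locates
  them only weakly, and the norm of v turns this into approximation in the metric. The bound of T is
  not given as a computable number. It enters through a natural number \<open>b\<close> with
  \<open>C < 2 ^ b\<close>, which is built into the machine as a shift of the input. How accurately
  the single vectors must be approximated depends on the coefficients of a combination; the moduli
  of these sum to at most the code m of the combination, so m itself measures the extra accuracy. As
  adjoints and T are definite descriptions, their existence is derived from the Riesz theorem, by a
  variational argument. After that \<open>T f\<close> is handled through the inner products
  \<open>ip L2 (analysis x) f\<close> alone, so that the image of a finite combination is recognized
  without a limit.\<close>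

datatype prog = Skip | Inc nat | Dec nat | Seq prog prog | Cond nat prog prog | While nat prog
  | Read nat | Out bool

type_synonym pstate = "(nat \<Rightarrow> nat) \<times> nat \<times> bool list"

inductive exec :: "(nat \<Rightarrow> bool) \<Rightarrow> prog \<Rightarrow> pstate \<Rightarrow> pstate \<Rightarrow> bool" for w where
  Skip: "exec w Skip s s"
| Inc: "exec w (Inc r) (\<sigma>, i, out) (\<sigma>(r := Suc (\<sigma> r)), i, out)"
| Dec: "exec w (Dec r) (\<sigma>, i, out) (\<sigma>(r := \<sigma> r - 1), i, out)"
| Seq: "exec w P s s' \<Longrightarrow> exec w Q s' s'' \<Longrightarrow> exec w (Seq P Q) s s''"
| Cond_True: "fst s r \<noteq> 0 \<Longrightarrow> exec w P s s' \<Longrightarrow> exec w (Cond r P Q) s s'"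
| Cond_False: "fst s r = 0 \<Longrightarrow> exec w Q s s' \<Longrightarrow> exec w (Cond r P Q) s s'"
| While_True: "fst s r \<noteq> 0 \<Longrightarrow> exec w P s s' \<Longrightarrow> exec w (While r P) s' s'' \<Longrightarrow>
    exec w (While r P) s s''"
| While_False: "fst s r = 0 \<Longrightarrow> exec w (While r P) s s"
| Read: "exec w (Read r) (\<sigma>, i, out) (if w i then \<sigma>(r := Suc (\<sigma> r)) else \<sigma>, Suc i, out)"
| Out: "exec w (Out b) (\<sigma>, i, out) (\<sigma>, i, out @ [b])"

datatype instr = IInc nat | IDec nat | IJz nat nat | IJmp nat | IRead nat | IOut bool

fun istep1 :: "(nat \<Rightarrow> bool) \<Rightarrow> instr \<Rightarrow> nat \<times> pstate \<Rightarrow> nat \<times> pstate" where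
  "istep1 w (IInc r) (pc, \<sigma>, i, out) = (Suc pc, \<sigma>(r := Suc (\<sigma> r)), i, out)"
| "istep1 w (IDec r) (pc, \<sigma>, i, out) = (Suc pc, \<sigma>(r := \<sigma> r - 1), i, out)"
| "istep1 w (IJz r a) (pc, \<sigma>, i, out) = (if \<sigma> r = 0 then a else Suc pc, \<sigma>, i, out)"
| "istep1 w (IJmp a) (pc, \<sigma>, i, out) = (a, \<sigma>, i, out)"
| "istep1 w (IRead r) (pc, \<sigma>, i, out) =
     (Suc pc, if w i then \<sigma>(r := Suc (\<sigma> r)) else \<sigma>, Suc i, out)"
| "istep1 w (IOut b) (pc, \<sigma>, i, out) = (Suc pc, \<sigma>, i, out @ [b])"

definition istep :: "(nat \<Rightarrow> bool) \<Rightarrow> instr list \<Rightarrow> nat \<times> pstate \<Rightarrow> nat \<times> pstate" where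
  "istep w code c = istep1 w (code ! fst c) c"

fun psize :: "prog \<Rightarrow> nat" where
  "psize Skip = 0"
| "psize (Seq P Q) = psize P + psize Q"
| "psize (Cond r P Q) = psize P + psize Q + 2"
| "psize (While r P) = psize P + 2"
| "psize _ = 1"

text \<open>Jump targets are absolute, so the code depends on the address \<open>a\<close> at which
  it is placed.\<close>

fun compile :: "nat \<Rightarrow> prog \<Rightarrow> instr list" where
  "compile a Skip = []"
| "compile a (Inc r) = [IInc r]"
| "compile a (Dec r) = [IDec r]"
| "compile a (Seq P Q) = compile a P @ compile (a + psize P) Q"
| "compile a (Cond r P Q) = IJz r (a + psize P + 2) # compile (Suc a) P @
     IJmp (a + psize P + psize Q + 2) # compile (a + psize P + 2) Q"
| "compile a (While r P) = IJz r (a + psize P + 2) # compile (Suc a) P @ [IJmp a]"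
| "compile a (Read r) = [IRead r]"
| "compile a (Out b) = [IOut b]"

lemma length_compile [simp]: "length (compile a P) = psize P"
  by (induction P arbitrary: a) auto

definition steps_to :: "(nat \<Rightarrow> bool) \<Rightarrow> instr list \<Rightarrow> nat \<times> pstate \<Rightarrow> nat \<times> pstate \<Rightarrow> bool" where
  "steps_to w code c c' \<longleftrightarrow> (\<exists>t. (istep w code ^^ t) c = c')"

lemma steps_to_refl: "steps_to w code c c"
  unfolding steps_to_def by (rule exI[of _ 0]) simp

lemma steps_to_trans:
  assumes "steps_to w code c c'" and "steps_to w code c' c''"
  shows "steps_to w code c c''"
  using assms unfolding steps_to_def by (metis comp_apply funpow_add)

lemma steps_to_step: "istep w code c = c' \<Longrightarrow> steps_to w code c c'"
  unfolding steps_to_def by (rule exI[of _ 1]) simp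

text \<open>Arbitrary \<open>pre\<close> and \<open>post\<close> let the induction hypothesis apply
  to a subprogram inside the code of the whole. The induction follows the big-step derivation, in
  which every pass of a loop is a premise of its own, so no loop invariant occurs.\<close>

lemma compile_correct:
  assumes "exec w P s s'"
  shows "code = pre @ compile (length pre) P @ post \<Longrightarrow>
    steps_to w code (length pre, s) (length pre + psize P, s')"
  using assms
proof (induction arbitrary: pre post rule: exec.induct)
  case (Skip s)
  then show ?case by (simp add: steps_to_refl)
next
  case (Seq P s s' Q s'')
  have 1: "steps_to w code (length pre, s) (length pre + psize P, s')"
    by (rule Seq.IH(1)[of pre "compile (length pre + psize P) Q @ post"]) (use Seq.prems in simp)
  have 2: "steps_to w code (length pre + psize P, s') (length pre + psize P + psize Q, s'')"
    using Seq.IH(2)[of "pre @ compile (length pre) P" post] Seq.prems by simp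
  show ?case using steps_to_trans[OF 1 2] by (simp add: add.assoc)
next
  case (Cond_True s r P s' Q)
  obtain \<sigma> i out where s: "s = (\<sigma>, i, out)" by (cases s) auto
  have 1: "steps_to w code (length pre, s) (Suc (length pre), s)"
    by (rule steps_to_step) (use Cond_True s in \<open>simp add: istep_def\<close>)
  have 2: "steps_to w code (Suc (length pre), s) (Suc (length pre) + psize P, s')"
    using Cond_True.IH[of "pre @ [IJz r (length pre + psize P + 2)]"] Cond_True.prems by simp
  obtain \<sigma>' i' out' where s': "s' = (\<sigma>', i', out')" by (cases s') auto
  have 3: "steps_to w code (Suc (length pre) + psize P, s') (length pre + psize P + psize Q + 2,
      s')"
    by (rule steps_to_step) (use Cond_True.prems s' in \<open>simp add: istep_def nth_append\<close>)
  show ?case using steps_to_trans[OF steps_to_trans[OF 1 2] 3] by (simp add: add.assoc)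
next
  case (Cond_False s r Q s' P)
  obtain \<sigma> i out where s: "s = (\<sigma>, i, out)" by (cases s) auto
  have 1: "steps_to w code (length pre, s) (length pre + psize P + 2, s)"
    by (rule steps_to_step) (use Cond_False s in \<open>simp add: istep_def\<close>)
  have 2: "steps_to w code (length pre + psize P + 2, s) (length pre + psize P + 2 + psize Q, s')"
    using Cond_False.IH[of "pre @ IJz r (length pre + psize P + 2) # compile (Suc (length pre)) P @
     [IJmp (length pre + psize P + psize Q + 2)]"] Cond_False.prems by simp
  show ?case using steps_to_trans[OF 1 2] by (simp add: algebra_simps)
next
  case (While_True s r P s' s'')
  obtain \<sigma> i out where s: "s = (\<sigma>, i, out)" by (cases s) auto
  have 1: "steps_to w code (length pre, s) (Suc (length pre), s)"
    by (rule steps_to_step) (use While_True s in \<open>simp add: istep_def\<close>)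
  have 2: "steps_to w code (Suc (length pre), s) (Suc (length pre) + psize P, s')"
    using While_True.IH(1)[of "pre @ [IJz r (length pre + psize P + 2)]"] While_True.prems by simp
  obtain \<sigma>' i' out' where s': "s' = (\<sigma>', i', out')" by (cases s') auto
  have 3: "steps_to w code (Suc (length pre) + psize P, s') (length pre, s')"
    by (rule steps_to_step) (use While_True.prems s' in \<open>simp add: istep_def nth_append\<close>)
  have 4: "steps_to w code (length pre, s') (length pre + psize (While r P), s'')"
    by (rule While_True.IH(2)) (rule While_True.prems)
  show ?case using steps_to_trans[OF steps_to_trans[OF steps_to_trans[OF 1 2] 3] 4] .
next
  case (While_False s r P)
  obtain \<sigma> i out where s: "s = (\<sigma>, i, out)" by (cases s) auto
  show ?case by (rule steps_to_step) (use While_False s in \<open>simp add: istep_def\<close>)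
qed (auto intro!: steps_to_step simp: istep_def)

subsection \<open>Counters as head positions\<close>

text \<open>The target \<open>n\<close>, the address just behind the code, is allowed: a conditional
  or loop at the end of the code leaves to it.\<close>

fun instr_ok :: "nat \<Rightarrow> nat \<Rightarrow> instr \<Rightarrow> bool" where
  "instr_ok R n (IInc r) = (r < R)"
| "instr_ok R n (IDec r) = (r < R)"
| "instr_ok R n (IJz r a) = (r < R \<and> a \<le> n)"
| "instr_ok R n (IJmp a) = (a \<le> n)"
| "instr_ok R n (IRead r) = (r < R)"
| "instr_ok R n (IOut b) = True"

fun regs_below :: "nat \<Rightarrow> prog \<Rightarrow> bool" where
  "regs_below R Skip = True"
| "regs_below R (Inc r) = (r < R)"
| "regs_below R (Dec r) = (r < R)"
| "regs_below R (Seq P Q) = (regs_below R P \<and> regs_below R Q)"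
| "regs_below R (Cond r P Q) = (r < R \<and> regs_below R P \<and> regs_below R Q)"
| "regs_below R (While r P) = (r < R \<and> regs_below R P)"
| "regs_below R (Read r) = (r < R)"
| "regs_below R (Out b) = True"

lemma regs_below_mono: "regs_below R P \<Longrightarrow> R \<le> R' \<Longrightarrow> regs_below R' P"
  by (induction P) auto

lemma regs_below_exists: "\<exists>R. regs_below R P"
proof (induction P)
  case (Seq P Q)
  then show ?case using regs_below_mono by (metis max.cobounded1 max.cobounded2 regs_below.simps(4))
next
  case (Cond r P Q)
  then obtain R R' where "regs_below R P" "regs_below R' Q" by auto
  then show ?case
    by (intro exI[of _ "R + R' + Suc r"]) (auto elim: regs_below_mono)
next
  case (While r P)
  then obtain R where "regs_below R P" by auto
  then show ?case by (intro exI[of _ "R + Suc r"]) (auto elim: regs_below_mono)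
qed auto

lemma instr_ok_compile:
  "regs_below R P \<Longrightarrow> a + psize P \<le> n \<Longrightarrow> \<forall>c\<in>set (compile a P). instr_ok R n c"
  by (induction P arbitrary: a) force+

text \<open>
  Work tape r holds the letter 1 in cell 0 only; its head stands in the cell whose number is
  the content of register r. State 0 prepares the tapes, and state \<open>Suc pc\<close> executes
  instruction \<open>pc\<close>. The head move of \<^term>\<open>Read r\<close> is the only one on the input tape.
\<close>

definition keep :: "nat list \<Rightarrow> (nat \<times> move) list" where
  "keep ws = map (\<lambda>x. (x, Stay)) ws"

definition inc_tape :: "nat \<Rightarrow> nat list \<Rightarrow> (nat \<times> move) list" where
  "inc_tape r ws = (keep ws)[r := (ws ! r, Move_Right)]"

text \<open>A head on the marked cell stays there, which is truncated subtraction at 0.\<close>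

definition dec_tape :: "nat \<Rightarrow> nat list \<Rightarrow> (nat \<times> move) list" where
  "dec_tape r ws = (keep ws)[r := (ws ! r, if ws ! r = 1 then Stay else Move_Left)]"

fun instr_delta :: "instr \<Rightarrow> nat \<Rightarrow> bool option \<Rightarrow> nat list \<Rightarrow>
    nat \<times> move \<times> (nat \<times> move) list \<times> bool option" where
  "instr_delta (IInc r) s a ws = (Suc s, Stay, inc_tape r ws, None)"
| "instr_delta (IDec r) s a ws = (Suc s, Stay, dec_tape r ws, None)"
| "instr_delta (IJz r t) s a ws = (if ws ! r = 1 then Suc t else Suc s, Stay, keep ws, None)"
| "instr_delta (IJmp t) s a ws = (Suc t, Stay, keep ws, None)"
| "instr_delta (IRead r) s a ws =
     (Suc s, Move_Right, if a = Some True then inc_tape r ws else keep ws, None)"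
| "instr_delta (IOut b) s a ws = (Suc s, Stay, keep ws, Some b)"

text \<open>In state \<open>Suc (length code)\<close> the program has ended and the machine idles.
  The minimum makes the bound on the next state in \<open>wf_machine\<close> immediate for every
  instruction.\<close>

definition code_delta :: "instr list \<Rightarrow> nat \<Rightarrow> bool option \<Rightarrow> nat list \<Rightarrow>
    nat \<times> move \<times> (nat \<times> move) list \<times> bool option" where
  "code_delta code s a ws =
     (if s = 0 then (1, Stay, map (\<lambda>_. (1, Stay)) ws, None)
      else case s of Suc pc \<Rightarrow>
        if pc < length code
        then (case instr_delta (code ! pc) s a ws of
                (s', m, acts, b) \<Rightarrow> (min s' (Suc (length code)), m, acts, b))
        else (s, Stay, keep ws, None))"

definition machine_of :: "nat \<Rightarrow> instr list \<Rightarrow> turing_machine" where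
  "machine_of R code =
     \<lparr>n_states = Suc (Suc (length code)), n_symbols = 2, n_tapes = R, delta = code_delta code\<rparr>"

lemma length_tape_acts [simp]:
  "length (keep ws) = length ws" "length (inc_tape r ws) = length ws"
  "length (dec_tape r ws) = length ws"
  by (simp_all add: keep_def inc_tape_def dec_tape_def)

lemma set_list_update_image: "f ` set (xs[i := x]) \<subseteq> insert (f x) (f ` set xs)"
  using set_update_subset_insert[of xs i x] by blast

lemma symbols_tape_acts:
  assumes "set ws \<subseteq> {..<n}"
  shows "fst ` set (keep ws) \<subseteq> {..<n}"
    and "r < length ws \<Longrightarrow> fst ` set (inc_tape r ws) \<subseteq> {..<n}"
    and "r < length ws \<Longrightarrow> fst ` set (dec_tape r ws) \<subseteq> {..<n}"
proof -
  show 1: "fst ` set (keep ws) \<subseteq> {..<n}" using assms by (auto simp: keep_def)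
  assume r: "r < length ws"
  then have 2: "ws ! r < n" using assms nth_mem by fastforce
  show "fst ` set (inc_tape r ws) \<subseteq> {..<n}" unfolding inc_tape_def
    by (rule order_trans[OF set_list_update_image], use 1 2 in simp)
  show "fst ` set (dec_tape r ws) \<subseteq> {..<n}" unfolding dec_tape_def
    by (rule order_trans[OF set_list_update_image], use 1 2 in simp)
qed

lemma wf_machine_of:
  assumes "\<forall>c\<in>set code. instr_ok R (length code) c"
  shows "wf_machine (machine_of R code)"
proof -
  have "s' < Suc (Suc (length code)) \<and> length acts = R \<and> fst ` set acts \<subseteq> {..<2}"
    if s: "s < Suc (Suc (length code))" "length ws = R" "set ws \<subseteq> {..<2}"
      and d: "code_delta code s a ws = (s', m, acts, b)" for s a ws s' m acts b
  proof (cases s)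
    case 0
    then show ?thesis using s d by (auto simp: code_delta_def)
  next
    case (Suc pc)
    show ?thesis
    proof (cases "pc < length code")
      case True
      obtain s'' m' acts' b' where id: "instr_delta (code ! pc) s a ws = (s'', m', acts', b')"
        by (cases "instr_delta (code ! pc) s a ws") auto
      have "instr_ok R (length code) (code ! pc)" using assms True by auto
      then have "length acts' = R \<and> fst ` set acts' \<subseteq> {..<2}"
        using id s(2) symbols_tape_acts[OF s(3)]
        by (cases "code ! pc") (simp_all split: if_splits, (elim conjE, hypsubst, simp)+)
      then show ?thesis using d Suc True id by (auto simp: code_delta_def)
    next
      case False
      then show ?thesis using d Suc s symbols_tape_acts(1)[OF s(3)] by (auto simp: code_delta_def)
    qed
  qed
  then show ?thesis unfolding wf_machine_def machine_of_def by (simp, blast)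
qed

definition mark :: "int \<Rightarrow> nat" where
  "mark j = (if j = 0 then 1 else 0)"

definition config_of :: "nat \<Rightarrow> nat \<times> pstate \<Rightarrow> config" where
  "config_of R c = (case c of (pc, \<sigma>, i, out) \<Rightarrow>
     \<lparr>cur_state = Suc pc, input_pos = int i,
      work_tapes = map (\<lambda>r. (mark, int (\<sigma> r))) [0..<R], out_word = out\<rparr>)"

lemma map2_nth_eqI:
  assumes "length xs = n" and "\<And>j. j < n \<Longrightarrow> f (xs ! j) (g j) = h j"
  shows "map2 f xs (map g [0..<n]) = map h [0..<n]"
  by (rule nth_equalityI) (use assms in auto)

text \<open>Every symbol is written back as it was read, so all tapes keep the contents
  \<open>mark\<close> and only the heads move. Scanning the symbol 1 is then the zero test for a
  counter.\<close>

lemma step_machine_of: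
  assumes ok: "\<forall>c\<in>set code. instr_ok R (length code) c" and pc: "fst c < length code"
  shows "step (machine_of R code) p (config_of R c) = config_of R (istep (word_of p) code c)"
proof -
  obtain pc \<sigma> i out where c: "c = (pc, \<sigma>, i, out)" by (cases c) auto
  let ?ws = "map (\<lambda>r. mark (int (\<sigma> r))) [0..<R]"
  have ws: "map (\<lambda>(t, h). t h) (work_tapes (config_of R c)) = ?ws"
    by (simp add: config_of_def c)
  have iok: "instr_ok R (length code) (code ! pc)" using ok pc c by auto
  have mark_upd: "mark(x := mark x) = mark" for x by simp
  have keep: "map2 (\<lambda>(w, d) (t, h). (t(h := w), h + shift d)) (keep ?ws)
     (map (\<lambda>r. (mark, int (\<sigma> r))) [0..<R]) = map (\<lambda>r. (mark, int (\<sigma> r))) [0..<R]"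
    by (rule map2_nth_eqI) (auto simp: keep_def mark_upd)
  have inc: "map2 (\<lambda>(w, d) (t, h). (t(h := w), h + shift d)) (inc_tape r ?ws)
     (map (\<lambda>r. (mark, int (\<sigma> r))) [0..<R]) = map (\<lambda>q. (mark, int ((\<sigma>(r := Suc (\<sigma> r))) q))) [0..<R]"
    if "r < R" for r
    by (rule map2_nth_eqI) (use that in \<open>auto simp: keep_def inc_tape_def nth_list_update mark_upd\<close>)
  have dec: "map2 (\<lambda>(w, d) (t, h). (t(h := w), h + shift d)) (dec_tape r ?ws)
     (map (\<lambda>r. (mark, int (\<sigma> r))) [0..<R]) = map (\<lambda>q. (mark, int ((\<sigma>(r := \<sigma> r - 1)) q))) [0..<R]"
    if "r < R" for r
    by (rule map2_nth_eqI)
      (use that in \<open>auto simp: keep_def dec_tape_def nth_list_update mark_upd mark_def\<close>)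
  have d: "code_delta code (Suc pc) a ws' =
      (case instr_delta (code ! pc) (Suc pc) a ws' of
         (s', m, acts, b) \<Rightarrow> (min s' (Suc (length code)), m, acts, b))" for a ws'
    using pc c by (simp add: code_delta_def)
  have mark1: "mark (int n) = Suc 0 \<longleftrightarrow> n = 0" for n by (simp add: mark_def)
  have rd: "read_input p (int i) = Some (word_of p i)" by (simp add: read_input_def)
  show ?thesis
    unfolding step_def ws
    using pc iok
    by (cases "code ! pc")
      (auto simp: machine_of_def c config_of_def d rd istep_def keep inc dec mark1
         simp del: fun_upd_apply)
qed

lemma init_step_machine_of:
  "step (machine_of R code) p (init_config (machine_of R code)) = config_of R (0, \<lambda>_. 0, 0, [])"
proof -
  have "(\<lambda>_. 0)(0 := 1) = mark" by (auto simp: mark_def)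
  then have "map2 (\<lambda>(w, d) (t, h). (t(h := w), h + shift d)) (replicate R (1, Stay))
      (replicate R (\<lambda>_. 0, 0)) = map (\<lambda>r. (mark, 0)) [0..<R]"
    by (intro nth_equalityI) auto
  then show ?thesis
    by (simp add: step_def init_config_def machine_of_def code_delta_def config_of_def
        map_replicate_const)
qed

subsection \<open>Endless loops\<close>

definition entry_pos :: "(nat \<Rightarrow> nat) \<Rightarrow> nat \<Rightarrow> nat" where
  "entry_pos q n = (\<Sum>i<n. q i) + n"

lemma entry_pos_0 [simp]: "entry_pos q 0 = 0"
  and entry_pos_Suc: "entry_pos q (Suc n) = Suc (entry_pos q n + q n)"
  by (simp_all add: entry_pos_def)

lemma strict_mono_entry_pos: "strict_mono (entry_pos q)"
  by (simp add: strict_mono_Suc_iff entry_pos_Suc)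

text \<open>The block of entry n begins at \<open>entry_pos q n\<close>, and the letter 1 that
  closes it stands just before the next block. In this form questions about letters reduce to strict
  monotonicity of \<open>entry_pos\<close>.\<close>

lemma word_of_iff_entry_pos: "word_of q j \<longleftrightarrow> (\<exists>n. Suc j = entry_pos q (Suc n))"
  unfolding word_of_def by (simp add: entry_pos_def lessThan_Suc_atMost)

lemma word_of_entry:
  assumes "j \<le> q n"
  shows "word_of q (entry_pos q n + j) \<longleftrightarrow> j = q n"
proof
  assume "word_of q (entry_pos q n + j)"
  then obtain m where m: "Suc (entry_pos q n + j) = entry_pos q (Suc m)"
    by (auto simp: word_of_iff_entry_pos)
  then have "entry_pos q n < entry_pos q (Suc m)" "entry_pos q (Suc m) \<le> entry_pos q (Suc n)"
    using assms by (auto simp: entry_pos_Suc[of q n])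
  then have "m = n"
    using strict_mono_less[OF strict_mono_entry_pos] strict_mono_less_eq[OF strict_mono_entry_pos]
    by (metis Suc_le_mono le_antisym less_Suc_eq_le)
  then show "j = q n" using m by (simp add: entry_pos_Suc)
next
  assume "j = q n"
  then show "word_of q (entry_pos q n + j)"
    unfolding word_of_iff_entry_pos by (intro exI[of _ n]) (simp add: entry_pos_Suc)
qed

text \<open>Entries are recovered from the left: if all earlier ones agree, both blocks begin at the
  same position, and the first letter 1 from there on fixes the entry.\<close>

lemma inj_word_of: "inj word_of"
proof (rule injI)
  fix q q' :: "nat \<Rightarrow> nat"
  assume eq: "word_of q = word_of q'"
  have "q n = q' n" for n
  proof (induction n rule: less_induct)
    case (less n)
    then have "entry_pos q n = entry_pos q' n" by (simp add: entry_pos_def)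
    moreover have "word_of q (entry_pos q n + q n)" "word_of q' (entry_pos q' n + q' n)"
      by (simp_all add: word_of_entry)
    ultimately show ?case
      using word_of_entry[of "q n" q' n] word_of_entry[of "q' n" q n] eq
      by (metis nat_le_linear)
  qed
  then show "q = q'" by auto
qed

lemma transforms_unique:
  assumes "transforms M p q" and "transforms M p q'"
  shows "q = q'"
proof -
  have "word_of q j = word_of q' j" for j
  proof -
    obtain t where "Suc j \<le> length (out_after M p t)" using assms unfolding transforms_def by blast
    then have "j < length (out_after M p t)" by simp
    then show ?thesis using assms unfolding transforms_def by metis
  qed
  then show ?thesis using inj_word_of by (auto dest: injD)
qed

text \<open>\<open>type2_computable\<close> prescribes the domain exactly, so the function is taken
  to be defined precisely where the machine writes the word of some sequence;
  \<open>transforms_unique\<close> justifies the description.\<close>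

lemma type2_computable_machine:
  assumes "wf_machine M"
  shows "type2_computable (\<lambda>p. if \<exists>q. transforms M p q then Some (THE q. transforms M p q) else
      None)"
proof -
  have "(THE q. transforms M p q) = q" if "transforms M p q" for p q
    using that transforms_unique by blast
  then show ?thesis
    unfolding type2_computable_def using assms by (intro exI[of _ M]) auto
qed

definition word_prefix :: "(nat \<Rightarrow> nat) \<Rightarrow> nat \<Rightarrow> bool list" where
  "word_prefix q n = concat (map (\<lambda>i. replicate (q i) False @ [True]) [0..<n])"

lemma word_prefix_0 [simp]: "word_prefix q 0 = []"
  and word_prefix_Suc: "word_prefix q (Suc n) = word_prefix q n @ replicate (q n) False @ [True]"
  by (simp_all add: word_prefix_def)

lemma length_word_prefix: "length (word_prefix q n) = entry_pos q n"
  by (induction n) (auto simp: word_prefix_Suc entry_pos_Suc)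

lemma word_prefix_nth: "j < entry_pos q n \<Longrightarrow> word_prefix q n ! j = word_of q j"
proof (induction n)
  case (Suc n)
  show ?case
  proof (cases "j < entry_pos q n")
    case True
    then show ?thesis using Suc by (simp add: word_prefix_Suc nth_append length_word_prefix)
  next
    case False
    then obtain k where k: "j = entry_pos q n + k" using le_Suc_ex not_less by blast
    then have "k \<le> q n" using Suc.prems by (simp add: entry_pos_Suc)
    then show ?thesis using word_of_entry[of k q n] k
      by (auto simp: word_prefix_Suc nth_append length_word_prefix)
  qed
qed simp

lemma out_word_step: "\<exists>bs. out_word (step M p c) = out_word c @ bs"
  by (auto simp: step_def split: prod.splits)

lemma out_after_mono: "t \<le> t' \<Longrightarrow> \<exists>bs. out_after M p t' = out_after M p t @ bs"
proof (induction t' rule: dec_induct)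
  case (step n)
  then show ?case using out_word_step[of M p "(Defs.step M p ^^ n) (init_config M)"]
    by (auto simp: out_after_def)
qed simp

lemma transforms_if_prefixes:
  assumes "\<And>n. \<exists>t. out_after M p t = word_prefix q n"
  shows "transforms M p q"
  unfolding transforms_def
proof (intro conjI allI impI)
  fix t j assume j: "j < length (out_after M p t)"
  \<comment> \<open>Each entry contributes at least one letter, so the prefix with this many entries
    is longer than the output at time \<open>t\<close> and can only be reached later.\<close>
  let ?n = "Suc (length (out_after M p t))"
  obtain t' where t': "out_after M p t' = word_prefix q ?n" using assms by blast
  have le: "?n \<le> entry_pos q ?n" unfolding entry_pos_def by simp
  have "t \<le> t'"
  proof (rule ccontr)
    assume "\<not> t \<le> t'"
    then obtain bs where "out_after M p t = out_after M p t' @ bs"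
      using out_after_mono[of t' t M p] by auto
    then have "length (out_after M p t) = entry_pos q ?n + length bs"
      unfolding t' by (metis length_append length_word_prefix)
    then show False using le by simp
  qed
  then obtain bs where bs: "out_after M p t' = out_after M p t @ bs"
    using out_after_mono[of t t' M p] by auto
  then have "out_after M p t ! j = word_prefix q ?n ! j" using j t' by (metis nth_append)
  also have "\<dots> = word_of q j" using j le by (intro word_prefix_nth) simp
  finally show "out_after M p t ! j = word_of q j" .
next
  fix n
  obtain t where "out_after M p t = word_prefix q n" using assms by blast
  then show "\<exists>t. n \<le> length (out_after M p t)"
    by (intro exI[of _ t]) (simp add: length_word_prefix entry_pos_def)
qed

lemma steps_machine_of:
  assumes ok: "\<forall>c\<in>set code. instr_ok R (length code) c"
    and inside: "\<And>t'. t' < t \<Longrightarrow> fst ((istep (word_of p) code ^^ t') c) < length code"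
  shows "(step (machine_of R code) p ^^ t) (config_of R c)
      = config_of R ((istep (word_of p) code ^^ t) c)"
  using inside by (induction t) (auto simp: step_machine_of[OF ok])

text \<open>Jumps lead at most to the last address, and the instruction there jumps back into the
  code, so control never runs off its end.\<close>

lemma istep_bound:
  assumes "\<forall>c\<in>set code. instr_ok R (length code - 1) c" and "last code = IJmp a"
      and "a < length code"
    and "fst c < length code"
  shows "fst (istep w code c) < length code"
proof -
  obtain pc \<sigma> i out where c: "c = (pc, \<sigma>, i, out)" by (cases c) auto
  have ok: "instr_ok R (length code - 1) (code ! pc)" using assms c by auto
  show ?thesis
  proof (cases "Suc pc = length code")
    case True
    then have "code ! pc = last code" by (metis last_conv_nth diff_Suc_1 length_0_conv
        nat.distinct(1))
    then show ?thesis using assms c by (simp add: istep_def)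
  next
    case False
    then show ?thesis using assms(4) ok c by (cases "code ! pc") (auto simp: istep_def)
  qed
qed

text \<open>\<open>exec\<close> describes terminating runs only. An infinite computation is
  therefore composed of a terminating prelude and terminating rounds, where \<open>S n\<close> is
  the state after n rounds. The machine is chosen before the input.\<close>

lemma loop_machine:
  "\<exists>M. wf_machine M \<and>
     (\<forall>p q S. exec (word_of p) Pre (\<lambda>_. 0, 0, []) (S 0) \<longrightarrow>
        (\<forall>n. exec (word_of p) Body (S n) (S (Suc n))) \<longrightarrow>
        (\<forall>n. snd (snd (S n)) = word_prefix q n) \<longrightarrow> transforms M p q)"
proof -
  let ?a = "psize Pre"
  define code where "code = compile 0 Pre @ compile ?a Body @ [IJmp ?a]"
  obtain R0 R1 where "regs_below R0 Pre" "regs_below R1 Body" using regs_below_exists by metis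
  then have R: "regs_below (R0 + R1) Pre" "regs_below (R0 + R1) Body"
    by (auto elim: regs_below_mono)
  define R where "R = R0 + R1"
  have len: "length code = ?a + psize Body + 1" by (simp add: code_def)
  have ok1: "\<forall>c\<in>set code. instr_ok R (length code - 1) c"
    using R instr_ok_compile[of R Pre 0 "length code - 1"] instr_ok_compile[of R Body ?a "length
        code - 1"]
    unfolding R_def len code_def by auto
  then have ok: "\<forall>c\<in>set code. instr_ok R (length code) c"
  proof -
    have "instr_ok R (length code) c" if "instr_ok R (length code - 1) c" for c
      using that by (cases c) auto
    then show ?thesis using ok1 by blast
  qed
  have last: "last code = IJmp ?a" by (simp add: code_def)
  have "fst c < length code \<Longrightarrow> fst (istep w code c) < length code" for w c
    using istep_bound[OF ok1 last, of c w] len by simp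
  then have inside: "fst c < length code \<Longrightarrow> fst ((istep w code ^^ t) c) < length code" for w t c
    by (induction t) simp_all
  have "transforms (machine_of R code) p q"
    if pre: "exec (word_of p) Pre (\<lambda>_. 0, 0, []) (S 0)"
      and body: "\<forall>n. exec (word_of p) Body (S n) (S (Suc n))"
      and out: "\<forall>n. snd (snd (S n)) = word_prefix q n" for p q S
  proof (rule transforms_if_prefixes)
    fix n
    have "steps_to (word_of p) code (0, \<lambda>_. 0, 0, []) (?a, S n)"
    proof (induction n)
      case 0
      show ?case using compile_correct[OF pre, of code "[]"] by (simp add: code_def)
    next
      case (Suc n)
      have "steps_to (word_of p) code (?a, S n) (?a + psize Body, S (Suc n))"
        using compile_correct[of "word_of p" Body "S n" "S (Suc n)" code "compile 0 Pre"] body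
        by (simp add: code_def)
      moreover have "steps_to (word_of p) code (?a + psize Body, S (Suc n)) (?a, S (Suc n))"
        by (rule steps_to_step) (cases "S (Suc n)", simp add: istep_def code_def nth_append)
      ultimately show ?case using Suc steps_to_trans by blast
    qed
    then obtain t where t: "(istep (word_of p) code ^^ t) (0, \<lambda>_. 0, 0, []) = (?a, S n)"
      unfolding steps_to_def by blast
    \<comment> \<open>The additional machine step is the one that marks the tapes.\<close>
    have "(step (machine_of R code) p ^^ Suc t) (init_config (machine_of R code))
        = config_of R (?a, S n)"
      unfolding funpow_Suc_right comp_apply init_step_machine_of
      by (subst steps_machine_of[OF ok], rule inside) (simp_all add: t len)
    then have "out_after (machine_of R code) p (Suc t) = word_prefix q n"
      using out by (cases "S n") (simp add: out_after_def config_of_def, metis snd_conv)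
    then show "\<exists>t. out_after (machine_of R code) p t = word_prefix q n" by blast
  qed
  then show ?thesis using wf_machine_of[OF ok] by blast
qed

section \<open>Computable functions on natural numbers\<close>

text \<open>The program is a template in its base register \<open>b\<close>, so that it can run
  above registers whose contents must survive. Registers above \<open>b\<close> may hold anything at
  the start, which is why the programs clear their scratch registers.\<close>

definition computes :: "(nat \<Rightarrow> prog) \<Rightarrow> (nat \<Rightarrow> nat) \<Rightarrow> bool" where
  "computes P f \<longleftrightarrow> (\<forall>w b u i out. \<exists>u'.
     exec w (P b) (u, i, out) (u', i, out) \<and> u' b = f (u b) \<and> (\<forall>r<b. u' r = u r))"

definition cmp :: "(nat \<Rightarrow> nat) \<Rightarrow> bool" where
  "cmp f \<longleftrightarrow> (\<exists>P. computes P f)"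

section \<open>Register programs for clearing, moving and copying\<close>

definition pclear :: "nat \<Rightarrow> prog" where
  "pclear r = While r (Dec r)"

lemma exec_pclear: "exec w (pclear r) (u, i, out) (u(r := 0), i, out)"
proof (induction "u r" arbitrary: u)
  case 0
  then have "u(r := 0) = u" by auto
  then show ?case unfolding pclear_def using 0 exec.While_False[of "(u, i, out)" r w "Dec r"]
      by simp
next
  case (Suc n)
  have "exec w (pclear r) (u(r := u r - 1), i, out) (u(r := 0), i, out)"
    using Suc.hyps(1)[of "u(r := u r - 1)"] Suc.hyps(2)[symmetric] by simp
  note step = this[unfolded pclear_def]
  show ?case using Suc.hyps(2)[symmetric] unfolding pclear_def
    by - (rule exec.While_True[OF _ exec.Dec step], simp)
qed

definition pmove :: "nat \<Rightarrow> nat \<Rightarrow> prog" where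
  "pmove a b = While a (Seq (Dec a) (Inc b))"

lemma exec_pmove:
  "a \<noteq> b \<Longrightarrow> exec w (pmove a b) (u, i, out) (u(a := 0, b := u b + u a), i, out)"
proof (induction "u a" arbitrary: u)
  case 0
  then have "u(a := 0, b := u b + u a) = u" by auto
  then show ?case unfolding pmove_def
    using 0 exec.While_False[of "(u, i, out)" a w "Seq (Dec a) (Inc b)"] by (simp only: fst_conv)
next
  case (Suc n)
  let ?s = "u(a := u a - 1)"
  let ?t = "?s(b := Suc (?s b))"
  have "exec w (pmove a b) (?t, i, out) (?t(a := 0, b := ?t b + ?t a), i, out)"
    by (rule Suc.hyps(1)) (use Suc.prems Suc.hyps(2)[symmetric] in auto)
  moreover have "?t(a := 0, b := ?t b + ?t a) = u(a := 0, b := u b + u a)"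
    using Suc.prems Suc.hyps(2)[symmetric] by auto
  ultimately have step: "exec w (pmove a b) (?t, i, out) (u(a := 0, b := u b + u a), i, out)"
    by (simp only:)
  show ?case using Suc.prems Suc.hyps(2)[symmetric] unfolding pmove_def
    by - (rule exec.While_True[OF _ exec.Seq[OF exec.Dec exec.Inc] step[unfolded pmove_def]],
        simp_all)
qed

definition pmove2 :: "nat \<Rightarrow> nat \<Rightarrow> nat \<Rightarrow> prog" where
  "pmove2 a b c = While a (Seq (Dec a) (Seq (Inc b) (Inc c)))"

lemma exec_pmove2:
  "a \<noteq> b \<Longrightarrow> a \<noteq> c \<Longrightarrow> b \<noteq> c \<Longrightarrow>
   exec w (pmove2 a b c) (u, i, out) (u(a := 0, b := u b + u a, c := u c + u a), i, out)"
proof (induction "u a" arbitrary: u)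
  case 0
  then have "u(a := 0, b := u b + u a, c := u c + u a) = u" by auto
  then show ?case unfolding pmove2_def
    using 0 exec.While_False[of "(u, i, out)" a w] by (simp only: fst_conv)
next
  case (Suc n)
  let ?s = "u(a := u a - 1)"
  let ?u = "?s(b := Suc (?s b))"
  let ?t = "?u(c := Suc (?u c))"
  have "exec w (pmove2 a b c) (?t, i, out) (?t(a := 0, b := ?t b + ?t a, c := ?t c + ?t a), i, out)"
    by (rule Suc.hyps(1)) (use Suc.prems Suc.hyps(2)[symmetric] in auto)
  moreover have "?t(a := 0, b := ?t b + ?t a, c := ?t c + ?t a)
      = u(a := 0, b := u b + u a, c := u c + u a)"
    using Suc.prems Suc.hyps(2)[symmetric] by auto
  ultimately have step: "exec w (pmove2 a b c) (?t, i, out) (u(a := 0, b := u b + u a, c := u c + u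
      a), i, out)"
    by (simp only:)
  show ?case using Suc.prems Suc.hyps(2)[symmetric] unfolding pmove2_def
    by - (rule exec.While_True[OF _ exec.Seq[OF exec.Dec exec.Seq[OF exec.Inc exec.Inc]]
        step[unfolded pmove2_def]], simp_all)
qed

text \<open>A counter can be read only by emptying it; the second copy in \<open>c\<close> serves to
  restore \<open>a\<close>.\<close>

definition pcopy :: "nat \<Rightarrow> nat \<Rightarrow> nat \<Rightarrow> prog" where
  "pcopy a b c = Seq (pclear b) (Seq (pclear c) (Seq (pmove2 a b c) (pmove c a)))"

lemma exec_pcopy:
  assumes "a \<noteq> b" "a \<noteq> c" "b \<noteq> c"
  shows "exec w (pcopy a b c) (u, i, out) (u(b := u a, c := 0), i, out)"
proof -
  let ?s1 = "u(b := 0)"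
  let ?s2 = "?s1(c := 0)"
  let ?s3 = "?s2(a := 0, b := ?s2 b + ?s2 a, c := ?s2 c + ?s2 a)"
  have "exec w (pcopy a b c) (u, i, out) (?s3(c := 0, a := ?s3 a + ?s3 c), i, out)"
    unfolding pcopy_def
    using assms by (intro exec.Seq[OF exec_pclear] exec.Seq[OF exec_pmove2] exec_pmove) auto
  moreover have "?s3(c := 0, a := ?s3 a + ?s3 c) = u(b := u a, c := 0)" using assms by auto
  ultimately show ?thesis by simp
qed

section \<open>Basic functions, composition, pairing and loops\<close>

lemma cmpI: "computes P f \<Longrightarrow> cmp f"
  unfolding cmp_def by blast

lemma computesI:
  assumes "\<And>w b u i out. \<exists>u'. exec w (P b) (u, i, out) (u', i, out) \<and> u' b = f (u b) \<and> (\<forall>r<b. u' r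
      = u r)"
  shows "computes P f"
  using assms unfolding computes_def by blast

lemma computesD:
  "computes P f \<Longrightarrow> \<exists>u'. exec w (P b) (u, i, out) (u', i, out) \<and> u' b = f (u b) \<and> (\<forall>r<b. u' r = u r)"
  unfolding computes_def by blast

lemma cmp_id: "cmp (\<lambda>x. x)"
  by (rule cmpI[of "\<lambda>b. Skip"], rule computesI) (auto intro: exec.Skip)

lemma cmp_zero: "cmp (\<lambda>x. 0)"
  by (rule cmpI[of "\<lambda>b. pclear b"], rule computesI)
    (auto intro!: exI[of _ "_(_ := 0)"] exec_pclear)

lemma cmp_Suc: "cmp Suc"
  by (rule cmpI[of "\<lambda>b. Inc b"], rule computesI) (fastforce intro: exec.Inc)

lemma cmp_pred: "cmp (\<lambda>x. x - 1)"
  by (rule cmpI[of "\<lambda>b. Dec b"], rule computesI) (fastforce intro: exec.Dec)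

lemma cmp_comp:
  assumes "cmp f" and "cmp g"
  shows "cmp (\<lambda>x. f (g x))"
proof -
  obtain P Q where P: "computes P f" and Q: "computes Q g" using assms unfolding cmp_def by blast
  show ?thesis
  proof (rule cmpI[of "\<lambda>b. Seq (Q b) (P b)"], rule computesI)
    fix w i out and b :: nat and u :: "nat \<Rightarrow> nat"
    obtain u1 where 1: "exec w (Q b) (u, i, out) (u1, i, out)" "u1 b = g (u b)"
      "\<forall>r<b. u1 r = u r"
      using computesD[OF Q, of w "b" "u" i out] by blast
    obtain u2 where 2: "exec w (P b) (u1, i, out) (u2, i, out)" "u2 b = f (u1 b)"
      "\<forall>r<b. u2 r = u1 r"
      using computesD[OF P, of w "b" "u1" i out] by blast
    show "\<exists>u'. exec w (Seq (Q b) (P b)) (u, i, out) (u', i, out) \<and> u' b = f (g (u b)) \<and>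
       (\<forall>r<b. u' r = u r)"
      using 1 2 by (intro exI[of _ u2]) (auto intro: exec.Seq)
  qed
qed

text \<open>
  Registers \<open>b + 3\<close> and \<open>b + 4\<close> hold a summation bound and a copy of it; \<open>prod_encode (m, n)\<close>
  is m plus the sum of all numbers up to \<open>m + n\<close>.
\<close>

definition ptriangle :: "nat \<Rightarrow> prog" where
  "ptriangle b = While (b + 3)
     (Seq (pmove2 (b + 3) (b + 4) b) (Seq (Dec (b + 4)) (pmove (b + 4) (b + 3))))"

lemma exec_ptriangle:
  "u (b + 4) = 0 \<Longrightarrow>
   exec w (ptriangle b) (u, i, out) (u(b := u b + triangle (u (b + 3)), b + 3 := 0), i, out)"
proof (induction "u (b + 3)" arbitrary: u)
  case 0
  then have "u(b := u b + triangle (u (b + 3)), b + 3 := 0) = u" by auto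
  then show ?case unfolding ptriangle_def
    using 0 exec.While_False[of "(u, i, out)" "b + 3" w] by (simp only: fst_conv)
next
  case (Suc n)
  let ?s1 = "u(b + 3 := 0, b + 4 := u (b + 4) + u (b + 3), b := u b + u (b + 3))"
  let ?s2 = "?s1(b + 4 := ?s1 (b + 4) - 1)"
  let ?t = "?s2(b + 4 := 0, b + 3 := ?s2 (b + 3) + ?s2 (b + 4))"
  have "exec w (ptriangle b) (?t, i, out) (?t(b := ?t b + triangle (?t (b + 3)), b + 3 := 0), i,
      out)"
    by (rule Suc.hyps(1)) (use Suc.prems Suc.hyps(2)[symmetric] in auto)
  moreover have "?t(b := ?t b + triangle (?t (b + 3)), b + 3 := 0)
      = u(b := u b + triangle (u (b + 3)), b + 3 := 0)"
    using Suc.prems Suc.hyps(2)[symmetric] by (auto simp: fun_eq_iff)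
  ultimately have step: "exec w (ptriangle b) (?t, i, out) (u(b := u b + triangle (u (b + 3)), b + 3
      := 0), i, out)"
    by (simp only:)
  show ?case using Suc.prems Suc.hyps(2)[symmetric] unfolding ptriangle_def
    by - (rule exec.While_True[OF _ exec.Seq[OF exec_pmove2 exec.Seq[OF exec.Dec exec_pmove]]
        step[unfolded ptriangle_def]], simp_all)
qed

definition pencode :: "nat \<Rightarrow> prog" where
  "pencode b = Seq (pclear b) (Seq (pclear (b + 3)) (Seq (pclear (b + 4))
     (Seq (pmove2 (b + 1) b (b + 3)) (Seq (pmove (b + 2) (b + 3)) (ptriangle b)))))"

lemma exec_pencode:
  "\<exists>u'. exec w (pencode b) (u, i, out) (u', i, out) \<and>
     u' b = prod_encode (u (b + 1), u (b + 2)) \<and> (\<forall>r<b. u' r = u r)"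
proof -
  let ?s3 = "u(b := 0, b + 3 := 0, b + 4 := 0)"
  let ?s4 = "?s3(b + 1 := 0, b := ?s3 b + ?s3 (b + 1), b + 3 := ?s3 (b + 3) + ?s3 (b + 1))"
  let ?s5 = "?s4(b + 2 := 0, b + 3 := ?s4 (b + 3) + ?s4 (b + 2))"
  let ?s6 = "?s5(b := ?s5 b + triangle (?s5 (b + 3)), b + 3 := 0)"
  have "exec w (pencode b) (u, i, out) (?s6, i, out)"
    unfolding pencode_def
    by (intro exec.Seq[OF exec_pclear] exec.Seq[OF exec_pmove2] exec.Seq[OF exec_pmove]
        exec_ptriangle) simp_all
  then show ?thesis by (intro exI[of _ ?s6]) (auto simp: prod_encode_def)
qed

lemma cmp_pair:
  assumes "cmp f" and "cmp g"
  shows "cmp (\<lambda>x. prod_encode (f x, g x))"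
proof -
  obtain P Q where P: "computes P f" and Q: "computes Q g" using assms unfolding cmp_def by blast
  show ?thesis
  proof (rule cmpI[of "\<lambda>b. Seq (pcopy b (b + 1) (b + 2)) (Seq (P (b + 1))
      (Seq (pcopy b (b + 2) (b + 3)) (Seq (Q (b + 2)) (pencode b))))"], rule computesI)
    fix w i out and b :: nat and u :: "nat \<Rightarrow> nat"
    let ?s1 = "u(b + 1 := u b, b + 2 := 0)"
    have 1: "exec w (pcopy b (b + 1) (b + 2)) (u, i, out) (?s1, i, out)"
      by (rule exec_pcopy) auto
    obtain u2 where 2: "exec w (P (b + 1)) (?s1, i, out) (u2, i, out)" "u2 (b + 1)
        = f (?s1 (b + 1))"
      "\<forall>r<b + 1. u2 r = ?s1 r"
      using computesD[OF P, of w "b + 1" "?s1" i out] by blast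
    let ?s3 = "u2(b + 2 := u2 b, b + 3 := 0)"
    have 3: "exec w (pcopy b (b + 2) (b + 3)) (u2, i, out) (?s3, i, out)"
      by (rule exec_pcopy) auto
    obtain u4 where 4: "exec w (Q (b + 2)) (?s3, i, out) (u4, i, out)" "u4 (b + 2)
        = g (?s3 (b + 2))"
      "\<forall>r<b + 2. u4 r = ?s3 r"
      using computesD[OF Q, of w "b + 2" "?s3" i out] by blast
    obtain u5 where 5: "exec w (pencode b) (u4, i, out) (u5, i, out)"
      "u5 b = prod_encode (u4 (b + 1), u4 (b + 2))" "\<forall>r<b. u5 r = u4 r"
      using exec_pencode by blast
    show "\<exists>u'. exec w (Seq (pcopy b (b + 1) (b + 2)) (Seq (P (b + 1))
      (Seq (pcopy b (b + 2) (b + 3)) (Seq (Q (b + 2)) (pencode b))))) (u, i, out) (u', i, out) \<and>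
      u' b = prod_encode (f (u b), g (u b)) \<and> (\<forall>r<b. u' r = u r)"
      using 2 4 5 by (intro exI[of _ u5] conjI exec.Seq[OF 1] exec.Seq[OF 2(1)] exec.Seq[OF 3]
          exec.Seq[OF 4(1)]) simp_all
  qed
qed

text \<open>Decoding by counting: each pass goes to the next pair in the order of
  \<open>prod_encode\<close>, one place further on the same diagonal or, at its end, to the first
  pair of the next diagonal.\<close>

definition pdecode :: "nat \<Rightarrow> prog" where
  "pdecode b = While b (Seq (Dec b) (Cond (b + 2) (Seq (Dec (b + 2)) (Inc (b + 1)))
     (Seq (Inc (b + 2)) (pmove (b + 1) (b + 2)))))"

lemma exec_pdecode:
  "\<exists>u'. exec w (pdecode b) (u, i, out) (u', i, out) \<and> u' b = 0 \<and>
     prod_encode (u' (b + 1), u' (b + 2)) = prod_encode (u (b + 1), u (b + 2)) + u b \<and>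
     (\<forall>r<b. u' r = u r)"
proof (induction "u b" arbitrary: u)
  case 0
  then show ?case unfolding pdecode_def by (intro exI[of _ u]) (simp add: exec.While_False)
next
  case (Suc n)
  let ?s1 = "u(b := u b - 1)"
  show ?case
  proof (cases "u (b + 2) = 0")
    case True
    let ?s2 = "?s1(b + 2 := Suc (?s1 (b + 2)))"
    let ?s3 = "?s2(b + 1 := 0, b + 2 := ?s2 (b + 2) + ?s2 (b + 1))"
    have s3: "exec w (Seq (Dec b) (Cond (b + 2) (Seq (Dec (b + 2)) (Inc (b + 1)))
     (Seq (Inc (b + 2)) (pmove (b + 1) (b + 2))))) (u, i, out) (?s3, i, out)"
      using True by (intro exec.Seq[OF exec.Dec] exec.Cond_False exec.Seq[OF exec.Inc] exec_pmove)
          auto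
    obtain u' where s': "exec w (pdecode b) (?s3, i, out) (u', i, out)" "u' b = 0"
      "prod_encode (u' (b + 1), u' (b + 2)) = prod_encode (?s3 (b + 1), ?s3 (b + 2)) + ?s3 b"
      "\<forall>r<b. u' r = ?s3 r"
      using Suc.hyps(1)[of ?s3] Suc.hyps(2)[symmetric] by
          (force simp del: fun_upd_apply simp: fun_upd_same fun_upd_other)
    have "exec w (pdecode b) (u, i, out) (u', i, out)" unfolding pdecode_def
      by (rule exec.While_True[OF _ s3 s'(1)[unfolded pdecode_def]])
          (simp add: Suc.hyps(2)[symmetric])
    then show ?thesis using s' Suc.hyps(2)[symmetric] True
      by (intro exI[of _ u']) (auto simp: prod_encode_def)
  next
    case False
    let ?s2 = "?s1(b + 2 := ?s1 (b + 2) - 1)"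
    let ?s3 = "?s2(b + 1 := Suc (?s2 (b + 1)))"
    have s3: "exec w (Seq (Dec b) (Cond (b + 2) (Seq (Dec (b + 2)) (Inc (b + 1)))
     (Seq (Inc (b + 2)) (pmove (b + 1) (b + 2))))) (u, i, out) (?s3, i, out)"
      using False
      by (intro exec.Seq[OF exec.Dec] exec.Cond_True exec.Seq[OF exec.Dec] exec.Inc) auto
    obtain u' where s': "exec w (pdecode b) (?s3, i, out) (u', i, out)" "u' b = 0"
      "prod_encode (u' (b + 1), u' (b + 2)) = prod_encode (?s3 (b + 1), ?s3 (b + 2)) + ?s3 b"
      "\<forall>r<b. u' r = ?s3 r"
      using Suc.hyps(1)[of ?s3] Suc.hyps(2)[symmetric] by
          (force simp del: fun_upd_apply simp: fun_upd_same fun_upd_other)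
    have "exec w (pdecode b) (u, i, out) (u', i, out)" unfolding pdecode_def
      by (rule exec.While_True[OF _ s3 s'(1)[unfolded pdecode_def]])
          (simp add: Suc.hyps(2)[symmetric])
    moreover obtain k where "u (b + 2) = Suc k" using False not0_implies_Suc by blast
    ultimately show ?thesis using s' Suc.hyps(2)[symmetric]
      by (intro exI[of _ u']) (auto simp: prod_encode_def)
  qed
qed

lemma exec_unpair:
  "\<exists>u'. exec w (Seq (pclear (b + 1)) (Seq (pclear (b + 2)) (pdecode b))) (u, i, out) (u', i, out) \<and>
     u' b = 0 \<and> u' (b + 1) = fst (prod_decode (u b)) \<and> u' (b + 2) = snd (prod_decode (u b)) \<and>
     (\<forall>r<b. u' r = u r)"
proof -
  let ?s = "u(b + 1 := 0, b + 2 := 0)"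
  obtain u' where s': "exec w (pdecode b) (?s, i, out) (u', i, out)" "u' b = 0"
      "prod_encode (u' (b + 1), u' (b + 2)) = prod_encode (?s (b + 1), ?s (b + 2)) + ?s b"
      "\<forall>r<b. u' r = ?s r"
    using exec_pdecode by blast
  have "prod_encode (u' (b + 1), u' (b + 2)) = u b" using s'(3) by (simp add: prod_encode_def)
  then have "prod_decode (u b) = (u' (b + 1), u' (b + 2))" by (metis prod_encode_inverse)
  then show ?thesis using s'
    by (intro exI[of _ u']) (auto intro: exec.Seq[OF exec_pclear] exec.Seq[OF exec_pclear])
qed

lemma cmp_fst: "cmp (\<lambda>x. fst (prod_decode x))"
proof (rule cmpI[of "\<lambda>b. Seq (Seq (pclear (b + 1)) (Seq (pclear (b + 2)) (pdecode b)))
    (pmove (b + 1) b)"], rule computesI)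
  fix w i out and b :: nat and u :: "nat \<Rightarrow> nat"
  obtain u' where 1: "exec w (Seq (pclear (b + 1)) (Seq (pclear (b + 2)) (pdecode b))) (u, i, out)
      (u', i, out)"
     "u' b = 0" "u' (b + 1) = fst (prod_decode (u b))" "\<forall>r<b. u' r = u r"
    using exec_unpair by blast
  show "\<exists>u'. exec w (Seq (Seq (pclear (b + 1)) (Seq (pclear (b + 2)) (pdecode b)))
    (pmove (b + 1) b)) (u, i, out) (u', i, out) \<and> u' b = fst (prod_decode (u b)) \<and>
        (\<forall>r<b. u' r = u r)"
    using 1
    by (intro exI[of _ "u'(b + 1 := 0, b := u' b + u' (b + 1))"] conjI exec.Seq[OF 1(1)] exec_pmove)
        auto
qed

lemma cmp_snd: "cmp (\<lambda>x. snd (prod_decode x))"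
proof (rule cmpI[of "\<lambda>b. Seq (Seq (pclear (b + 1)) (Seq (pclear (b + 2)) (pdecode b)))
    (pmove (b + 2) b)"], rule computesI)
  fix w i out and b :: nat and u :: "nat \<Rightarrow> nat"
  obtain u' where 1: "exec w (Seq (pclear (b + 1)) (Seq (pclear (b + 2)) (pdecode b))) (u, i, out)
      (u', i, out)"
     "u' b = 0" "u' (b + 2) = snd (prod_decode (u b))" "\<forall>r<b. u' r = u r"
    using exec_unpair by blast
  show "\<exists>u'. exec w (Seq (Seq (pclear (b + 1)) (Seq (pclear (b + 2)) (pdecode b)))
    (pmove (b + 2) b)) (u, i, out) (u', i, out) \<and> u' b = snd (prod_decode (u b)) \<and>
        (\<forall>r<b. u' r = u r)"
    using 1
    by (intro exI[of _ "u'(b + 2 := 0, b := u' b + u' (b + 2))"] conjI exec.Seq[OF 1(1)] exec_pmove)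
        auto
qed

text \<open>Since \<open>cmp\<close> covers total functions only, the loop has to end for every
  number x, also for numbers that code nothing. This is the origin of the surjectivity assumption in
  \<open>computable_Least\<close>.\<close>

lemma cmp_until:
  assumes "cmp c" and "cmp g" and "cmp a" and "\<And>x. \<exists>n. c ((g ^^ n) (a x)) = 0"
  shows "cmp (\<lambda>x. (g ^^ (LEAST n. c ((g ^^ n) (a x)) = 0)) (a x))"
proof -
  obtain P Q A where P: "computes P c" and Q: "computes Q g" and A: "computes A a"
    using assms unfolding cmp_def by blast
  define test where "test b = Seq (pcopy b (b + 1) (b + 2)) (P (b + 1))" for b
  have test: "\<exists>u'. exec w (test b) (u, i, out) (u', i, out) \<and> u' (b + 1) = c (u b) \<and>
      (\<forall>r\<le>b. u' r = u r)" for w b u i out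
  proof -
    let ?s1 = "u(b + 1 := u b, b + 2 := 0)"
    have 1: "exec w (pcopy b (b + 1) (b + 2)) (u, i, out) (?s1, i, out)"
      by (rule exec_pcopy) auto
    obtain u2 where 2: "exec w (P (b + 1)) (?s1, i, out) (u2, i, out)" "u2 (b + 1)
        = c (?s1 (b + 1))"
      "\<forall>r<b + 1. u2 r = ?s1 r"
      using computesD[OF P, of w "b + 1" "?s1" i out] by blast
    then show ?thesis unfolding test_def
      by (intro exI[of _ u2] conjI exec.Seq[OF 1]) auto
  qed
  have loop: "\<exists>u'. exec w (While (b + 1) (Seq (Q b) (test b))) (u, i, out) (u', i, out) \<and>
      u' b = (g ^^ n) (u b) \<and> (\<forall>r<b. u' r = u r)"
    if "u (b + 1) = c (u b)" "c ((g ^^ n) (u b)) = 0" "\<forall>m<n. c ((g ^^ m) (u b)) \<noteq> 0"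
        for w b u i out n
    using that
  proof (induction n arbitrary: u)
    case 0
    then show ?case by (intro exI[of _ u]) (simp add: exec.While_False)
  next
    case (Suc n)
    obtain u1 where 1: "exec w (Q b) (u, i, out) (u1, i, out)" "u1 b = g (u b)"
      "\<forall>r<b. u1 r = u r"
      using computesD[OF Q, of w "b" "u" i out] by blast
    obtain u2 where 2: "exec w (test b) (u1, i, out) (u2, i, out)" "u2 (b + 1) = c (u1 b)"
      "\<forall>r\<le>b. u2 r = u1 r"
      using test by blast
    have b2: "u2 b = g (u b)" using 1 2 by simp
    have "\<exists>u'. exec w (While (b + 1) (Seq (Q b) (test b))) (u2, i, out) (u', i, out) \<and>
      u' b = (g ^^ n) (u2 b) \<and> (\<forall>r<b. u' r = u2 r)"
    proof (rule Suc.IH)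
      show "c ((g ^^ n) (u2 b)) = 0" using Suc.prems(2) b2 by (simp add: funpow_swap1)
      show "\<forall>m<n. c ((g ^^ m) (u2 b)) \<noteq> 0"
      proof (intro allI impI)
        fix m assume "m < n"
        then have "c ((g ^^ Suc m) (u b)) \<noteq> 0" using Suc.prems(3) by blast
        then show "c ((g ^^ m) (u2 b)) \<noteq> 0" by (simp add: b2 funpow_swap1)
      qed
    qed (use b2 2 1 in simp)
    then obtain u' where 3: "exec w (While (b + 1) (Seq (Q b) (test b))) (u2, i, out) (u', i, out)"
      "u' b = (g ^^ n) (u2 b)" "\<forall>r<b. u' r = u2 r" by blast
    have "u (b + 1) \<noteq> 0" using Suc.prems by (metis funpow_0 zero_less_Suc)
    then have "exec w (While (b + 1) (Seq (Q b) (test b))) (u, i, out) (u', i, out)"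
      by - (rule exec.While_True[OF _ exec.Seq[OF 1(1) 2(1)] 3(1)], simp)
    then show ?case using 1 2 3 by (intro exI[of _ u']) (auto simp: b2 funpow_swap1)
  qed
  show ?thesis
  proof (rule cmpI[of "\<lambda>b. Seq (A b) (Seq (test b) (While (b + 1) (Seq (Q b) (test b))))"], rule
      computesI)
    fix w i out and b :: nat and u :: "nat \<Rightarrow> nat"
    let ?x = "a (u b)"
    let ?n = "LEAST n. c ((g ^^ n) ?x) = 0"
    obtain u0 where 0: "exec w (A b) (u, i, out) (u0, i, out)" "u0 b = ?x" "\<forall>r<b. u0 r = u r"
      using computesD[OF A, of w b u i out] by blast
    obtain u1 where 1: "exec w (test b) (u0, i, out) (u1, i, out)" "u1 (b + 1) = c (u0 b)"
      "\<forall>r\<le>b. u1 r = u0 r"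
      using test by blast
    have "c ((g ^^ ?n) ?x) = 0" using assms(4) by (rule LeastI_ex)
    moreover have "\<forall>m<?n. c ((g ^^ m) ?x) \<noteq> 0" using not_less_Least by blast
    ultimately obtain u2 where 2: "exec w (While (b + 1) (Seq (Q b) (test b))) (u1, i, out) (u2, i,
        out)"
      "u2 b = (g ^^ ?n) (u1 b)" "\<forall>r<b. u2 r = u1 r"
      using loop[of u1 b ?n w i out] 0 1 by auto
    show "\<exists>u'. exec w (Seq (A b) (Seq (test b) (While (b + 1) (Seq (Q b) (test b))))) (u, i, out)
        (u', i, out) \<and>
      u' b = (g ^^ ?n) ?x \<and> (\<forall>r<b. u' r = u r)"
      using 0 1 2 exec.Seq[OF 0(1) exec.Seq[OF 1(1) 2(1)]] by (intro exI[of _ u2]) auto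
  qed
qed

section \<open>Computable functions on coded types\<close>

text \<open>Injectivity is all that is demanded, since the codes of a type such as
  \<open>bool\<close> do not exhaust the natural numbers.\<close>

class coded =
  fixes enc :: "'a \<Rightarrow> nat"
  assumes enc_eq [simp]: "enc x = enc y \<longleftrightarrow> x = y"

instantiation nat :: coded
begin
definition enc_nat :: "nat \<Rightarrow> nat" where [simp]: "enc_nat n = n"
instance by standard simp
end

instantiation bool :: coded
begin
definition enc_bool :: "bool \<Rightarrow> nat" where [simp]: "enc_bool b = of_bool b"
instance by standard (simp add: of_bool_eq_iff)
end

instantiation int :: coded
begin
definition enc_int :: "int \<Rightarrow> nat" where [simp]: "enc_int i = int_encode i"
instance by standard (simp add: int_encode_eq)
end

instantiation prod :: (coded, coded) coded
begin
definition enc_prod :: "'a \<times> 'b \<Rightarrow> nat" where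
  [simp]: "enc_prod z = prod_encode (enc (fst z), enc (snd z))"
instance by standard (auto simp: prod_eq_iff)
end

instantiation list :: (coded) coded
begin
definition enc_list :: "'a list \<Rightarrow> nat" where [simp]: "enc_list xs = list_encode (map enc xs)"
instance by standard (simp add: list_encode_eq inj_map_eq_map inj_def)
end

text \<open>With functions at their own types, closure under the usual operations becomes a set of
  introduction rules, and functions assembled from these operations require no register programs of
  their own.\<close>

definition computable :: "('a::coded \<Rightarrow> 'b::coded) \<Rightarrow> bool" where
  "computable f \<longleftrightarrow> (\<exists>g. cmp g \<and> (\<forall>x. g (enc x) = enc (f x)))"

named_theorems computable_intros

lemma computableI: "cmp g \<Longrightarrow> (\<And>x. g (enc x) = enc (f x)) \<Longrightarrow> computable f"
  unfolding computable_def by blast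

lemma computable_nat_iff: "computable (f :: nat \<Rightarrow> nat) \<longleftrightarrow> cmp f"
proof -
  have "g = f" if "\<forall>x. g x = f x" for g using that by auto
  then show ?thesis unfolding computable_def by auto
qed

lemma computable_id [computable_intros]: "computable (\<lambda>x. x)"
  by (rule computableI[OF cmp_id]) simp

lemma cmp_const: "cmp (\<lambda>x. c)"
  by (induction c) (simp_all add: cmp_zero cmp_comp[OF cmp_Suc])

lemma computable_const [computable_intros]: "computable (\<lambda>x. c)"
  by (rule computableI[OF cmp_const]) simp

lemma computable_comp:
  assumes "computable f" and "computable g"
  shows "computable (\<lambda>x. f (g x))"
proof -
  obtain f' g' where "cmp f'" "\<forall>x. f' (enc x) = enc (f x)" "cmp g'" "\<forall>x. g' (enc x) = enc (g x)"
    using assms unfolding computable_def by blast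
  then show ?thesis by (intro computableI[OF cmp_comp[of f' g']]) auto
qed

lemma computable_Pair [computable_intros]:
  assumes "computable f" and "computable g"
  shows "computable (\<lambda>x. (f x, g x))"
proof -
  obtain f' g' where "cmp f'" "\<forall>x. f' (enc x) = enc (f x)" "cmp g'" "\<forall>x. g' (enc x) = enc (g x)"
    using assms unfolding computable_def by blast
  then show ?thesis by (intro computableI[OF cmp_pair[of f' g']]) auto
qed

lemma computable_fst [computable_intros]: "computable f \<Longrightarrow> computable (\<lambda>x. fst (f x))"
  by (rule computable_comp[of fst], rule computableI[OF cmp_fst]) simp

lemma computable_snd [computable_intros]: "computable f \<Longrightarrow> computable (\<lambda>x. snd (f x))"
  by (rule computable_comp[of snd], rule computableI[OF cmp_snd]) simp

lemma computable_comp2: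
  assumes "computable (\<lambda>z. h (fst z) (snd z))" and "computable f" and "computable g"
  shows "computable (\<lambda>x. h (f x) (g x))"
  using computable_comp[OF assms(1) computable_Pair[OF assms(2,3)]] by simp

lemma computable_comp3:
  assumes "computable (\<lambda>z. h (fst z) (fst (snd z)) (snd (snd z)))"
    and "computable f" and "computable g" and "computable k"
  shows "computable (\<lambda>x. h (f x) (g x) (k x))"
  using computable_comp[OF assms(1) computable_Pair[OF assms(2) computable_Pair[OF assms(3,4)]]]
      by simp

text \<open>Decoding functions such as \<open>list_decode\<close> do nothing on the level of codes:
  the code of the result is the argument itself.\<close>

lemma computable_recode:
  assumes "computable f" and "\<And>x. enc (r x) = enc x"
  shows "computable (\<lambda>x. r (f x))"
  using assms unfolding computable_def by auto

lemma computable_enc [computable_intros]: "computable f \<Longrightarrow> computable (\<lambda>x. enc (f x))"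
  by (erule computable_recode) simp

lemma computable_prod_decode [computable_intros]:
  "computable f \<Longrightarrow> computable (\<lambda>x. prod_decode (f x))"
  by (erule computable_recode) simp

lemma computable_prod_encode [computable_intros]:
  "computable f \<Longrightarrow> computable (\<lambda>x. prod_encode (f x))"
  by (erule computable_recode) simp

lemma computable_list_decode [computable_intros]:
  "computable f \<Longrightarrow> computable (\<lambda>x. list_decode (f x))"
  by (erule computable_recode) (simp add: enc_nat_def[abs_def])

lemma computable_list_encode [computable_intros]:
  "computable f \<Longrightarrow> computable (\<lambda>x. list_encode (f x))"
  by (erule computable_recode) (simp add: enc_nat_def[abs_def])

lemma computable_int_decode [computable_intros]:
  "computable f \<Longrightarrow> computable (\<lambda>x. int_decode (f x))"
  by (erule computable_recode) simp

lemma computable_int_encode [computable_intros]: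
  "computable f \<Longrightarrow> computable (\<lambda>x. int_encode (f x))"
  by (erule computable_recode) simp

lemma computable_of_bool [computable_intros]:
  "computable f \<Longrightarrow> computable (\<lambda>x. of_bool (f x) :: nat)"
  by (erule computable_recode) simp

lemma computable_Suc [computable_intros]: "computable f \<Longrightarrow> computable (\<lambda>x. Suc (f x))"
  by (rule computable_comp[of Suc]) (auto simp: computable_nat_iff cmp_Suc)

subsection \<open>Iteration and recursion\<close>

text \<open>The number of remaining rounds is carried along in the second component. It reaches 0
  after exactly \<open>n x\<close> rounds, whatever x is, so the loop of \<open>cmp_until\<close>
  always ends.\<close>

lemma cmp_iterate:
  assumes g: "cmp g" and n: "cmp n" and a: "cmp a"
  shows "cmp (\<lambda>x. (g ^^ n x) (a x))"
proof -
  let ?G = "\<lambda>z. prod_encode (g (fst (prod_decode z)), snd (prod_decode z) - 1)"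
  have G: "cmp ?G" by (intro cmp_pair cmp_comp[OF g cmp_fst] cmp_comp[OF cmp_pred cmp_snd])
  have G_pow: "(?G ^^ k) (prod_encode (y, m)) = prod_encode ((g ^^ k) y, m - k)" for k y m
    by (induction k) auto
  have "(LEAST k. snd (prod_decode ((?G ^^ k) (prod_encode (a x, n x)))) = 0) = n x" for x
    unfolding G_pow by (rule Least_equality) auto
  then have "cmp (\<lambda>x. fst (prod_decode ((?G ^^ n x) (prod_encode (a x, n x)))))"
    using cmp_comp[OF cmp_fst cmp_until[OF cmp_snd G cmp_pair[OF a n]]] G_pow by auto
  then show ?thesis unfolding G_pow by simp
qed

text \<open>A function iterated by \<open>cmp_iterate\<close> takes no parameter, so x travels
  unchanged in the first component of the state.\<close>

lemma computable_funpow [computable_intros]: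
  fixes s :: "'a::coded \<Rightarrow> 'b::coded \<Rightarrow> 'b"
  assumes s: "computable (\<lambda>z. s (fst z) (snd z))" and n: "computable n" and a: "computable a"
  shows "computable (\<lambda>x. (s x ^^ n x) (a x))"
proof -
  obtain s' n' a' where s': "cmp s'" "\<And>x y. s' (prod_encode (enc x, enc y)) = enc (s x y)"
    and n': "cmp n'" "\<And>x. n' (enc x) = n x" and a': "cmp a'" "\<And>x. a' (enc x) = enc (a x)"
    using assms unfolding computable_def by auto
  let ?G = "\<lambda>z. prod_encode (fst (prod_decode z), s' z)"
  have "cmp (\<lambda>x. snd (prod_decode ((?G ^^ n' x) (prod_encode (x, a' x)))))"
    by (intro cmp_comp[OF cmp_snd] cmp_iterate cmp_pair cmp_fst cmp_id s' n' a')
  moreover have "(?G ^^ k) (prod_encode (enc x, enc y)) = prod_encode (enc x, enc ((s x ^^ k) y))"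
      for k x y
    by (induction k) (auto simp: s')
  ultimately show ?thesis by (intro computableI[of "\<lambda>x. snd (prod_decode ((?G ^^ n' x) (prod_encode
      (x, a' x))))"])
    (auto simp: n' a')
qed

lemma computable_rec_nat [computable_intros]:
  assumes "computable a" and s: "computable (\<lambda>z. s (fst z) (fst (snd z)) (snd (snd z)))"
      and "computable n"
  shows "computable (\<lambda>x. rec_nat (a x) (s x) (n x))"
proof -
  have "((\<lambda>z. (Suc (fst z), s x (fst z) (snd z))) ^^ k) (0, y) = (k, rec_nat y (s x) k)" for x y k
    by (induction k) auto
  then have "rec_nat (a x) (s x) (n x) =
      snd (((\<lambda>x z. (Suc (fst z), s x (fst z) (snd z))) x ^^ n x) (0, a x))" for x
    by simp
  moreover have "computable (\<lambda>z. s (fst z) (fst (snd z)) (snd (snd z)))" by (rule s)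
  ultimately show ?thesis
    by (simp only:) (intro computable_intros assms)
qed

lemma computable_case_nat [computable_intros]:
  assumes "computable n" and "computable a" and "computable (\<lambda>z. f (fst z) (snd z))"
  shows "computable (\<lambda>x. case n x of 0 \<Rightarrow> a x | Suc m \<Rightarrow> f x m)"
proof -
  have "(case n x of 0 \<Rightarrow> a x | Suc m \<Rightarrow> f x m) = rec_nat (a x) ((\<lambda>x m r. f x m) x) (n x)" for x
    by (cases "n x") auto
  moreover have "computable (\<lambda>z. f (fst z) (fst (snd z)))"
    using assms(3) by (rule computable_comp2) (intro computable_intros)+
  ultimately show ?thesis by (simp only:) (intro computable_rec_nat assms)
qed

lemma computable_if [computable_intros]:
  assumes "computable P" and "computable f" and "computable g"
  shows "computable (\<lambda>x. if P x then f x else g x)"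
proof -
  have "(if P x then f x else g x) = (case of_bool (P x) :: nat of 0 \<Rightarrow> g x | Suc m \<Rightarrow> f x)" for x
    by simp
  moreover have "computable (\<lambda>z. f (fst z))" using assms(2) by (rule computable_comp)
      (intro computable_intros)
  ultimately show ?thesis by (simp only:) (intro computable_case_nat computable_of_bool assms)
qed

lemma computable_not [computable_intros]: "computable P \<Longrightarrow> computable (\<lambda>x. \<not> P x)"
proof -
  assume P: "computable P"
  have "(\<not> P x) = (if P x then False else True)" for x by simp
  then show ?thesis by (simp only:) (intro computable_if computable_const P)
qed

lemma computable_conj [computable_intros]:
  assumes "computable P" and "computable Q"
  shows "computable (\<lambda>x. P x \<and> Q x)"
proof -
  have "(P x \<and> Q x) = (if P x then Q x else False)" for x by simp
  then show ?thesis by (simp only:) (intro computable_if computable_const assms)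
qed

subsection \<open>Arithmetic\<close>

lemma computable_add_nat [computable_intros]:
  fixes f g :: "_ \<Rightarrow> nat"
  assumes "computable f" and "computable g"
  shows "computable (\<lambda>x. f x + g x)"
proof -
  have "(Suc ^^ m) n = m + n" for m n by (induction m) auto
  then have "f x + g x = ((\<lambda>x. Suc) x ^^ f x) (g x)" for x by simp
  then show ?thesis by (simp only:) (intro computable_intros assms)
qed

lemma computable_diff_nat [computable_intros]:
  fixes f g :: "_ \<Rightarrow> nat"
  assumes "computable f" and "computable g"
  shows "computable (\<lambda>x. f x - g x)"
proof -
  have "((\<lambda>k. k - 1) ^^ m) n = n - m" for m n :: nat by (induction m) auto
  then have "f x - g x = ((\<lambda>x k. k - 1) x ^^ g x) (f x)" for x by simp
  moreover have "computable (\<lambda>z. snd z - 1 :: nat)" for z :: "'a \<times> nat"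
    by (rule computable_comp[of "\<lambda>k. k - 1"])
        (simp_all add: computable_nat_iff cmp_pred[unfolded One_nat_def] computable_intros)
  ultimately show ?thesis by (simp only:)
      (intro computable_funpow assms; simp add: computable_intros)
qed

lemma computable_mult_nat [computable_intros]:
  fixes f g :: "_ \<Rightarrow> nat"
  assumes "computable f" and "computable g"
  shows "computable (\<lambda>x. f x * g x)"
proof -
  have "((\<lambda>k. k + n) ^^ m) 0 = m * n" for m n :: nat by (induction m) auto
  then have "f x * g x = ((\<lambda>x k. k + g x) x ^^ f x) 0" for x by simp
  moreover have "computable (\<lambda>z. snd z + g (fst z))"
    by (intro computable_intros computable_comp[OF assms(2)])
  ultimately show ?thesis by (simp only:) (intro computable_funpow computable_const assms)
qed

lemma computable_power_nat [computable_intros]: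
  fixes f g :: "_ \<Rightarrow> nat"
  assumes "computable f" and "computable g"
  shows "computable (\<lambda>x. f x ^ g x)"
proof -
  have "((\<lambda>k. n * k) ^^ m) 1 = n ^ m" for m n :: nat by (induction m) auto
  then have "f x ^ g x = ((\<lambda>x k. f x * k) x ^^ g x) 1" for x by simp
  moreover have "computable (\<lambda>z. f (fst z) * snd z)"
    by (intro computable_intros computable_comp[OF assms(1)])
  ultimately show ?thesis by (simp only:) (intro computable_funpow computable_const assms)
qed

lemma computable_eq_0 [computable_intros]:
  "computable (f :: _ \<Rightarrow> nat) \<Longrightarrow> computable (\<lambda>x. f x = 0)"
proof -
  assume f: "computable f"
  have "(f x = 0) = (case f x of 0 \<Rightarrow> True | Suc m \<Rightarrow> False)" for x by (simp split: nat.split)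
  then show ?thesis by (simp only:) (intro computable_intros f)
qed

lemma computable_le_nat [computable_intros]:
  fixes f g :: "_ \<Rightarrow> nat"
  assumes "computable f" and "computable g"
  shows "computable (\<lambda>x. f x \<le> g x)"
  using computable_eq_0[OF computable_diff_nat[OF assms]] by simp

lemma computable_less_nat [computable_intros]:
  fixes f g :: "_ \<Rightarrow> nat"
  assumes "computable f" and "computable g"
  shows "computable (\<lambda>x. f x < g x)"
  using computable_not[OF computable_le_nat[OF assms(2,1)]] by (simp add: not_le)

lemma computable_eq [computable_intros]:
  assumes "computable f" and "computable g"
  shows "computable (\<lambda>x. f x = g x)"
proof -
  have "(f x = g x) = (enc (f x) \<le> enc (g x) \<and> enc (g x) \<le> enc (f x))" for x
    by (metis enc_eq le_antisym order_refl)
  then show ?thesis by (simp only:) (intro computable_intros assms)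
qed

lemma computable_even [computable_intros]: 
  assumes f: "computable (f :: _ \<Rightarrow> nat)" shows "computable (\<lambda>x. even (f x))"
proof -
  have "rec_nat True (\<lambda>_ b. \<not> b) n = even n" for n by (induction n) auto
  then have "even (f x) = rec_nat True ((\<lambda>x _ b. \<not> b) x) (f x)" for x by simp
  then show ?thesis by (simp only:) (intro computable_intros f)
qed

lemma computable_half [computable_intros]:
  assumes f: "computable (f :: _ \<Rightarrow> nat)" shows "computable (\<lambda>x. f x div 2)"
proof -
  have "rec_nat 0 (\<lambda>i r. if even i then r else Suc r) n = n div 2" for n by (induction n) auto
  then have "f x div 2 = rec_nat 0 ((\<lambda>x i r. if even i then r else Suc r) x) (f x)" for x by simp
  then show ?thesis by (simp only:) (intro computable_intros f)
qed

lemma computable_nat [computable_intros]: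
  assumes f: "computable f" shows "computable (\<lambda>x. nat (f x))"
proof -
  \<comment> \<open>\<open>int_encode\<close> gives the even codes to nonnegative integers and the
    odd ones to negative integers.\<close>
  have "nat i = (if even (enc i) then enc i div 2 else 0)" for i
    by (simp add: int_encode_def sum_encode_def)
  then show ?thesis by (simp only:) (intro computable_intros f)
qed

text \<open>Sums and products of integers reduce to this difference by splitting both arguments into
  positive and negative parts.\<close>

lemma computable_int_diff:
  assumes "computable f" and "computable g"
  shows "computable (\<lambda>x. int (f x) - int (g x))"
proof -
  have "int m - int n = int_decode (if n \<le> m then 2 * (m - n) else Suc (2 * (n - m - 1)))" for m n
    by (auto simp: int_decode_def sum_decode_def)
  then show ?thesis by (simp only:) (intro computable_intros assms)
qed

lemma computable_uminus_int [computable_intros]: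
  assumes f: "computable (f :: _ \<Rightarrow> int)" shows "computable (\<lambda>x. - f x)"
proof -
  have i: "- i = int_decode (if even (enc i) then 2 * (enc i div 2) - 1 else Suc (enc i))" for i
  proof (cases i rule: int_cases2)
    case (nonneg n)
    then show ?thesis by (cases n) (simp_all add: int_encode_def sum_encode_def int_decode_def
        sum_decode_def)
  next
    case (nonpos n)
    then show ?thesis by (cases n) (simp_all add: int_encode_def sum_encode_def int_decode_def
        sum_decode_def)
  qed
  show ?thesis by (subst i) (intro computable_intros f)
qed

lemma computable_int [computable_intros]:
  assumes f: "computable f" shows "computable (\<lambda>x. int (f x))"
  using computable_int_diff[OF f computable_const[of 0]] by simp

lemma computable_add_int [computable_intros]:
  fixes f g :: "_ \<Rightarrow> int"
  assumes "computable f" and "computable g"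
  shows "computable (\<lambda>x. f x + g x)"
proof -
  have "i + j = int (nat i + nat j) - int (nat (- i) + nat (- j))" for i j by simp
  then show ?thesis by (simp only:) (intro computable_intros computable_int_diff assms)
qed

lemma computable_mult_int [computable_intros]:
  fixes f g :: "_ \<Rightarrow> int"
  assumes "computable f" and "computable g"
  shows "computable (\<lambda>x. f x * g x)"
proof -
  have "i * j = int (nat i * nat j + nat (- i) * nat (- j)) - int (nat i * nat (- j) + nat (- i) *
      nat j)" for i j
    by (cases "0 \<le> i"; cases "0 \<le> j") auto
  then show ?thesis by (simp only:) (intro computable_intros computable_int_diff assms)
qed

lemma computable_less_int [computable_intros]:
  fixes f g :: "_ \<Rightarrow> int"
  assumes "computable f" and "computable g"
  shows "computable (\<lambda>x. f x < g x)"
proof -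
  have "i < j \<longleftrightarrow> nat i + nat (- j) < nat j + nat (- i)" for i j by linarith
  then show ?thesis by (simp only:) (intro computable_intros assms)
qed

subsection \<open>Lists\<close>

lemma computable_Cons [computable_intros]:
  assumes "computable f" and "computable g"
  shows "computable (\<lambda>x. f x # g x)"
proof -
  obtain f' g' where "cmp f'" "\<forall>x. f' (enc x) = enc (f x)" "cmp g'" "\<forall>x. g' (enc x) = enc (g x)"
    using assms unfolding computable_def by blast
  then show ?thesis by (intro computableI[OF cmp_comp[OF cmp_Suc cmp_pair[of f' g']]]) auto
qed

text \<open>A list code is 0 or the successor of a pair code, so this is a case distinction on
  natural numbers.\<close>

lemma computable_case_list [computable_intros]:
  assumes "computable xs" and "computable a"
      and "computable (\<lambda>z. f (fst z) (fst (snd z)) (snd (snd z)))"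
  shows "computable (\<lambda>x. case xs x of [] \<Rightarrow> a x | y # ys \<Rightarrow> f x y ys)"
proof -
  obtain xs' a' f' where xs': "cmp xs'" "\<And>x. xs' (enc x) = list_encode (map enc (xs x))"
    and a': "cmp a'" "\<And>x. a' (enc x) = enc (a x)"
    and f': "cmp f'" "\<And>x y ys. f' (prod_encode (enc x, prod_encode (enc y, list_encode (map enc
        ys)))) = enc (f x y ys)"
    using assms unfolding computable_def by auto
  let ?g = "\<lambda>n. case xs' n of 0 \<Rightarrow> a' n | Suc m \<Rightarrow> f' (prod_encode (n, m))"
  have "computable ?g"
    by (rule computable_case_nat[OF _ _ computable_comp])
      (use xs' a' f' in \<open>simp_all add: computable_nat_iff computable_intros\<close>)
  then have "cmp ?g" by (simp only: computable_nat_iff)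
  moreover have "?g (enc x) = enc (case xs x of [] \<Rightarrow> a x | y # ys \<Rightarrow> f x y ys)" for x
    by (cases "xs x") (auto simp: xs' a' f')
  ultimately show ?thesis by (rule computableI)
qed

lemma length_le_list_encode: "length xs \<le> list_encode xs"
proof (induction xs)
  case (Cons x xs)
  then show ?case using le_prod_encode_2[of "list_encode xs" x] by simp
qed simp

text \<open>The fold becomes an iteration, whose number of rounds must be given beforehand. The code
  of a list bounds its length, and surplus rounds on the empty list change nothing.\<close>

lemma computable_fold [computable_intros]:
  assumes f: "computable (\<lambda>z. f (fst z) (fst (snd z)) (snd (snd z)))" and xs: "computable xs"
      and a: "computable a"
  shows "computable (\<lambda>x. fold (f x) (xs x) (a x))"
proof -
  let ?s = "\<lambda>x z. case fst z of [] \<Rightarrow> ([], snd z) | y # ys \<Rightarrow> (ys, f x y (snd z))"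
  have pow: "(?s x ^^ n) (ys, b) = ([], fold (f x) ys b)" if "length ys \<le> n" for x ys b n
    using that
  proof (induction n arbitrary: ys b)
    case (Suc n)
    then show ?case unfolding funpow_Suc_right comp_apply by (cases ys) (simp_all del: funpow.simps)
  qed simp
  have "fold (f x) (xs x) (a x) = snd ((?s x ^^ enc (xs x)) (xs x, a x))" for x
    using pow[of "xs x" "enc (xs x)"] length_le_list_encode[of "map enc (xs x)"] by simp
  moreover have "computable (\<lambda>z. f (fst (fst z)) (fst (snd z)) (snd (snd (fst z))))"
    by (intro computable_comp3[OF f] computable_intros)
  ultimately show ?thesis
    by (simp only:) (intro computable_intros xs a, simp add: computable_comp3[OF f]
        computable_intros)
qed

lemma computable_rev [computable_intros]:
  assumes xs: "computable xs" shows "computable (\<lambda>x. rev (xs x))"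
proof -
  have "rev (xs x) = fold ((\<lambda>x. (#)) x) (xs x) []" for x by (simp add: fold_Cons_rev)
  then show ?thesis by (simp only:) (intro computable_intros xs)
qed

lemma computable_map [computable_intros]:
  assumes f: "computable (\<lambda>z. f (fst z) (snd z))" and xs: "computable xs"
  shows "computable (\<lambda>x. map (f x) (xs x))"
proof -
  have "fold (\<lambda>y ys. f x y # ys) zs ys = rev (map (f x) zs) @ ys" for x zs ys
    by (induction zs arbitrary: ys) auto
  then have "map (f x) (xs x) = rev (fold ((\<lambda>x y ys. f x y # ys) x) (xs x) [])" for x by simp
  moreover have "computable (\<lambda>z. f (fst z) (fst (snd z)))"
    by (intro computable_comp2[OF f] computable_intros)
  ultimately show ?thesis by (simp only:) (intro computable_intros xs)
qed

lemma computable_length [computable_intros]: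
  assumes xs: "computable xs" shows "computable (\<lambda>x. length (xs x))"
proof -
  have "fold (\<lambda>_. Suc) ys n = length ys + n" for ys :: "'b list" and n by
      (induction ys arbitrary: n) auto
  then have "length (xs x) = fold ((\<lambda>x _. Suc) x) (xs x) 0" for x by simp
  then show ?thesis by (simp only:) (intro computable_intros xs)
qed

lemma computable_append [computable_intros]:
  assumes "computable xs" and "computable ys" shows "computable (\<lambda>x. xs x @ ys x)"
proof -
  have "us @ vs = fold (#) (rev us) vs" for us vs :: "'b list" by (simp add: fold_Cons_rev)
  then have "xs x @ ys x = fold ((\<lambda>x. (#)) x) (rev (xs x)) (ys x)" for x by simp
  then show ?thesis by (simp only:) (intro computable_intros assms)
qed

lemma computable_upt [computable_intros]:
  assumes n: "computable n" shows "computable (\<lambda>x. [0..<n x])"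
proof -
  have "rec_nat [] (\<lambda>i r. r @ [i]) k = [0..<k]" for k by (induction k) auto
  then have "[0..<n x] = rec_nat [] ((\<lambda>x i r. r @ [i]) x) (n x)" for x by simp
  then show ?thesis by (simp only:) (intro computable_intros n)
qed

text \<open>The default takes the place of \<open>!\<close>, whose value beyond the end of a list is
  unspecified.\<close>

lemma computable_nth_default [computable_intros]:
  assumes "computable d" and "computable xs" and "computable n"
  shows "computable (\<lambda>x. nth_default (d x) (xs x) (n x))"
proof -
  have tl: "(tl ^^ k) ys = drop k ys" for k and ys :: "'b list" by (induction k)
      (auto simp: drop_Suc tl_drop)
  have "nth_default d ys k = (case (tl ^^ k) ys of [] \<Rightarrow> d | y # _ \<Rightarrow> y)" for d :: 'b and ys k
    unfolding tl by (cases "k < length ys")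
        (auto simp: nth_default_def Cons_nth_drop_Suc[symmetric])
  moreover have "tl = (\<lambda>ys. case ys of [] \<Rightarrow> [] | z # zs \<Rightarrow> (zs :: 'b list))"
    by (auto split: list.split)
  ultimately have eq: "nth_default (d x) (xs x) (n x)
      = (case ((\<lambda>x ys. case ys of [] \<Rightarrow> [] | z # zs \<Rightarrow> zs) x ^^ n x)
      (xs x) of [] \<Rightarrow> d x | y # ys \<Rightarrow> y)" for x
    by (simp only:)
  show ?thesis unfolding eq by (intro computable_intros assms)
qed

subsection \<open>Unbounded search and finite tables\<close>

lemma surj_enc_nat: "surj (enc :: nat \<Rightarrow> nat)"
  by (simp add: surj_def)

lemma surj_enc_prod:
  assumes "surj (enc :: 'a::coded \<Rightarrow> nat)" and "surj (enc :: 'b::coded \<Rightarrow> nat)"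
  shows "surj (enc :: 'a \<times> 'b \<Rightarrow> nat)"
  unfolding surj_def
proof
  fix n
  obtain a :: 'a where "fst (prod_decode n) = enc a" using assms(1) by (metis surjD)
  moreover obtain b :: 'b where "snd (prod_decode n) = enc b" using assms(2) by (metis surjD)
  ultimately have "prod_decode n = (enc a, enc b)" by (simp add: prod_eq_iff)
  then have "n = enc (a, b)" by (metis prod_decode_inverse enc_prod_def fst_conv snd_conv)
  then show "\<exists>x :: 'a \<times> 'b. n = enc x" by blast
qed

text \<open>The search carries the code of x along with the candidate. As every number is the code
  of some x, the search ends on all numbers, as \<open>cmp_until\<close> demands.\<close>

lemma computable_Least:
  fixes P :: "'a::coded \<Rightarrow> nat \<Rightarrow> bool"
  assumes P: "computable (\<lambda>z. P (fst z) (snd z))" and surj: "surj (enc :: 'a \<Rightarrow> nat)"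
    and ex: "\<And>x. \<exists>n. P x n"
  shows "computable (\<lambda>x. LEAST n. P x n)"
proof -
  obtain P' where P': "cmp P'" "\<And>x n. P' (prod_encode (enc x, n)) = of_bool (P x n)"
    using P unfolding computable_def by auto
  let ?G = "\<lambda>z. prod_encode (fst (prod_decode z), Suc (snd (prod_decode z)))"
  let ?c = "\<lambda>z. 1 - P' z"
  have c: "cmp ?c"
  proof -
    have "computable (\<lambda>z. 1 - P' z)" by (intro computable_intros) (simp add: computable_nat_iff P')
    then show ?thesis by (simp add: computable_nat_iff)
  qed
  have G: "cmp ?G" by (intro cmp_pair cmp_fst cmp_comp[OF cmp_Suc cmp_snd])
  have G_pow: "(?G ^^ k) (prod_encode (y, m)) = prod_encode (y, m + k)" for k y m
    by (induction k) auto
  have hit: "?c ((?G ^^ k) (prod_encode (enc x, 0))) = 0 \<longleftrightarrow> P x k" for x k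
    unfolding G_pow by (simp add: P')
  have "\<exists>k. ?c ((?G ^^ k) (prod_encode (m, 0))) = 0" for m
  proof -
    obtain x :: 'a where x: "m = enc x" using surj by (metis surjD)
    show ?thesis unfolding x hit by (rule ex)
  qed
  from cmp_comp[OF cmp_snd cmp_until[OF c G cmp_pair[OF cmp_id cmp_zero] this]]
  have "cmp (\<lambda>x. snd (prod_decode ((?G ^^ (LEAST n. ?c ((?G ^^ n) (prod_encode (x, 0)))
      = 0)) (prod_encode (x, 0)))))" .
  then show ?thesis
    by (rule computableI) (simp only: hit, simp add: G_pow)
qed

text \<open>Applied to the transition function of a machine, which is an arbitrary function but
  matters on finitely many arguments only.\<close>

lemma computable_finite_table:
  fixes f :: "'a::coded \<Rightarrow> 'b::coded"
  assumes "finite A"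
  shows "\<exists>g. computable g \<and> (\<forall>x\<in>A. g x = f x)"
  using assms
proof (induction A)
  case empty
  show ?case by (intro exI[of _ "\<lambda>_. undefined"]) (simp add: computable_const)
next
  case (insert a A)
  then obtain g where g: "computable g" "\<forall>x\<in>A. g x = f x" by blast
  have "computable (\<lambda>x. if x = a then f a else g x)"
    by (intro computable_intros g)
  then show ?case using g by (intro exI[of _ "\<lambda>x. if x = a then f a else g x"]) auto
qed

section \<open>Machines compute computable functions\<close>

text \<open>
  A tape of the simulation is the list of all write operations on it, in chronological order, together
  with the head position. An input letter is coded by 0, 1 or 2 for \<open>None\<close>, \<open>Some False\<close>,
  \<open>Some True\<close>, and so is the letter that a step writes.
\<close>

type_synonym sim_tape = "(int \<times> nat) list \<times> int"
type_synonym sim_config = "nat \<times> int \<times> sim_tape list \<times> bool list"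
type_synonym sim_result = "nat \<times> int \<times> (nat \<times> int) list \<times> nat"

text \<open>In the fold the latest write to a cell wins; a cell that was never written holds the
  blank 0.\<close>

definition lookup :: "(int \<times> nat) list \<Rightarrow> int \<Rightarrow> nat" where
  "lookup h j = fold (\<lambda>w a. if fst w = j then snd w else a) h 0"

lemma lookup_append [simp]: "lookup (h @ [(i, s)]) = (lookup h)(i := s)"
  by (auto simp: lookup_def)

text \<open>The input is the word of the sequence n, 0, 0, ...: n times the letter 0 and from then
  on only the letter 1. Comparing the head position with n therefore yields the scanned
  letter.\<close>

definition sim_view :: "nat \<Rightarrow> sim_config \<Rightarrow> nat \<times> nat \<times> nat list" where
  "sim_view n z = (fst z, if fst (snd z) < 0 then 0 else if nat (fst (snd z)) < n then 1 else 2,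
     map (\<lambda>t. lookup (fst t) (snd t)) (fst (snd (snd z))))"

definition sim_next :: "sim_result \<Rightarrow> sim_config \<Rightarrow> sim_config" where
  "sim_next r z =
     (fst r, fst (snd z) + fst (snd r),
      map (\<lambda>i. (fst (nth_default ([], 0) (fst (snd (snd z))) i) @
                 [(snd (nth_default ([], 0) (fst (snd (snd z))) i), fst (nth_default (0, 0) (fst
                     (snd (snd r))) i))],
               snd (nth_default ([], 0) (fst (snd (snd z))) i) + snd (nth_default (0, 0) (fst (snd
                   (snd r))) i)))
        [0..<length (fst (snd (snd z)))],
      snd (snd (snd z)) @ (if snd (snd (snd r)) = 0 then [] else [snd (snd (snd r)) = 2]))"

definition letter_code :: "bool option \<Rightarrow> nat" where
  "letter_code b = (case b of None \<Rightarrow> 0 | Some c \<Rightarrow> if c then 2 else 1)"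

definition letter_decode :: "nat \<Rightarrow> bool option" where
  "letter_decode k = (if k = 0 then None else Some (k = 2))"

definition sim_table :: "turing_machine \<Rightarrow> nat \<times> nat \<times> nat list \<Rightarrow> sim_result" where
  "sim_table M = (\<lambda>(s, k, ws). case delta M s (letter_decode k) ws of
     (s', m, acts, b) \<Rightarrow> (s', shift m, map (\<lambda>a. (fst a, shift (snd a))) acts, letter_code b))"

definition view_set :: "turing_machine \<Rightarrow> (nat \<times> nat \<times> nat list) set" where
  "view_set M = {..<n_states M} \<times> {..2} \<times> {ws. set ws \<subseteq> {..<n_symbols M} \<and> length ws = n_tapes M}"

lemma finite_view_set: "finite (view_set M)"
  unfolding view_set_def by (intro finite_cartesian_product finite_lists_length_eq) auto

text \<open>The invariant that keeps all views inside the finite set on which a table replaces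
  \<open>delta\<close>.\<close>

definition sim_valid :: "turing_machine \<Rightarrow> sim_config \<Rightarrow> bool" where
  "sim_valid M z \<longleftrightarrow> fst z < n_states M \<and> length (fst (snd (snd z))) = n_tapes M \<and>
     (\<forall>t\<in>set (fst (snd (snd z))). \<forall>j. lookup (fst t) j < n_symbols M)"

definition sim_abs :: "sim_config \<Rightarrow> config" where
  "sim_abs z = \<lparr>cur_state = fst z, input_pos = fst (snd z),
     work_tapes = map (\<lambda>t. (lookup (fst t), snd t)) (fst (snd (snd z))), out_word = snd (snd
         (snd z))\<rparr>"

definition first_entry :: "nat \<Rightarrow> nat \<Rightarrow> nat" where
  "first_entry n i = (if i = 0 then n else 0)"

lemma word_of_first_entry: "word_of (first_entry n) j \<longleftrightarrow> n \<le> j"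
proof -
  have "entry_pos (first_entry n) (Suc m) = Suc (n + m)" for m
    by (induction m) (auto simp: entry_pos_Suc first_entry_def)
  then show ?thesis unfolding word_of_iff_entry_pos by (auto simp: le_iff_add)
qed

lemma sim_view_in_view_set: "sim_valid M z \<Longrightarrow> sim_view n z \<in> view_set M"
  by (auto simp: sim_valid_def sim_view_def view_set_def)

lemma sim_step:
  assumes wf: "wf_machine M" and valid: "sim_valid M z" and T: "\<forall>v\<in>view_set M. T v = sim_table M v"
  shows "sim_valid M (sim_next (T (sim_view n z)) z)"
    and "sim_abs (sim_next (T (sim_view n z)) z) = step M (first_entry n) (sim_abs z)"
proof -
  obtain s pos ts out where z: "z = (s, pos, ts, out)" by (cases z) auto
  define ws where "ws = map (\<lambda>t. lookup (fst t) (snd t)) ts"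
  obtain s' m acts b where d: "delta M s (read_input (first_entry n) pos) ws = (s', m, acts, b)"
    by (metis prod_cases4)
  have ws: "length ws = n_tapes M" "set ws \<subseteq> {..<n_symbols M}" "s < n_states M" "length ts
      = n_tapes M"
    using valid by (auto simp: sim_valid_def z ws_def)
  then have acts: "s' < n_states M" "length acts = n_tapes M" "fst ` set acts \<subseteq> {..<n_symbols M}"
    using wf d unfolding wf_machine_def by metis+
  define k :: nat where "k = (if pos < 0 then 0 else if nat pos < n then 1 else 2)"
  have "letter_decode k = read_input (first_entry n) pos"
    by (auto simp: k_def letter_decode_def read_input_def word_of_first_entry)
  moreover have "sim_view n z = (s, k, ws)" by (simp add: sim_view_def z ws_def k_def)
  moreover have "T (sim_view n z) = sim_table M (sim_view n z)"
      using T sim_view_in_view_set[OF valid] by blast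
  ultimately have r: "T (sim_view n z) = (s', shift m, map (\<lambda>a. (fst a, shift (snd a))) acts,
      letter_code b)"
    by (simp add: sim_table_def d)
  have tapes: "fst (snd (snd (sim_next (T (sim_view n z)) z))) =
    map (\<lambda>i. (fst (ts ! i) @ [(snd (ts ! i), fst (acts ! i))], snd (ts ! i) + shift (snd
        (acts ! i)))) [0..<n_tapes M]"
    unfolding r sim_next_def using ws acts by (auto simp: z nth_default_def)
  show "sim_valid M (sim_next (T (sim_view n z)) z)"
    unfolding sim_valid_def tapes
  proof (intro conjI ballI allI)
    show "fst (sim_next (T (sim_view n z)) z) < n_states M"
      unfolding r sim_next_def using acts by simp
    fix t j assume "t \<in> set (map (\<lambda>i. (fst (ts ! i) @ [(snd (ts ! i), fst (acts ! i))], snd (ts ! i)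
        + shift (snd (acts ! i)))) [0..<n_tapes M])"
    then obtain i where i: "i < n_tapes M" "fst t = fst (ts ! i) @ [(snd (ts ! i), fst (acts ! i))]"
        by auto
    have "lookup (fst (ts ! i)) j < n_symbols M" using i ws valid by (auto simp: sim_valid_def z)
    moreover have "fst (acts ! i) < n_symbols M" using i acts by (auto simp: image_subset_iff)
    ultimately show "lookup (fst t) j < n_symbols M" by (simp add: i(2))
  qed simp
  have "map (\<lambda>t. (lookup (fst t), snd t)) (fst (snd (snd (sim_next (T (sim_view n z)) z)))) =
    map2 (\<lambda>(w, d) (t, h). (t(h := w), h + shift d)) acts (map (\<lambda>t. (lookup (fst t), snd t)) ts)"
    unfolding tapes by (rule nth_equalityI) (use ws acts in \<open>auto split: prod.split\<close>)
  moreover have "map (\<lambda>(t, h). t h) (work_tapes (sim_abs z)) = ws"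
    by (simp add: sim_abs_def z ws_def)
  ultimately show "sim_abs (sim_next (T (sim_view n z)) z) = step M (first_entry n) (sim_abs z)"
    using d unfolding r step_def
    by (simp add: sim_abs_def z sim_next_def letter_code_def split: option.split)
qed

text \<open>The second component counts the letters 0 since the last letter 1, that is, the part of
  the unfinished entry read so far.\<close>

definition parse_entries :: "bool list \<Rightarrow> nat list \<times> nat" where
  "parse_entries bs = fold (\<lambda>b z. if b then (fst z @ [snd z], 0) else (fst z, Suc (snd z))) bs ([],
      0)"

lemma parse_entries_word:
  "\<exists>m c. parse_entries (map (word_of q) [0..<L]) = (map q [0..<m], c) \<and> entry_pos q m + c = L \<and> c
      \<le> q m"
proof (induction L)
  case 0
  show ?case by (intro exI[of _ 0]) (simp add: parse_entries_def)
next
  case (Suc L)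
  then obtain m c where m: "parse_entries (map (word_of q) [0..<L]) = (map q [0..<m], c)"
    "entry_pos q m + c = L" "c \<le> q m" by blast
  have w: "word_of q L \<longleftrightarrow> c = q m" using word_of_entry[of c q m, OF m(3)] m(2) by simp
  have p: "parse_entries (map (word_of q) [0..<Suc L]) =
      (if word_of q L then (map q [0..<m] @ [c], 0) else (map q [0..<m], Suc c))"
    using m(1) by (simp add: parse_entries_def)
  show ?case
  proof (cases "c = q m")
    case True
    then show ?thesis using p w m by (intro exI[of _ "Suc m"] exI[of _ 0]) (simp add: entry_pos_Suc)
  next
    case False
    then show ?thesis using p w m by (intro exI[of _ m] exI[of _ "Suc c"]) simp
  qed
qed

lemma computable_parse_entries [computable_intros]:
  "computable f \<Longrightarrow> computable (\<lambda>x. parse_entries (f x))"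
  unfolding parse_entries_def by (intro computable_intros)

lemma computable_lookup [computable_intros]:
  assumes "computable f" and "computable g"
  shows "computable (\<lambda>x. lookup (f x) (g x))"
  unfolding lookup_def
  by (intro computable_intros assms computable_comp[OF assms(2)])

lemma computable_sim_view [computable_intros]:
  assumes f: "computable f" and g: "computable g"
  shows "computable (\<lambda>x. sim_view (f x) (g x))"
proof -
  have "computable (\<lambda>z. sim_view (fst z) (snd z))"
    unfolding sim_view_def by (intro computable_intros)
  then show ?thesis by (rule computable_comp2[OF _ assms])
qed

lemma computable_sim_next [computable_intros]:
  assumes f: "computable f" and g: "computable g"
  shows "computable (\<lambda>x. sim_next (f x) (g x))"
proof -
  have "computable (\<lambda>z. sim_next (fst z) (snd z))"
    unfolding sim_next_def by (intro computable_intros)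
  then show ?thesis by (rule computable_comp2[OF _ assms])
qed

theorem computable_transforms:
  assumes wf: "wf_machine M" and q: "\<And>n. transforms M (first_entry n) (q n)"
  shows "computable (\<lambda>z. q (fst z) (snd z))"
proof -
  obtain T where T: "computable T" "\<forall>v\<in>view_set M. T v = sim_table M v"
    using computable_finite_table[OF finite_view_set] by blast
  define run :: "nat \<times> nat \<Rightarrow> sim_config" where
    "run = (\<lambda>z. ((\<lambda>c. sim_next (T (sim_view (fst z) c)) c) ^^ snd z) (0, 0, replicate (n_tapes M)
        ([], 0), []))"
  have "sim_valid M (run (n, t)) \<and> sim_abs (run (n, t))
      = (step M (first_entry n) ^^ t) (init_config M)" for n t
  proof (induction t)
    case 0
    have "lookup [] = (\<lambda>_. 0)" by (auto simp: lookup_def)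
    then show ?case using wf
      by (simp add: run_def sim_abs_def sim_valid_def wf_machine_def init_config_def)
  next
    case (Suc t)
    then show ?case using sim_step[OF wf _ T(2), of "run (n, t)" n] by (simp add: run_def)
  qed
  then have abs: "(step M (first_entry n) ^^ t) (init_config M) = sim_abs (run (n, t))" for n t
    by simp
  have out: "out_after M (first_entry n) t = snd (snd (snd (run (n, t))))" for n t
    unfolding out_after_def abs by (simp add: sim_abs_def)
  define entries where "entries = (\<lambda>z. fst (parse_entries (snd (snd (snd (run z))))))"
  have run: "computable run" unfolding run_def
    by (rule computable_funpow computable_sim_next computable_comp[OF T(1)] computable_sim_view
        computable_fst computable_snd computable_id computable_const)+
  then have entries: "computable entries" unfolding entries_def
    by (intro computable_fst computable_snd computable_parse_entries)
  have ex: "\<exists>m c. entries (n, t) = map (q n) [0..<m] \<and> entry_pos (q n) m + c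
      = length (out_after M (first_entry n) t) \<and> c \<le> q n m" for n t
  proof -
    have "out_after M (first_entry n) t = map (word_of (q n)) [0..<length (out_after M (first_entry
        n) t)]"
      using q[of n] unfolding transforms_def by (intro nth_equalityI) auto
    then show ?thesis
      using parse_entries_word[of "q n" "length (out_after M (first_entry n) t)"]
          unfolding entries_def out
      by (metis fst_conv)
  qed
  have long: "\<exists>t. k < length (entries (n, t))" for n k
  proof -
    obtain t where t: "entry_pos (q n) (Suc k) \<le> length (out_after M (first_entry n) t)"
      using q[of n] unfolding transforms_def by blast
    obtain m c where m: "entries (n, t) = map (q n) [0..<m]" "c \<le> q n m"
        "entry_pos (q n) m + c = length (out_after M (first_entry n) t)" using ex by blast
    \<comment> \<open>An output with exactly m complete entries ends before the block of entry m is
      closed.\<close>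
    then have "entry_pos (q n) (Suc k) < entry_pos (q n) (Suc m)" using t by
        (simp add: entry_pos_Suc[of _ m])
    then have "k < m" using strict_mono_less[OF strict_mono_entry_pos] by blast
    then show ?thesis using m by (intro exI[of _ t]) simp
  qed
  have entry: "k < length (entries (n, t)) \<Longrightarrow> nth_default 0 (entries (n, t)) k = q n k" for n t k
    using ex[of n t] by (auto simp: nth_default_def)
  \<comment> \<open>The first time at which the wanted entry is complete; it exists because the
    output is infinite.\<close>
  let ?t = "\<lambda>z. LEAST t. snd z < length (entries (fst z, t))"
  have "q (fst z) (snd z) = nth_default 0 (entries (fst z, ?t z)) (snd z)" for z
    by (rule entry[symmetric], rule LeastI_ex, rule long)
  moreover have "computable ?t"
    by (rule computable_Least) (intro computable_intros computable_comp[OF entries] surj_enc_prod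
        surj_enc_nat long)+
  ultimately show ?thesis
    by (simp only:) (intro computable_intros computable_comp[OF entries])
qed

section \<open>Stream machines\<close>

text \<open>Register \<open>r\<close> counts the letters 0, \<open>r + 1\<close> keeps the loop of
  \<open>pread\<close> running until a letter 1 is met, and \<open>r + 2\<close> receives the
  scanned letter. \<open>Read\<close> increments its register, hence the clearing.\<close>

definition pread_body :: "nat \<Rightarrow> prog" where
  "pread_body r = Seq (pclear (r + 2)) (Seq (Read (r + 2)) (Cond (r + 2) (Dec (r + 1)) (Inc r)))"

definition pread :: "nat \<Rightarrow> prog" where
  "pread r = Seq (pclear r) (Seq (pclear (r + 1)) (Seq (Inc (r + 1)) (While (r + 1) (pread_body
      r))))"

text \<open>Here \<open>u r\<close> letters 0 of the current block have been read and
  \<open>k\<close> are still to come.\<close>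

lemma exec_pread_loop:
  assumes "u r + k = p m" and "u (r + 1) = 1"
  shows "\<exists>u'. exec (word_of p) (While (r + 1) (pread_body r)) (u, entry_pos p m + u r, out)
     (u', entry_pos p (Suc m), out) \<and> u' r = p m \<and> (\<forall>r'<r. u' r' = u r')"
  using assms
proof (induction k arbitrary: u)
  case 0
  then have w: "word_of p (entry_pos p m + u r)" by (simp add: word_of_entry)
  let ?s1 = "u(r + 2 := 0)"
  let ?s2 = "?s1(r + 2 := Suc (?s1 (r + 2)))"
  let ?s3 = "?s2(r + 1 := ?s2 (r + 1) - 1)"
  have rd: "exec (word_of p) (Read (r + 2)) (?s1, entry_pos p m + u r, out) (?s2, Suc (entry_pos p m
      + u r), out)"
    using exec.Read[of "word_of p" "r + 2" ?s1 "entry_pos p m + u r" out] w by simp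
  have b: "exec (word_of p) (pread_body r) (u, entry_pos p m + u r, out) (?s3, Suc (entry_pos p m +
      u r), out)"
    unfolding pread_body_def
    by (intro exec.Seq[OF exec_pclear] exec.Seq[OF rd] exec.Cond_True exec.Dec) simp
  have "exec (word_of p) (While (r + 1) (pread_body r)) (?s3, Suc (entry_pos p m + u r), out) (?s3,
      Suc (entry_pos p m + u r), out)"
    by (rule exec.While_False) (use 0 in simp)
  note loop = this
  have "exec (word_of p) (While (r + 1) (pread_body r)) (u, entry_pos p m + u r, out) (?s3, Suc
      (entry_pos p m + u r), out)"
    by (rule exec.While_True[OF _ b loop]) (use 0 in simp)
  moreover have "Suc (entry_pos p m + u r) = entry_pos p (Suc m)" using 0 by
      (simp add: entry_pos_Suc)
  moreover have "?s3 r = p m" "\<forall>r'<r. ?s3 r' = u r'" using 0 by auto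
  ultimately show ?case by metis
next
  case (Suc k)
  then have w: "\<not> word_of p (entry_pos p m + u r)" using word_of_entry[of "u r" p m] by simp
  let ?s1 = "u(r + 2 := 0)"
  let ?s3 = "?s1(r := Suc (?s1 r))"
  have rd: "exec (word_of p) (Read (r + 2)) (?s1, entry_pos p m + u r, out) (?s1, Suc (entry_pos p m
      + u r), out)"
    using exec.Read[of "word_of p" "r + 2" ?s1 "entry_pos p m + u r" out] w by simp
  have b: "exec (word_of p) (pread_body r) (u, entry_pos p m + u r, out) (?s3, entry_pos p m + ?s3
      r, out)"
    unfolding pread_body_def
    using exec.Inc[of "word_of p" r ?s1 "Suc (entry_pos p m + u r)" out]
    by (intro exec.Seq[OF exec_pclear] exec.Seq[OF rd] exec.Cond_False) simp_all
  have "?s3 r + k = p m" "?s3 (r + 1) = 1" using Suc.prems by auto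
  from Suc.IH[OF this] obtain u' where s': "exec (word_of p) (While (r + 1) (pread_body r)) (?s3,
      entry_pos p m + ?s3 r, out)
     (u', entry_pos p (Suc m), out)" "u' r = p m" "\<forall>r'<r. u' r' = ?s3 r'"
    by blast
  have "exec (word_of p) (While (r + 1) (pread_body r)) (u, entry_pos p m + u r, out) (u', entry_pos
      p (Suc m), out)"
    by (rule exec.While_True[OF _ b s'(1)]) (use Suc.prems in simp)
  then show ?case using s' by (intro exI[of _ u']) simp
qed

lemma exec_pread:
  "\<exists>u'. exec (word_of p) (pread r) (u, entry_pos p m, out) (u', entry_pos p (Suc m), out) \<and>
     u' r = p m \<and> (\<forall>r'<r. u' r' = u r')"
proof -
  let ?s1 = "u(r := 0, r + 1 := 0)"
  let ?s = "?s1(r + 1 := Suc (?s1 (r + 1)))"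
  obtain u' where s': "exec (word_of p) (While (r + 1) (pread_body r)) (?s, entry_pos p m + ?s r,
      out)
     (u', entry_pos p (Suc m), out)" "u' r = p m" "\<forall>r'<r. u' r' = ?s r'"
    using exec_pread_loop[of ?s r "p m" p m out] by auto
  then have 1: "exec (word_of p) (While (r + 1) (pread_body r)) (?s, entry_pos p m, out) (u',
      entry_pos p (Suc m), out)"
    by simp
  have "exec (word_of p) (pread r) (u, entry_pos p m, out) (u', entry_pos p (Suc m), out)"
    unfolding pread_def
    by (rule exec.Seq[OF exec_pclear exec.Seq[OF exec_pclear exec.Seq[OF exec.Inc 1]]])
  then show ?thesis using s' by (intro exI[of _ u']) simp
qed

fun pskip :: "nat \<Rightarrow> prog" where
  "pskip 0 = Skip"
| "pskip (Suc c) = Seq (pskip c) (pread 3)"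

lemma exec_pskip:
  "\<exists>u'. exec (word_of p) (pskip c) (u, 0, out) (u', entry_pos p c, out) \<and> u' 0 = u 0"
proof (induction c)
  case 0
  then show ?case by (auto intro: exec.Skip)
next
  case (Suc c)
  then obtain u1 where 1: "exec (word_of p) (pskip c) (u, 0, out) (u1, entry_pos p c, out)" "u1 0
      = u 0"
    by blast
  obtain u2 where 2: "exec (word_of p) (pread 3) (u1, entry_pos p c, out) (u2, entry_pos p (Suc c),
      out)"
    "\<forall>r'<3. u2 r' = u1 r'" using exec_pread by blast
  show ?case using 1 2 exec.Seq[OF 1(1) 2(1)] by (intro exI[of _ u2]) auto
qed

definition pwrite :: "nat \<Rightarrow> prog" where
  "pwrite r = Seq (While r (Seq (Dec r) (Out False))) (Out True)"

lemma exec_pwrite_loop: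
  "exec w (While r (Seq (Dec r) (Out False))) (u, i, out) (u(r := 0), i, out @ replicate (u r)
      False)"
proof (induction "u r" arbitrary: u out)
  case 0
  then have "u(r := 0) = u" by auto
  then show ?case using 0 exec.While_False[of "(u, i, out)" r w] by simp
next
  case (Suc n)
  let ?s = "u(r := u r - 1)"
  have n: "n = ?s r" using Suc.hyps(2)[symmetric] by simp
  have eq: "out @ [False] @ replicate (?s r) False = out @ replicate (u r) False"
    using Suc.hyps(2)[symmetric] by simp
  have 1: "exec w (While r (Seq (Dec r) (Out False))) (?s, i, out @ [False])
      (?s(r := 0), i, (out @ [False]) @ replicate (?s r) False)"
    by (rule Suc.hyps(1)) (rule n)
  have "exec w (While r (Seq (Dec r) (Out False))) (u, i, out)
      (?s(r := 0), i, (out @ [False]) @ replicate (?s r) False)"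
    by (rule exec.While_True[OF _ exec.Seq[OF exec.Dec exec.Out] 1]) (use Suc.hyps(2)[symmetric]
        in simp)
  then show ?case by (simp only: append_assoc eq fun_upd_upd)
qed

lemma exec_pwrite:
  "exec w (pwrite r) (u, i, out) (u(r := 0), i, (out @ replicate (u r) False) @ [True])"
  unfolding pwrite_def by (rule exec.Seq[OF exec_pwrite_loop exec.Out])

text \<open>Register 0 holds the index of the output entry. As \<open>pencode 1\<close> pairs the
  registers 2 and 3, the index is copied to 2 and the input entry is read into 3; running P at base
  1 protects register 0.\<close>

lemma exec_stream_body:
  assumes P: "computes P g"
  defines "Body \<equiv> Seq (pread 3) (Seq (pcopy 0 2 1) (Seq (pencode 1) (Seq (P 1) (Seq (pwrite 1) (Inc
      0)))))"
  shows "\<exists>u'. exec (word_of p) Body (u, entry_pos p m, out)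
     (u', entry_pos p (Suc m), out @ replicate (g (prod_encode (u 0, p m))) False @ [True]) \<and>
     u' 0 = Suc (u 0)"
proof -
  obtain u1 where 1: "exec (word_of p) (pread 3) (u, entry_pos p m, out) (u1, entry_pos p (Suc m),
      out)"
    "u1 3 = p m" "\<forall>r'<3. u1 r' = u r'" using exec_pread by blast
  let ?s2 = "u1(2 := u1 0, 1 := 0)"
  have 2: "exec (word_of p) (pcopy 0 2 1) (u1, entry_pos p (Suc m), out) (?s2, entry_pos p (Suc m),
      out)"
    by (rule exec_pcopy) auto
  obtain u3 where 3: "exec (word_of p) (pencode 1) (?s2, entry_pos p (Suc m), out) (u3, entry_pos p
      (Suc m), out)"
    "u3 1 = prod_encode (?s2 (1 + 1), ?s2 (1 + 2))" "\<forall>r<1. u3 r = ?s2 r" using exec_pencode by blast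
  obtain u4 where 4: "exec (word_of p) (P 1) (u3, entry_pos p (Suc m), out) (u4, entry_pos p (Suc
      m), out)"
    "u4 1 = g (u3 1)" "\<forall>r<1. u4 r = u3 r"
    using computesD[OF P, of "word_of p" 1 u3 "entry_pos p (Suc m)" out] by blast
  let ?s5 = "u4(1 := 0)"
  let ?s6 = "?s5(0 := Suc (?s5 0))"
  have "exec (word_of p) Body (u, entry_pos p m, out)
      (?s6, entry_pos p (Suc m), (out @ replicate (u4 1) False) @ [True])"
    unfolding Body_def
    by (rule exec.Seq[OF 1(1) exec.Seq[OF 2 exec.Seq[OF 3(1) exec.Seq[OF 4(1) exec.Seq[OF
        exec_pwrite exec.Inc]]]]])
  moreover have "u3 1 = prod_encode (u 0, p m)" using 1 3 by
      (simp add: numeral_2_eq_2 numeral_3_eq_3)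
  ultimately show ?thesis using 1 3 4 by (intro exI[of _ ?s6]) simp
qed

text \<open>One output entry per input entry is all that the final algorithm requires. The first
  \<open>c\<close> input entries are skipped by the prelude, so \<open>c\<close> is a constant of
  the machine. The output is infinite on every input, which makes F total.\<close>

theorem stream_computable:
  assumes G: "computable G"
  shows "\<exists>F. type2_computable F \<and> (\<forall>p. F p = Some (\<lambda>n. G (n, p (n + c))))"
proof -
  obtain g where g: "cmp g" "\<And>n x. g (prod_encode (n, x)) = G (n, x)"
    using G unfolding computable_def by auto
  then obtain P where P: "computes P g" unfolding cmp_def by blast
  define Body where "Body = Seq (pread 3) (Seq (pcopy 0 2 1) (Seq (pencode 1) (Seq (P 1) (Seq
      (pwrite 1) (Inc 0)))))"
  obtain M where wf: "wf_machine M" and M: "\<And>p q S. exec (word_of p) (pskip c) (\<lambda>_. 0, 0, []) (S 0)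
      \<Longrightarrow>
        \<forall>n. exec (word_of p) Body (S n) (S (Suc n)) \<Longrightarrow>
        \<forall>n. snd (snd (S n)) = word_prefix q n \<Longrightarrow> transforms M p q"
    using loop_machine[of "pskip c" Body] by blast
  have trans: "transforms M p (\<lambda>n. G (n, p (n + c)))" for p
  proof -
    let ?q = "\<lambda>n. G (n, p (n + c))"
    let ?I = "\<lambda>n s. fst s 0 = n \<and> fst (snd s) = entry_pos p (n + c) \<and> snd (snd s)
        = word_prefix ?q n"
    \<comment> \<open>The states between rounds are chosen successively, because
      \<open>computes\<close> fixes the final registers only in part. The clause for
      \<open>n = 0\<close> records that the first state comes from the prelude.\<close>
    have "\<exists>S. \<forall>n. (?I n (S n) \<and> (n = 0 \<longrightarrow> exec (word_of p) (pskip c) (\<lambda>_. 0, 0, []) (S n))) \<and>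
        exec (word_of p) Body (S n) (S (Suc n))"
    proof (rule dependent_nat_choice)
      obtain u where "exec (word_of p) (pskip c) (\<lambda>_. 0, 0, []) (u, entry_pos p c, [])" "u 0 = 0"
        using exec_pskip[of p c "\<lambda>_. 0" "[]"] by auto
      then show "\<exists>s. ?I 0 s \<and> ((0::nat) = 0 \<longrightarrow> exec (word_of p) (pskip c) (\<lambda>_. 0, 0, []) s)"
        by (intro exI[of _ "(u, entry_pos p c, [])"]) simp
    next
      fix s n assume s: "?I n s \<and> (n = 0 \<longrightarrow> exec (word_of p) (pskip c) (\<lambda>_. 0, 0, []) s)"
      obtain u i out where s_eq: "s = (u, i, out)" by (cases s) auto
      then have s': "s = (u, entry_pos p (n + c), word_prefix ?q n)" and n: "u 0 = n" using s
          by auto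
      obtain u' where "exec (word_of p) Body s (u', entry_pos p (Suc (n + c)),
          word_prefix ?q n @ replicate (g (prod_encode (u 0, p
              (n + c)))) False @ [True])" "u' 0 = Suc (u 0)"
        using exec_stream_body[OF P] unfolding s' Body_def by blast
      then show "\<exists>t. (?I (Suc n) t \<and> (Suc n = 0 \<longrightarrow> exec (word_of p) (pskip c) (\<lambda>_. 0, 0, []) t))
          \<and> exec (word_of p) Body s t"
        by (intro exI) (auto simp: n g word_prefix_Suc)
    qed
    then obtain S where S: "\<And>n. ?I n (S n)" "exec (word_of p) (pskip c) (\<lambda>_. 0, 0, []) (S 0)"
      "\<And>n. exec (word_of p) Body (S n) (S (Suc n))" by blast
    show ?thesis by (rule M[of p S]) (use S in auto)
  qed
  have "(THE q. transforms M p q) = (\<lambda>n. G (n, p (n + c)))" for p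
    using trans transforms_unique by blast
  moreover have "\<exists>q. transforms M p q" for p using trans by blast
  ultimately show ?thesis using type2_computable_machine[OF wf]
    by (intro exI[of _ "\<lambda>p. if \<exists>q. transforms M p q then Some (THE q. transforms M p q) else None"])
        auto
qed

section \<open>Inner product spaces\<close>

lemma scalar_ring_simps [simp]:
  "carrier (scalar_ring K) = K" "mult (scalar_ring K) = (*)" "one (scalar_ring K) = 1"
  "zero (scalar_ring K) = 0" "add (scalar_ring K) = (+)"
  by (simp_all add: scalar_ring_def)

text \<open>\<open>hilbert_space\<close> without completeness, so that the same facts serve for H,
  for the spaces of the family and for their l2 sum.\<close>

locale ip_space =
  fixes K :: "complex set" and V :: "'a hspace" (structure)
  assumes scalars: "K = \<real> \<or> K = UNIV"
    and mod: "Module.module (scalar_ring K) V"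
    and ip_in: "x \<in> carrier V \<Longrightarrow> y \<in> carrier V \<Longrightarrow> ip V x y \<in> K"
    and ip_sym: "x \<in> carrier V \<Longrightarrow> y \<in> carrier V \<Longrightarrow> ip V y x = cnj (ip V x y)"
    and ip_add: "x \<in> carrier V \<Longrightarrow> y \<in> carrier V \<Longrightarrow> z \<in> carrier V \<Longrightarrow>
       ip V (x \<oplus> y) z = ip V x z + ip V y z"
    and ip_smult: "c \<in> K \<Longrightarrow> x \<in> carrier V \<Longrightarrow> y \<in> carrier V \<Longrightarrow> ip V (c \<odot> x) y = c * ip V x y"
    and ip_nonneg: "x \<in> carrier V \<Longrightarrow> 0 \<le> Re (ip V x x)"
    and ip_definite: "x \<in> carrier V \<Longrightarrow> ip V x x = 0 \<Longrightarrow> x = \<zero>"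
begin

sublocale module "scalar_ring K" V
  by (rule mod)

lemma K_simps [simp, intro]:
  "0 \<in> K" "1 \<in> K" "-1 \<in> K" "of_real r \<in> K"
  "a \<in> K \<Longrightarrow> b \<in> K \<Longrightarrow> a + b \<in> K" "a \<in> K \<Longrightarrow> b \<in> K \<Longrightarrow> a * b \<in> K" "a \<in> K \<Longrightarrow> - a \<in> K"
  "a \<in> K \<Longrightarrow> b \<in> K \<Longrightarrow> a - b \<in> K" "a \<in> K \<Longrightarrow> cnj a \<in> K"
  using scalars by (auto simp: Reals_cnj_iff)

lemma smult_in [simp, intro]: "c \<in> K \<Longrightarrow> x \<in> carrier V \<Longrightarrow> c \<odot> x \<in> carrier V"
  using smult_closed by simp

lemma a_inv_eq_smult: "x \<in> carrier V \<Longrightarrow> \<ominus> x = (-1) \<odot> x"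
proof -
  assume x: "x \<in> carrier V"
  have "(-1) \<odot> x \<oplus> x = (-1 + 1) \<odot> x"
    using smult_l_distr[of "-1" 1 x] smult_one[of x] x by simp
  also have "\<dots> = \<zero>" using smult_l_null[of x] x by simp
  finally show ?thesis using M.minus_equality[of "(-1) \<odot> x" x] x by simp
qed

lemma ip_diff:
  "x \<in> carrier V \<Longrightarrow> y \<in> carrier V \<Longrightarrow> z \<in> carrier V \<Longrightarrow> ip V (x \<ominus> y) z = ip V x z - ip V y z"
  using ip_add[of x "\<ominus> y" z] ip_smult[of "-1" y z] by (simp add: a_minus_def a_inv_eq_smult)

lemma ip_add_right:
  "x \<in> carrier V \<Longrightarrow> y \<in> carrier V \<Longrightarrow> z \<in> carrier V \<Longrightarrow> ip V z (x \<oplus> y) = ip V z x + ip V z y"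
  using ip_add[of x y z] ip_sym[of "x \<oplus> y" z] ip_sym[of x z] ip_sym[of y z] by simp

lemma ip_diff_right:
  "x \<in> carrier V \<Longrightarrow> y \<in> carrier V \<Longrightarrow> z \<in> carrier V \<Longrightarrow> ip V z (x \<ominus> y) = ip V z x - ip V z y"
  using ip_diff[of x y z] ip_sym[of "x \<ominus> y" z] ip_sym[of x z] ip_sym[of y z] by simp

lemma ip_smult_right:
  "c \<in> K \<Longrightarrow> x \<in> carrier V \<Longrightarrow> y \<in> carrier V \<Longrightarrow> ip V y (c \<odot> x) = cnj c * ip V y x"
  using ip_smult[of c x y] ip_sym[of "c \<odot> x" y] ip_sym[of x y] by simp

lemma ip_zero_left [simp]: "x \<in> carrier V \<Longrightarrow> ip V \<zero> x = 0"
  using ip_smult[of 0 x x] smult_l_null[of x] by simp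

lemma ip_zero_right [simp]: "x \<in> carrier V \<Longrightarrow> ip V x \<zero> = 0"
  using ip_sym[of "\<zero>" x] by simp

lemma hnorm_nonneg [simp]: "x \<in> carrier V \<Longrightarrow> 0 \<le> hnorm V x"
  by (simp add: hnorm_def ip_nonneg)

lemma ip_self: "x \<in> carrier V \<Longrightarrow> ip V x x = of_real ((hnorm V x)\<^sup>2)"
  using ip_sym[of x x] ip_nonneg[of x] by (simp add: hnorm_def complex_eq_iff)

lemma hnorm_sq: "x \<in> carrier V \<Longrightarrow> (hnorm V x)\<^sup>2 = Re (ip V x x)"
  by (simp add: ip_self)

lemma hnorm_zero [simp]: "hnorm V \<zero> = 0"
  by (simp add: hnorm_def)

lemma hnorm_eq_0: "x \<in> carrier V \<Longrightarrow> hnorm V x = 0 \<longleftrightarrow> x = \<zero>"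
  using ip_definite[of x] ip_self[of x] by auto

lemma hnorm_smult: "c \<in> K \<Longrightarrow> x \<in> carrier V \<Longrightarrow> hnorm V (c \<odot> x) = cmod c * hnorm V x"
proof -
  assume c: "c \<in> K" "x \<in> carrier V"
  have "ip V (c \<odot> x) (c \<odot> x) = c * cnj c * ip V x x"
    using c by (simp add: ip_smult ip_smult_right)
  also have "\<dots> = of_real ((cmod c * hnorm V x)\<^sup>2)"
    using c by (simp add: ip_self complex_norm_square power_mult_distrib flip: of_real_power)
  finally have "(hnorm V (c \<odot> x))\<^sup>2 = (cmod c * hnorm V x)\<^sup>2"
    using c ip_self[of "c \<odot> x"] by (metis of_real_eq_iff smult_in)
  then show ?thesis using c by (simp add: power2_eq_iff_nonneg)
qed

lemma hnorm_add_sq: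
  assumes "x \<in> carrier V" "y \<in> carrier V"
  shows "(hnorm V (x \<oplus> y))\<^sup>2 = (hnorm V x)\<^sup>2 + (hnorm V y)\<^sup>2 + 2 * Re (ip V x y)"
  using assms ip_sym[of x y] by (simp add: hnorm_sq ip_add ip_add_right)

lemma hnorm_diff_sq:
  assumes "x \<in> carrier V" "y \<in> carrier V"
  shows "(hnorm V (x \<ominus> y))\<^sup>2 = (hnorm V x)\<^sup>2 + (hnorm V y)\<^sup>2 - 2 * Re (ip V x y)"
  using assms ip_sym[of x y] by (simp add: hnorm_sq ip_diff ip_diff_right)

text \<open>Expands the squared norm of N x - c y with N the squared norm of y and c the inner
  product of x and y. This vector is N times the part of x orthogonal to y; the factor N avoids a
  division.\<close>

lemma Cauchy_Schwarz:
  assumes x: "x \<in> carrier V" and y: "y \<in> carrier V"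
  shows "cmod (ip V x y) \<le> hnorm V x * hnorm V y"
proof (cases "y = \<zero>")
  case True
  then show ?thesis using x by simp
next
  case False
  define N where "N = (hnorm V y)\<^sup>2"
  define c where "c = ip V x y"
  have N: "N > 0" using False y by (simp add: N_def hnorm_eq_0)
  have c: "c \<in> K" using ip_in x y by (simp add: c_def)
  have "ip V (of_real N \<odot> x) (c \<odot> y) = of_real N * (c * cnj c)"
    using x y c by (simp add: ip_smult ip_smult_right c_def mult.commute)
  also have "\<dots> = of_real (N * (cmod c)\<^sup>2)"
    by (simp only: of_real_mult complex_norm_square)
  finally have cross: "Re (ip V (of_real N \<odot> x) (c \<odot> y)) = N * (cmod c)\<^sup>2"
    by (simp only: Re_complex_of_real)
  have "0 \<le> (hnorm V (of_real N \<odot> x \<ominus> c \<odot> y))\<^sup>2" by simp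
  also have "\<dots> = N\<^sup>2 * (hnorm V x)\<^sup>2 + (cmod c)\<^sup>2 * N - 2 * (N * (cmod c)\<^sup>2)"
    using x y c N by (simp add: hnorm_diff_sq cross)
        (simp add: hnorm_smult power_mult_distrib N_def[symmetric])
  finally have "0 \<le> N * (N * (hnorm V x)\<^sup>2 - (cmod c)\<^sup>2)" by
      (simp add: algebra_simps power2_eq_square)
  then have "(cmod c)\<^sup>2 \<le> N * (hnorm V x)\<^sup>2" using N by (simp add: zero_le_mult_iff)
  also have "\<dots> = (hnorm V x * hnorm V y)\<^sup>2" by (simp add: N_def power_mult_distrib)
  finally show ?thesis unfolding c_def using x y by (simp add: power2_le_iff_abs_le)
qed

lemma hnorm_triangle:
  assumes "x \<in> carrier V" "y \<in> carrier V"
  shows "hnorm V (x \<oplus> y) \<le> hnorm V x + hnorm V y"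
proof -
  have "Re (ip V x y) \<le> hnorm V x * hnorm V y"
    using complex_Re_le_cmod Cauchy_Schwarz[OF assms] by (rule order_trans)
  then have "(hnorm V (x \<oplus> y))\<^sup>2 \<le> (hnorm V x + hnorm V y)\<^sup>2"
    by (simp add: hnorm_add_sq[OF assms] power2_sum)
  then show ?thesis using assms by (simp add: power2_le_iff_abs_le)
qed

lemma diff_zero [simp]: "x \<in> carrier V \<Longrightarrow> x \<ominus> \<zero> = x"
  by (simp add: a_minus_def a_inv_eq_smult smult_r_null)

lemma diff_eq_zero_iff:
  assumes "x \<in> carrier V" "y \<in> carrier V"
  shows "x \<ominus> y = \<zero> \<longleftrightarrow> x = y"
proof
  assume "x \<ominus> y = \<zero>"
  then have "(x \<oplus> \<ominus> y) \<oplus> y = y" using assms by (simp add: a_minus_def)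
  then show "x = y" using assms by (simp add: M.a_assoc M.l_neg)
qed (use assms in \<open>simp add: a_minus_def M.r_neg\<close>)

lemma diff_split:
  assumes "x \<in> carrier V" "y \<in> carrier V" "z \<in> carrier V"
  shows "x \<ominus> z = (x \<ominus> y) \<oplus> (y \<ominus> z)"
  using assms by (simp add: a_minus_def M.a_ac M.r_neg1 M.r_neg2)

lemma hdist_eq: "x \<in> carrier V \<Longrightarrow> y \<in> carrier V \<Longrightarrow> hdist V x y = hnorm V (x \<ominus> y)"
  by (simp add: hdist_def)

lemma hdist_sq:
  "x \<in> carrier V \<Longrightarrow> y \<in> carrier V \<Longrightarrow>
   (hdist V x y)\<^sup>2 = (hnorm V x)\<^sup>2 + (hnorm V y)\<^sup>2 - 2 * Re (ip V x y)"
  by (simp add: hdist_eq hnorm_diff_sq)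

sublocale metric: Metric_space "carrier V" "hdist V"
proof
  show "0 \<le> hdist V x y" for x y by (simp add: hdist_def)
  show "hdist V x y = hdist V y x" for x y
  proof (cases "x \<in> carrier V \<and> y \<in> carrier V")
    case True
    have "(hdist V x y)\<^sup>2 = (hdist V y x)\<^sup>2" using True ip_sym[of x y] by (simp add: hdist_sq)
    then show ?thesis using True by (simp add: power2_eq_iff_nonneg hdist_eq)
  qed (auto simp: hdist_def)
  show "hdist V x y = 0 \<longleftrightarrow> x = y" if "x \<in> carrier V" "y \<in> carrier V" for x y
  proof
    assume "hdist V x y = 0"
    then have "x \<ominus> y = \<zero>" using that by (simp add: hdist_eq hnorm_eq_0)
    then show "x = y" using that diff_eq_zero_iff by blast
  next
    assume "x = y"
    then have "x \<ominus> y = \<zero>" using that diff_eq_zero_iff by blast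
    then show "hdist V x y = 0" using that by (simp add: hdist_eq)
  qed
  show "hdist V x z \<le> hdist V x y + hdist V y z"
    if "x \<in> carrier V" "y \<in> carrier V" "z \<in> carrier V" for x y z
    using that diff_split[of x y z] hnorm_triangle[of "x \<ominus> y" "y \<ominus> z"] by (simp add: hdist_eq)
qed

lemma hdist_zero: "x \<in> carrier V \<Longrightarrow> hdist V x \<zero> = hnorm V x"
  by (simp add: hdist_eq)

lemma ip_finsum_right:
  assumes "finite A" "f \<in> A \<rightarrow> carrier V" "z \<in> carrier V"
  shows "ip V z (\<Oplus>i\<in>A. f i) = (\<Sum>i\<in>A. ip V z (f i))"
  using assms by (induction A) (auto simp: ip_add_right Pi_iff)

lemma hnorm_finsum:
  assumes "finite A" "f \<in> A \<rightarrow> carrier V"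
  shows "hnorm V (\<Oplus>i\<in>A. f i) \<le> (\<Sum>i\<in>A. hnorm V (f i))"
  using assms
proof (induction A)
  case (insert a A)
  then have "hnorm V (f a \<oplus> (\<Oplus>i\<in>A. f i)) \<le> hnorm V (f a) + hnorm V (\<Oplus>i\<in>A. f i)"
    by (intro hnorm_triangle) (auto simp: Pi_iff)
  then show ?case using insert by (simp add: Pi_iff)
qed simp

lemma finsum_diff:
  assumes "finite A" "f \<in> A \<rightarrow> carrier V" "g \<in> A \<rightarrow> carrier V"
  shows "(\<Oplus>i\<in>A. f i) \<ominus> (\<Oplus>i\<in>A. g i) = (\<Oplus>i\<in>A. f i \<ominus> g i)"
  using assms
proof (induction A)
  case (insert a A)
  then have "f a \<in> carrier V" "g a \<in> carrier V" "(\<Oplus>i\<in>A. f i) \<in> carrier V" "(\<Oplus>i\<in>A. g i) \<in> carrier V"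
    by auto
  then show ?case using insert
    by (simp add: a_minus_def M.minus_add M.a_ac Pi_iff)
qed (simp add: a_minus_def)

lemma ip_eqI:
  assumes "y \<in> carrier V" "z \<in> carrier V" "\<And>x. x \<in> carrier V \<Longrightarrow> ip V x y = ip V x z"
  shows "y = z"
proof -
  have "ip V (y \<ominus> z) (y \<ominus> z) = 0"
    using assms by (simp add: ip_diff_right)
  then have "y \<ominus> z = \<zero>" using assms by (intro ip_definite) auto
  then show ?thesis using assms diff_eq_zero_iff by blast
qed

text \<open>Norm estimates by duality, from the choice x = y. In this way the bound of the analysis
  operator carries over to T.\<close>

lemma hnorm_le_by_ip:
  assumes "y \<in> carrier V" "0 \<le> C" "\<And>x. x \<in> carrier V \<Longrightarrow> cmod (ip V x y) \<le> C * hnorm V x"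
  shows "hnorm V y \<le> C"
proof (cases "hnorm V y = 0")
  case False
  have "hnorm V y * hnorm V y \<le> C * hnorm V y"
    using assms(3)[of y] assms(1) by (simp add: ip_self power2_eq_square norm_mult)
  moreover have "0 < hnorm V y" using False hnorm_nonneg[OF assms(1)] by linarith
  ultimately show ?thesis by simp
qed (use assms in simp)

end

lemma ip_spaceI:
  assumes "hilbert_space K V" shows "ip_space K V"
proof -
  note h = assms[unfolded hilbert_space_def]
  note h2 = h[THEN conjunct2] note h3 = h2[THEN conjunct2] note h4 = h3[THEN conjunct2]
  note h5 = h4[THEN conjunct2] note h6 = h5[THEN conjunct2] note h7 = h6[THEN conjunct2]
  note h8 = h7[THEN conjunct2]
  show ?thesis
    by (rule ip_space.intro[OF h[THEN conjunct1] h2[THEN conjunct1] h3[THEN conjunct1, rule_format]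
        h4[THEN conjunct1, rule_format] h5[THEN conjunct1, rule_format] h6[THEN conjunct1,
            rule_format]
        h7[THEN conjunct1, rule_format] h8[THEN conjunct1, rule_format]])
qed

subsection \<open>The Riesz representation theorem\<close>

text \<open>If \<phi> is the inner product with z, then J x is the squared distance of x and z minus
  the squared norm of z, so z minimizes J. By linearity the terms with \<phi> cancel in the
  parallelogram law; near-minimizers of J are therefore close to each other.\<close>

lemma (in ip_space) parallelogram_functional:
  assumes x: "x \<in> carrier V" and y: "y \<in> carrier V"
    and add: "\<And>x y. x \<in> carrier V \<Longrightarrow> y \<in> carrier V \<Longrightarrow> \<phi> (x \<oplus> y) = \<phi> x + \<phi> y"
    and smult: "\<And>c x. c \<in> K \<Longrightarrow> x \<in> carrier V \<Longrightarrow> \<phi> (c \<odot> x) = c * \<phi> x"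
  defines "J \<equiv> \<lambda>x. (hnorm V x)\<^sup>2 - 2 * Re (\<phi> x)"
  shows "(hdist V x y)\<^sup>2 = 2 * J x + 2 * J y - 4 * J ((1 / 2) \<odot> (x \<oplus> y))"
proof -
  have half: "(1 / 2 :: complex) \<in> K" using K_simps(4)[of "1 / 2"] by simp
  have "4 * (hnorm V ((1 / 2) \<odot> (x \<oplus> y)))\<^sup>2 = (hnorm V (x \<oplus> y))\<^sup>2"
    using x y half by (simp add: hnorm_smult power_mult_distrib power2_eq_square)
  moreover have "Re (\<phi> ((1 / 2) \<odot> (x \<oplus> y))) = (Re (\<phi> x) + Re (\<phi> y)) / 2"
    using x y half by (simp add: add smult)
  ultimately show ?thesis
    unfolding J_def using x y by (simp add: hdist_sq hnorm_add_sq)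
qed

text \<open>A minimizing sequence of J is Cauchy by the parallelogram identity. Its limit z attains
  the infimum, and vanishing of the first variation of J at z says that \<phi> is the inner product
  with z.\<close>

lemma (in ip_space) Riesz:
  assumes complete: "metric.mcomplete"
    and add: "\<And>x y. x \<in> carrier V \<Longrightarrow> y \<in> carrier V \<Longrightarrow> \<phi> (x \<oplus> y) = \<phi> x + \<phi> y"
    and smult: "\<And>c x. c \<in> K \<Longrightarrow> x \<in> carrier V \<Longrightarrow> \<phi> (c \<odot> x) = c * \<phi> x"
    and in_K: "\<And>x. x \<in> carrier V \<Longrightarrow> \<phi> x \<in> K"
    and bounded: "\<And>x. x \<in> carrier V \<Longrightarrow> cmod (\<phi> x) \<le> C * hnorm V x"
  shows "\<exists>z\<in>carrier V. \<forall>x\<in>carrier V. \<phi> x = ip V x z"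
proof -
  define J where "J x = (hnorm V x)\<^sup>2 - 2 * Re (\<phi> x)" for x
  \<comment> \<open>Completing the square bounds J x from below by
    \<open>(hnorm V x - C)^2 - C^2\<close>.\<close>
  have lower: "- C\<^sup>2 \<le> J x" if "x \<in> carrier V" for x
  proof -
    have "Re (\<phi> x) \<le> C * hnorm V x" using complex_Re_le_cmod bounded[OF that] by (rule order_trans)
    moreover have "0 \<le> (hnorm V x - C)\<^sup>2" by simp
    ultimately show ?thesis unfolding J_def by (simp add: power2_diff algebra_simps)
  qed
  define m where "m = (INF x\<in>carrier V. J x)"
  have bdd: "bdd_below (J ` carrier V)" using lower by (auto intro!: bdd_belowI)
  have m_le: "m \<le> J x" if "x \<in> carrier V" for x
    unfolding m_def using bdd that by (rule cINF_lower)
  have "\<exists>x. x \<in> carrier V \<and> J x < m + 1 / real (Suc n)" for n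
  proof -
    have "(INF x\<in>carrier V. J x) < m + 1 / real (Suc n)" unfolding m_def[symmetric] by simp
    then show ?thesis using cINF_less_iff[OF _ bdd] M.zero_closed by (metis empty_iff)
  qed
  then obtain s where s: "\<And>n. s n \<in> carrier V" "\<And>n. J (s n) < m + 1 / real (Suc n)" by metis
  have half: "(1 / 2 :: complex) \<in> K" using K_simps(4)[of "1 / 2"] by simp
  have close: "(hdist V x y)\<^sup>2 \<le> 2 * (J x - m) + 2 * (J y - m)" if "x \<in> carrier V" "y \<in> carrier V"
      for x y
  proof -
    define u where "u = (1 / 2) \<odot> (x \<oplus> y)"
    have "(hdist V x y)\<^sup>2 = 2 * J x + 2 * J y - 4 * J u"
      unfolding J_def u_def using that add smult by (rule parallelogram_functional)
    moreover have "m \<le> J u" unfolding u_def using m_le half that by simp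
    ultimately show ?thesis by (simp add: algebra_simps)
  qed
  have "metric.MCauchy s"
    unfolding metric.MCauchy_def
  proof (intro conjI allI impI)
    show "range s \<subseteq> carrier V" using s by auto
    fix \<epsilon> :: real assume \<epsilon>: "\<epsilon> > 0"
    \<comment> \<open>A quarter, because \<open>close\<close> doubles the excess over
      \<open>m\<close> of both points.\<close>
    obtain N where N: "1 / real (Suc N) < \<epsilon>\<^sup>2 / 4" using \<epsilon> nat_approx_posE[of "\<epsilon>\<^sup>2 / 4"] by auto
    have tail: "J (s n) - m < \<epsilon>\<^sup>2 / 4" if "N \<le> n" for n
    proof -
      have "1 / real (Suc n) \<le> 1 / real (Suc N)" using that by (simp add: frac_le)
      then show ?thesis using s(2)[of n] N by linarith
    qed
    have "hdist V (s n) (s n') < \<epsilon>" if "N \<le> n" "N \<le> n'" for n n'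
    proof -
      have "(hdist V (s n) (s n'))\<^sup>2 < \<epsilon>\<^sup>2"
          using close[OF s(1) s(1), of n n'] tail[OF that(1)] tail[OF that(2)] by argo
      then show ?thesis using \<epsilon> power2_less_imp_less by fastforce
    qed
    then show "\<exists>N. \<forall>n n'. N \<le> n \<longrightarrow> N \<le> n' \<longrightarrow> hdist V (s n) (s n') < \<epsilon>" by blast
  qed
  then obtain z where lim: "limitin metric.mtopology s z sequentially"
    using complete unfolding metric.mcomplete_def by blast
  then have z: "z \<in> carrier V" and d0: "(\<lambda>n. hdist V (s n) z) \<longlonglongrightarrow> 0"
    unfolding metric.limitin_metric_dist_null by auto
  have J_split: "J (x \<oplus> u) = J x + (hnorm V u)\<^sup>2 + 2 * Re (ip V u x - \<phi> u)"
    if "x \<in> carrier V" "u \<in> carrier V" for x u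
    using that ip_sym[of x u] unfolding J_def by (simp add: hnorm_add_sq add)
  have "J z \<le> m"
  proof -
    have "J z \<le> J (s n) + 2 * (hnorm V z + C) * hdist V (s n) z" for n
    proof -
      let ?u = "s n \<ominus> z"
      have u: "?u \<in> carrier V" "z \<oplus> ?u = s n"
        using s z M.a_lcomm[of z "s n" "\<ominus> z"] by (simp_all add: a_minus_def M.r_neg)
      have "cmod (ip V ?u z - \<phi> ?u) \<le> cmod (ip V ?u z) + cmod (\<phi> ?u)" by (rule norm_triangle_ineq4)
      also have "\<dots> \<le> hnorm V ?u * hnorm V z + C * hnorm V ?u"
        by (intro add_mono Cauchy_Schwarz bounded u z)
      finally have "- Re (ip V ?u z - \<phi> ?u) \<le> (hnorm V z + C) * hnorm V ?u"
        using abs_Re_le_cmod[of "ip V ?u z - \<phi> ?u"] by (simp add: algebra_simps)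
      moreover have "J (s n) = J z + (hnorm V ?u)\<^sup>2 + 2 * Re (ip V ?u z - \<phi> ?u)"
        using J_split[OF z u(1)] u(2) by simp
      moreover have "0 \<le> (hnorm V ?u)\<^sup>2" by simp
      ultimately have "J z \<le> J (s n) + 2 * ((hnorm V z + C) * hnorm V ?u)" by argo
      then show ?thesis using s z by (simp only: hdist_eq mult.assoc)
    qed
    moreover have "J (s n) \<le> m + 1 / real (Suc n)" for n using s(2)[of n] by simp
    ultimately have "J z \<le> (m + 1 / real (Suc n)) + 2 * (hnorm V z + C) * hdist V (s n) z" for n
      by (meson add_mono_thms_linordered_semiring(3) order_trans)
    moreover have "(\<lambda>n. (m + 1 / real (Suc n)) + 2 * (hnorm V z + C) * hdist V (s n) z) \<longlonglongrightarrow> (m + 0) +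
        2 * (hnorm V z + C) * 0"
      by (intro tendsto_intros d0 LIMSEQ_inverse_real_of_nat[unfolded inverse_eq_divide])
    ultimately show ?thesis by (intro LIMSEQ_le_const[of _ m]) auto
  qed
  have "\<phi> x = ip V x z" if x: "x \<in> carrier V" for x
  proof (rule ccontr)
    assume ne: "\<phi> x \<noteq> ip V x z"
    define w where "w = ip V x z - \<phi> x"
    have w: "w \<in> K" "w \<noteq> 0" using ne x z in_K ip_in by (auto simp: w_def)
    \<comment> \<open>The direction t is one of descent, with linear gain
      \<open>2 * q * (cmod w)^2\<close>. The step length q makes the quadratic loss at most half of
      it; the summand 1 covers the case x = 0.\<close>
    define q where "q = 1 / ((hnorm V x)\<^sup>2 + 1)"
    have "0 < (hnorm V x)\<^sup>2 + 1" by (rule add_nonneg_pos) simp_all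
    then have q: "q > 0" "q * (hnorm V x)\<^sup>2 \<le> 1" by (simp_all add: q_def divide_le_eq)
    define t where "t = - (of_real q * cnj w)"
    have t: "t \<in> K" using w by (simp add: t_def)
    have "J z \<le> J (z \<oplus> t \<odot> x)" using \<open>J z \<le> m\<close> m_le[of "z \<oplus> t \<odot> x"] t x z by simp
    then have "0 \<le> (hnorm V (t \<odot> x))\<^sup>2 + 2 * Re (ip V (t \<odot> x) z - \<phi> (t \<odot> x))"
      using J_split[OF z, of "t \<odot> x"] t x by simp
    also have "ip V (t \<odot> x) z - \<phi> (t \<odot> x) = t * w"
      using t x z by (simp add: ip_smult smult w_def algebra_simps)
    also have "t * w = - of_real (q * (cmod w)\<^sup>2)"
      by (simp only: t_def of_real_mult complex_norm_square mult_ac mult_minus_left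
          mult_minus_right)
    also have "(hnorm V (t \<odot> x))\<^sup>2 = q * (q * (hnorm V x)\<^sup>2) * (cmod w)\<^sup>2"
      using t x q by (simp add: hnorm_smult t_def norm_mult power_mult_distrib power2_eq_square)
    finally have "2 * (q * (cmod w)\<^sup>2) \<le> q * (q * (hnorm V x)\<^sup>2) * (cmod w)\<^sup>2"
      by (simp only: uminus_complex.sel Re_complex_of_real)
    also have "\<dots> \<le> q * 1 * (cmod w)\<^sup>2" using q by (intro mult_right_mono mult_left_mono) auto
    finally show False using q w by simp
  qed
  then show ?thesis using z by blast
qed

subsection \<open>Hilbert sums\<close>

locale ip_family =
  fixes K :: "complex set" and W :: "nat \<Rightarrow> 'b hspace"
  assumes ip_space_i: "ip_space K (W i)"
begin

sublocale W: ip_space K "W i" for i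
  by (rule ip_space_i)

abbreviation "L2 \<equiv> l2_sum W"

lemma l2_simps [simp]:
  "f \<in> carrier L2 \<longleftrightarrow> (\<forall>i. f i \<in> carrier (W i)) \<and> summable (\<lambda>i. (hnorm (W i) (f i))\<^sup>2)"
  "\<zero>\<^bsub>L2\<^esub> = (\<lambda>i. \<zero>\<^bsub>W i\<^esub>)" "f \<oplus>\<^bsub>L2\<^esub> g = (\<lambda>i. f i \<oplus>\<^bsub>W i\<^esub> g i)"
  "c \<odot>\<^bsub>L2\<^esub> f = (\<lambda>i. c \<odot>\<^bsub>W i\<^esub> f i)"
  by (simp_all add: l2_sum_def)

lemma l2_D:
  assumes "f \<in> carrier L2"
  shows "f i \<in> carrier (W i)" and "summable (\<lambda>i. (hnorm (W i) (f i))\<^sup>2)"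
  using assms by simp_all

lemma l2_ip: "ip L2 f g = (\<Sum>i. ip (W i) (f i) (g i))"
  by (simp add: l2_sum_def)

lemma l2_closed:
  assumes "f \<in> carrier L2" and "g \<in> carrier L2" and "c \<in> K"
  shows "f \<oplus>\<^bsub>L2\<^esub> g \<in> carrier L2" and "c \<odot>\<^bsub>L2\<^esub> f \<in> carrier L2"
proof -
  note fi = l2_D(1)[OF assms(1)] note gi = l2_D(1)[OF assms(2)]
  have "(hnorm (W i) (f i \<oplus>\<^bsub>W i\<^esub> g i))\<^sup>2 \<le> 2 * (hnorm (W i) (f i))\<^sup>2 + 2 * (hnorm (W i) (g i))\<^sup>2"
      for i
  proof -
    have "(hnorm (W i) (f i \<oplus>\<^bsub>W i\<^esub> g i))\<^sup>2 \<le> (hnorm (W i) (f i) + hnorm (W i) (g i))\<^sup>2"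
      by (intro power_mono W.hnorm_triangle W.hnorm_nonneg W.M.a_closed fi gi)
    also have "\<dots> \<le> 2 * (hnorm (W i) (f i))\<^sup>2 + 2 * (hnorm (W i) (g i))\<^sup>2"
      using sum_squares_bound[of "hnorm (W i) (f i)" "hnorm (W i) (g i)"] by (simp add: power2_sum)
    finally show ?thesis .
  qed
  moreover have "summable (\<lambda>i. 2 * (hnorm (W i) (f i))\<^sup>2 + 2 * (hnorm (W i) (g i))\<^sup>2)"
    by (rule summable_add[OF summable_mult[OF l2_D(2)[OF assms(1)]] summable_mult[OF l2_D(2)[OF
        assms(2)]]])
  ultimately have "summable (\<lambda>i. (hnorm (W i) (f i \<oplus>\<^bsub>W i\<^esub> g i))\<^sup>2)"
    by - (rule summable_comparison_test'[where N = 0], assumption, simp)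
  then show "f \<oplus>\<^bsub>L2\<^esub> g \<in> carrier L2" by (simp add: fi gi)
  have "summable (\<lambda>i. (cmod c)\<^sup>2 * (hnorm (W i) (f i))\<^sup>2)" 
    by (rule summable_mult[OF l2_D(2)[OF assms(1)]])
  then show "c \<odot>\<^bsub>L2\<^esub> f \<in> carrier L2"
    by (simp add: W.hnorm_smult power_mult_distrib fi assms(3))
qed

lemma l2_ip_summable:
  assumes "f \<in> carrier L2" and "g \<in> carrier L2"
  shows "summable (\<lambda>i. ip (W i) (f i) (g i))"
proof (rule summable_comparison_test'[where N = 0])
  show "summable (\<lambda>i. (hnorm (W i) (f i))\<^sup>2 + (hnorm (W i) (g i))\<^sup>2)"
    by (rule summable_add[OF l2_D(2)[OF assms(1)] l2_D(2)[OF assms(2)]])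
  show "norm (ip (W i) (f i) (g i)) \<le> (hnorm (W i) (f i))\<^sup>2 + (hnorm (W i) (g i))\<^sup>2" for i
  proof -
    have "norm (ip (W i) (f i) (g i)) \<le> hnorm (W i) (f i) * hnorm (W i) (g i)"
      by (rule W.Cauchy_Schwarz[OF l2_D(1)[OF assms(1)] l2_D(1)[OF assms(2)]])
    also have "\<dots> \<le> (hnorm (W i) (f i))\<^sup>2 + (hnorm (W i) (g i))\<^sup>2"
      using sum_squares_bound[of "hnorm (W i) (f i)" "hnorm (W i) (g i)"]
        zero_le_power2[of "hnorm (W i) (f i)"] zero_le_power2[of "hnorm (W i) (g i)"] by linarith
    finally show ?thesis .
  qed
qed

lemma l2_abelian_group: "abelian_group L2"
proof (rule abelian_groupI)
  fix f g h assume f: "f \<in> carrier L2" and g: "g \<in> carrier L2"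
  show "f \<oplus>\<^bsub>L2\<^esub> g \<in> carrier L2" using l2_closed(1)[OF f g W.K_simps(1)] .
  show "f \<oplus>\<^bsub>L2\<^esub> g = g \<oplus>\<^bsub>L2\<^esub> f" using f g by (simp add: W.M.a_comm)
  assume h: "h \<in> carrier L2"
  show "f \<oplus>\<^bsub>L2\<^esub> g \<oplus>\<^bsub>L2\<^esub> h = f \<oplus>\<^bsub>L2\<^esub> (g \<oplus>\<^bsub>L2\<^esub> h)" using f g h by (simp add: W.M.a_assoc)
next
  show "\<zero>\<^bsub>L2\<^esub> \<in> carrier L2" by simp
next
  fix f assume f: "f \<in> carrier L2"
  show "\<zero>\<^bsub>L2\<^esub> \<oplus>\<^bsub>L2\<^esub> f = f" using f by simp
  have "(-1) \<odot>\<^bsub>L2\<^esub> f \<in> carrier L2" using l2_closed(2)[OF f f W.K_simps(3)] .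
  moreover have "(-1) \<odot>\<^bsub>L2\<^esub> f \<oplus>\<^bsub>L2\<^esub> f = \<zero>\<^bsub>L2\<^esub>"
    using f by (simp add: W.a_inv_eq_smult[symmetric] W.M.l_neg)
  ultimately show "\<exists>g\<in>carrier L2. g \<oplus>\<^bsub>L2\<^esub> f = \<zero>\<^bsub>L2\<^esub>" by blast
qed

lemma l2_module: "Module.module (scalar_ring K) L2"
proof (rule moduleI)
  show "cring (scalar_ring K)" by (rule W.R.is_cring)
  show "abelian_group L2" by (rule l2_abelian_group)
  show "\<one>\<^bsub>scalar_ring K\<^esub> \<odot>\<^bsub>L2\<^esub> f = f" if "f \<in> carrier L2" for f
    using that W.smult_one by simp
  fix a b f g assume a: "a \<in> carrier (scalar_ring K)" and f: "f \<in> carrier L2"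
  show "a \<odot>\<^bsub>L2\<^esub> f \<in> carrier L2" using l2_closed(2)[OF f f] a by simp
  {
    assume b: "b \<in> carrier (scalar_ring K)"
    show "(a \<oplus>\<^bsub>scalar_ring K\<^esub> b) \<odot>\<^bsub>L2\<^esub> f = a \<odot>\<^bsub>L2\<^esub> f \<oplus>\<^bsub>L2\<^esub> b \<odot>\<^bsub>L2\<^esub> f"
      using a b f W.smult_l_distr[OF a b] by simp
    show "(a \<otimes>\<^bsub>scalar_ring K\<^esub> b) \<odot>\<^bsub>L2\<^esub> f = a \<odot>\<^bsub>L2\<^esub> (b \<odot>\<^bsub>L2\<^esub> f)"
      using a b f W.smult_assoc1[OF a b] by simp
  next
    assume g: "g \<in> carrier L2"
    show "a \<odot>\<^bsub>L2\<^esub> (f \<oplus>\<^bsub>L2\<^esub> g) = a \<odot>\<^bsub>L2\<^esub> f \<oplus>\<^bsub>L2\<^esub> a \<odot>\<^bsub>L2\<^esub> g"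
      using a f g W.smult_r_distr[OF a] by simp
  }
qed

lemma l2_ip_space: "ip_space K L2"
proof (rule ip_space.intro)
  show "K = \<real> \<or> K = UNIV" by (rule W.scalars)
  show "Module.module (scalar_ring K) L2" by (rule l2_module)
  fix f g assume f: "f \<in> carrier L2" and g: "g \<in> carrier L2"
  have fi: "f i \<in> carrier (W i)" and gi: "g i \<in> carrier (W i)" for i using f g by simp_all
  have sums: "(\<lambda>i. ip (W i) (f i) (g i)) sums ip L2 f g"
    unfolding l2_ip using l2_ip_summable[OF f g] by (rule summable_sums)
  show "ip L2 f g \<in> K"
  proof (cases "K = \<real>")
    case True
    then have "Im (ip (W i) (f i) (g i)) = 0" for i
      using W.ip_in[OF fi gi] by (simp add: complex_is_Real_iff)
    then have "(\<lambda>_. 0) sums Im (ip L2 f g)" using sums_Im[OF sums] by simp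
    then have "Im (ip L2 f g) = 0" using sums_unique2 sums_zero by blast
    then show ?thesis using True by (simp add: complex_is_Real_iff)
  next
    case False
    then show ?thesis using W.scalars by simp
  qed
  have "(\<lambda>i. cnj (ip (W i) (f i) (g i))) sums cnj (ip L2 f g)" using sums by (simp add: sums_cnj)
  then show "ip L2 g f = cnj (ip L2 f g)"
    unfolding l2_ip[of g f] using W.ip_sym[OF fi gi] by (simp add: sums_iff)
  show "ip L2 (f \<oplus>\<^bsub>L2\<^esub> g) h = ip L2 f h + ip L2 g h" if h: "h \<in> carrier L2" for h
  proof -
    have "h i \<in> carrier (W i)" for i using h by simp
    then show ?thesis using suminf_add[OF l2_ip_summable[OF f h] l2_ip_summable[OF g h]]
      by (simp add: l2_ip W.ip_add fi gi)
  qed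
  show "ip L2 (c \<odot>\<^bsub>L2\<^esub> f) g = c * ip L2 f g" if c: "c \<in> K" for c
    using suminf_mult[OF l2_ip_summable[OF f g], of c] by (simp add: l2_ip W.ip_smult c fi gi)
  have self: "ip L2 f f = of_real (\<Sum>i. (hnorm (W i) (f i))\<^sup>2)"
    unfolding l2_ip using f by (simp add: W.ip_self fi suminf_of_real flip: of_real_power)
  show "0 \<le> Re (ip L2 f f)" using f by (simp add: self suminf_nonneg)
  show "f = \<zero>\<^bsub>L2\<^esub>" if "ip L2 f f = 0"
  proof -
    have "(\<Sum>i. (hnorm (W i) (f i))\<^sup>2) = 0" using that unfolding self by simp
    then have "(hnorm (W i) (f i))\<^sup>2 = 0" for i
        using f suminf_eq_zero_iff[of "\<lambda>i. (hnorm (W i) (f i))\<^sup>2"] by simp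
    then show ?thesis using W.hnorm_eq_0[OF fi] by auto
  qed
qed

sublocale L2: ip_space K L2
  by (rule l2_ip_space)

lemma l2_hnorm_sq:
  assumes f: "f \<in> carrier L2"
  shows "(hnorm L2 f)\<^sup>2 = (\<Sum>i. (hnorm (W i) (f i))\<^sup>2)"
proof -
  have "ip L2 f f = of_real (\<Sum>i. (hnorm (W i) (f i))\<^sup>2)"
    unfolding l2_ip using f by (simp add: W.ip_self suminf_of_real flip: of_real_power)
  then show ?thesis using f by (simp only: L2.hnorm_sq Re_complex_of_real)
qed

lemma l2_single:
  assumes x: "x \<in> carrier (W i)"
  defines "s \<equiv> (\<lambda>j. if j = i then x else \<zero>\<^bsub>W j\<^esub>)"
  shows "s \<in> carrier L2" and "f \<in> carrier L2 \<Longrightarrow> ip L2 f s = ip (W i) (f i) x"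
proof -
  have "(\<lambda>j. (hnorm (W j) (s j))\<^sup>2) = (\<lambda>j. if j = i then (hnorm (W i) x)\<^sup>2 else 0)"
    by (auto simp: s_def)
  then have "summable (\<lambda>j. (hnorm (W j) (s j))\<^sup>2)" by simp
  then show "s \<in> carrier L2" using x by (simp add: s_def)
  assume f: "f \<in> carrier L2"
  then have "(\<lambda>j. ip (W j) (f j) (s j)) = (\<lambda>j. if j = i then ip (W i) (f i) x else 0)"
    by (auto simp: s_def)
  then show "ip L2 f s = ip (W i) (f i) x"
    unfolding l2_ip using sums_unique[OF sums_single[of i "\<lambda>_. ip (W i) (f i) x"]] by simp
qed

end

subsection \<open>Adjoints and the synthesis operator\<close>

text \<open>Existence for the definite description comes from Riesz applied to the functional
  \<open>ip W (L x) y\<close> of x, uniqueness from \<open>ip_eqI\<close>.\<close>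

lemma adjoint_op:
  assumes V: "ip_space K V" "Metric_space.mcomplete (carrier V) (hdist V)" and W: "ip_space K W"
    and L: "bounded_op K V W L" and y: "y \<in> carrier W"
  shows "adjoint_op V W L y \<in> carrier V"
    and "x \<in> carrier V \<Longrightarrow> ip V x (adjoint_op V W L y) = ip W (L x) y"
proof -
  interpret V: ip_space K V by (rule V)
  interpret W: ip_space K W by (rule W)
  obtain B where L_in: "\<And>x. x \<in> carrier V \<Longrightarrow> L x \<in> carrier W"
    and L_add: "\<And>x y. x \<in> carrier V \<Longrightarrow> y \<in> carrier V \<Longrightarrow> L (x \<oplus>\<^bsub>V\<^esub> y) = L x \<oplus>\<^bsub>W\<^esub> L y"
    and L_smult: "\<And>c x. c \<in> K \<Longrightarrow> x \<in> carrier V \<Longrightarrow> L (c \<odot>\<^bsub>V\<^esub> x) = c \<odot>\<^bsub>W\<^esub> L x"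
    and B: "\<And>x. x \<in> carrier V \<Longrightarrow> hnorm W (L x) \<le> B * hnorm V x"
    using L unfolding bounded_op_def by blast
  have "\<exists>z\<in>carrier V. \<forall>x\<in>carrier V. ip W (L x) y = ip V x z"
  proof (rule V.Riesz[OF V(2), where C = "B * hnorm W y"])
    fix x assume x: "x \<in> carrier V"
    have "cmod (ip W (L x) y) \<le> hnorm W (L x) * hnorm W y" by (intro W.Cauchy_Schwarz L_in x y)
    also have "\<dots> \<le> B * hnorm V x * hnorm W y" by (intro mult_right_mono B x W.hnorm_nonneg y)
    finally show "cmod (ip W (L x) y) \<le> B * hnorm W y * hnorm V x" by (simp add: mult_ac)
  qed (use y L_in in \<open>simp_all add: L_add L_smult W.ip_add W.ip_smult W.ip_in\<close>)
  then obtain z where z: "z \<in> carrier V" "\<forall>x\<in>carrier V. ip W (L x) y = ip V x z" by blast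
  have "adjoint_op V W L y = z"
    unfolding adjoint_op_def
    by (rule the_equality) (use z in \<open>auto intro!: V.ip_eqI\<close>)
  then show "adjoint_op V W L y \<in> carrier V"
    and "x \<in> carrier V \<Longrightarrow> ip V x (adjoint_op V W L y) = ip W (L x) y"
    using z by auto
qed

locale frame = ip_family K W for K and W :: "nat \<Rightarrow> 'b hspace" +
  fixes H :: "'a hspace" and \<Lambda> :: "nat \<Rightarrow> 'a \<Rightarrow> 'b"
  assumes hilbert: "hilbert_space K H" and g_frame: "g_frame K H W \<Lambda>"
begin

sublocale H: ip_space K H
  by (rule ip_spaceI) (rule hilbert)

lemma H_complete: "H.metric.mcomplete"
  using hilbert by (simp add: hilbert_space_def)

lemma \<Lambda>_bounded: "bounded_op K H (W i) (\<Lambda> i)"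
  using g_frame by (simp add: g_frame_def)

lemma \<Lambda>_in [simp]: "x \<in> carrier H \<Longrightarrow> \<Lambda> i x \<in> carrier (W i)"
  using \<Lambda>_bounded[of i] by (simp add: bounded_op_def)

lemma \<Lambda>_add: "x \<in> carrier H \<Longrightarrow> y \<in> carrier H \<Longrightarrow> \<Lambda> i (x \<oplus>\<^bsub>H\<^esub> y) = \<Lambda> i x \<oplus>\<^bsub>W i\<^esub> \<Lambda> i y"
  using \<Lambda>_bounded[of i] by (simp add: bounded_op_def)

lemma \<Lambda>_smult: "c \<in> K \<Longrightarrow> x \<in> carrier H \<Longrightarrow> \<Lambda> i (c \<odot>\<^bsub>H\<^esub> x) = c \<odot>\<^bsub>W i\<^esub> \<Lambda> i x"
  using \<Lambda>_bounded[of i] by (simp add: bounded_op_def)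

text \<open>The analysis operator of the frame, a bounded map into the l2 sum by the upper frame
  bound. T will be recognized as its adjoint.\<close>

definition analysis :: "'a \<Rightarrow> nat \<Rightarrow> 'b" where
  "analysis x i = \<Lambda> i x"

lemma analysis_in: "x \<in> carrier H \<Longrightarrow> analysis x \<in> carrier L2"
  using g_frame by (auto simp: analysis_def g_frame_def)

lemma analysis_bounded:
  obtains C where "0 \<le> C" "\<And>x. x \<in> carrier H \<Longrightarrow> hnorm L2 (analysis x) \<le> C * hnorm H x"
proof -
  obtain B where B: "0 < B"
    "\<And>f. f \<in> carrier H \<Longrightarrow> (\<Sum>i. (hnorm (W i) (\<Lambda> i f))\<^sup>2) \<le> B * (hnorm H f)\<^sup>2"
    using g_frame unfolding g_frame_def by (meson less_le_trans)
  have "hnorm L2 (analysis x) \<le> sqrt B * hnorm H x" if x: "x \<in> carrier H" for x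
  proof -
    have "(hnorm L2 (analysis x))\<^sup>2 \<le> (sqrt B * hnorm H x)\<^sup>2"
      unfolding l2_hnorm_sq[OF analysis_in[OF x]] using B(2)[OF x] B(1)
      by (simp add: analysis_def power_mult_distrib)
    moreover have "0 \<le> sqrt B * hnorm H x"
      using B(1) H.hnorm_nonneg[OF x] by simp
    ultimately show ?thesis by (rule power2_le_imp_le)
  qed
  then show ?thesis using that[of "sqrt B"] B(1) by simp
qed

abbreviation adj :: "nat \<Rightarrow> 'b \<Rightarrow> 'a" where
  "adj i \<equiv> adjoint_op H (W i) (\<Lambda> i)"

lemma adj_in [simp]: "y \<in> carrier (W i) \<Longrightarrow> adj i y \<in> carrier H"
  by (rule adjoint_op[OF H.ip_space_axioms H_complete W.ip_space_axioms \<Lambda>_bounded])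

lemma ip_adj: "y \<in> carrier (W i) \<Longrightarrow> x \<in> carrier H \<Longrightarrow> ip H x (adj i y) = ip (W i) (\<Lambda> i x) y"
  by (rule adjoint_op[OF H.ip_space_axioms H_complete W.ip_space_axioms \<Lambda>_bounded])

text \<open>The adjoint of the analysis operator at f, obtained from Riesz before anything is known
  about convergence of the synthesis series.\<close>

lemma synthesis_exists:
  assumes f: "f \<in> carrier L2"
  shows "\<exists>y\<in>carrier H. \<forall>x\<in>carrier H. ip L2 (analysis x) f = ip H x y"
proof -
  obtain C where C: "\<And>x. x \<in> carrier H \<Longrightarrow> hnorm L2 (analysis x) \<le> C * hnorm H x"
    using analysis_bounded by blast
  have add: "analysis (x \<oplus>\<^bsub>H\<^esub> y) = analysis x \<oplus>\<^bsub>L2\<^esub> analysis y" if "x \<in> carrier H" "y \<in> carrier H"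
      for x y
    using that by (simp add: analysis_def \<Lambda>_add fun_eq_iff)
  have smult: "analysis (c \<odot>\<^bsub>H\<^esub> x) = c \<odot>\<^bsub>L2\<^esub> analysis x" if "c \<in> K" "x \<in> carrier H" for c x
    using that by (simp add: analysis_def \<Lambda>_smult fun_eq_iff)
  show ?thesis
  proof (rule H.Riesz[OF H_complete, where C = "C * hnorm L2 f"])
    fix x y assume x: "x \<in> carrier H"
    show "ip L2 (analysis x) f \<in> K" by (intro L2.ip_in analysis_in x f)
    have "cmod (ip L2 (analysis x) f) \<le> hnorm L2 (analysis x) * hnorm L2 f"
      by (intro L2.Cauchy_Schwarz analysis_in x f)
    also have "\<dots> \<le> C * hnorm H x * hnorm L2 f" by (intro mult_right_mono C x L2.hnorm_nonneg f)
    finally show "cmod (ip L2 (analysis x) f) \<le> C * hnorm L2 f * hnorm H x" by (simp add: mult_ac)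
    show "ip L2 (analysis (c \<odot>\<^bsub>H\<^esub> x)) f = c * ip L2 (analysis x) f" if "c \<in> K" for c
      unfolding smult[OF that x] by (intro L2.ip_smult that analysis_in x f)
    assume y: "y \<in> carrier H"
    show "ip L2 (analysis (x \<oplus>\<^bsub>H\<^esub> y)) f = ip L2 (analysis x) f + ip L2 (analysis y) f"
      unfolding add[OF x y] by (intro L2.ip_add analysis_in x y f)
  qed
qed

text \<open>The error of a partial sum is the adjoint applied to a tail of f, so by duality its norm
  is at most C times the norm of that tail.\<close>

lemma synthesis_partial:
  assumes f: "f \<in> carrier L2" and y: "y \<in> carrier H"
    and ip_y: "\<And>x. x \<in> carrier H \<Longrightarrow> ip H x y = ip L2 (analysis x) f"
  shows "limitin (htopology H) (\<lambda>n. \<Oplus>\<^bsub>H\<^esub>i\<in>{..<n}. adj i (f i)) y sequentially"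
proof -
  obtain C where C: "0 \<le> C" "\<And>x. x \<in> carrier H \<Longrightarrow> hnorm L2 (analysis x) \<le> C * hnorm H x"
    using analysis_bounded by blast
  have fi: "f i \<in> carrier (W i)" for i using f by simp
  let ?y = "\<lambda>n. \<Oplus>\<^bsub>H\<^esub>i\<in>{..<n}. adj i (f i)"
  have y_in: "?y n \<in> carrier H" for n by (intro H.M.finsum_closed) (auto simp: fi)
  \<comment> \<open>The tail of f from index n on. Its squared norms are computed as a difference of
    sums, which gives both membership in the l2 sum and the limit 0.\<close>
  define r where "r n = (\<lambda>i. if i < n then \<zero>\<^bsub>W i\<^esub> else f i)" for n
  have norm_f: "summable (\<lambda>i. (hnorm (W i) (f i))\<^sup>2)" using f by simp
  have norm_r: "(hnorm (W i) (r n i))\<^sup>2 = (if i < n then 0 else (hnorm (W i) (f i))\<^sup>2)" for n i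
    by (simp add: r_def)
  have r_sums: "(\<lambda>i. (hnorm (W i) (r n i))\<^sup>2) sums ((\<Sum>i. (hnorm (W i) (f i))\<^sup>2) - (\<Sum>i<n. (hnorm (W
      i) (f i))\<^sup>2))" for n
  proof -
    have "(\<lambda>i. if i < n then (hnorm (W i) (f i))\<^sup>2 else 0) sums (\<Sum>i<n. (hnorm (W i) (f i))\<^sup>2)"
      using sums_If_finite[of "\<lambda>i. i < n" "\<lambda>i. (hnorm (W i) (f i))\<^sup>2"] by (simp add: lessThan_def)
    from sums_diff[OF summable_sums[OF norm_f] this] show ?thesis
      unfolding norm_r by (rule sums_cong[THEN iffD1, rotated]) simp
  qed
  then have r_in: "r n \<in> carrier L2" for n
    using sums_summable[OF r_sums] fi by (simp add: r_def)
  have r_norm: "(hnorm L2 (r n))\<^sup>2 = (\<Sum>i. (hnorm (W i) (f i))\<^sup>2) - (\<Sum>i<n. (hnorm (W i) (f i))\<^sup>2)"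
      for n
    unfolding l2_hnorm_sq[OF r_in] using r_sums by (rule sums_unique[symmetric])
  have tail: "(\<lambda>n. hnorm L2 (r n)) \<longlonglongrightarrow> 0"
  proof -
    have "(\<lambda>n. (\<Sum>i. (hnorm (W i) (f i))\<^sup>2) - (\<Sum>i<n. (hnorm (W i) (f i))\<^sup>2)) \<longlonglongrightarrow>
        (\<Sum>i. (hnorm (W i) (f i))\<^sup>2) - (\<Sum>i. (hnorm (W i) (f i))\<^sup>2)"
      by (intro tendsto_intros summable_LIMSEQ norm_f)
    then have "(\<lambda>n. sqrt ((hnorm L2 (r n))\<^sup>2)) \<longlonglongrightarrow> sqrt 0" unfolding r_norm by
        (intro tendsto_real_sqrt) simp
    then show ?thesis using r_in by (simp add: L2.hnorm_nonneg del: l2_simps)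
  qed
  have "ip H x (y \<ominus>\<^bsub>H\<^esub> ?y n) = ip L2 (analysis x) (r n)" if x: "x \<in> carrier H" for x n
  proof -
    have "ip H x (?y n) = (\<Sum>i<n. ip (W i) (\<Lambda> i x) (f i))"
      by (subst H.ip_finsum_right) (auto simp: fi x ip_adj)
    moreover have "(\<lambda>i. ip (W i) (\<Lambda> i x) (r n i)) sums (ip L2 (analysis x) f - (\<Sum>i<n. ip (W i) (\<Lambda> i
        x) (f i)))"
    proof -
      have 1: "(\<lambda>i. if i < n then ip (W i) (\<Lambda> i x) (f i) else 0) sums (\<Sum>i<n. ip (W i) (\<Lambda> i x) (f
          i))"
        using sums_If_finite[of "\<lambda>i. i < n" "\<lambda>i. ip (W i) (\<Lambda> i x) (f i)"] by
            (simp add: lessThan_def)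
      have 2: "(\<lambda>i. ip (W i) (\<Lambda> i x) (f i)) sums ip L2 (analysis x) f"
        using summable_sums[OF l2_ip_summable[OF analysis_in[OF x] f]] by
            (simp add: l2_ip analysis_def)
      from sums_diff[OF 2 1] show ?thesis
        by (rule sums_cong[THEN iffD1, rotated]) (simp add: r_def x)
    qed
    then have "ip L2 (analysis x) (r n) = ip L2 (analysis x) f - (\<Sum>i<n. ip (W i) (\<Lambda> i x) (f i))"
      unfolding l2_ip[of _ "r n"] analysis_def by (rule sums_unique[symmetric])
    ultimately show ?thesis using x y y_in by (simp add: H.ip_diff_right ip_y)
  qed
  then have bound: "hnorm H (y \<ominus>\<^bsub>H\<^esub> ?y n) \<le> C * hnorm L2 (r n)" for n
  proof (intro H.hnorm_le_by_ip)
    fix x assume x: "x \<in> carrier H"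
    have "cmod (ip L2 (analysis x) (r n)) \<le> hnorm L2 (analysis x) * hnorm L2 (r n)"
      by (intro L2.Cauchy_Schwarz analysis_in x r_in)
    also have "\<dots> \<le> C * hnorm H x * hnorm L2 (r n)" by
        (intro mult_right_mono C x L2.hnorm_nonneg r_in)
    finally show "cmod (ip H x (y \<ominus>\<^bsub>H\<^esub> ?y n)) \<le> C * hnorm L2 (r n) * hnorm H x"
      using \<open>\<And>x n. x \<in> carrier H \<Longrightarrow> ip H x (y \<ominus>\<^bsub>H\<^esub> ?y n) = ip L2 (analysis x) (r n)\<close> x by
          (simp add: mult_ac)
  qed (use y y_in C L2.hnorm_nonneg[OF r_in] in auto)
  have "(\<lambda>n. hdist H (?y n) y) \<longlonglongrightarrow> 0"
  proof (rule tendsto_sandwich[of "\<lambda>_. 0" _ _ "\<lambda>n. C * hnorm L2 (r n)"])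
    show "\<forall>\<^sub>F n in sequentially. hdist H (?y n) y \<le> C * hnorm L2 (r n)"
      using bound y y_in by (simp add: H.hdist_eq H.metric.commute[of "?y _" y])
    show "(\<lambda>n. C * hnorm L2 (r n)) \<longlonglongrightarrow> 0" using tendsto_mult_right_zero[OF tail, of C] by
        (simp add: mult.commute)
  qed auto
  then show ?thesis unfolding H.metric.limitin_metric_dist_null using y y_in by simp
qed

lemma synthesis_op:
  assumes f: "f \<in> carrier L2"
  shows "synthesis_op H W \<Lambda> f \<in> carrier H"
    and "x \<in> carrier H \<Longrightarrow> ip H x (synthesis_op H W \<Lambda> f) = ip L2 (analysis x) f"
proof -
  obtain y where y: "y \<in> carrier H" "\<And>x. x \<in> carrier H \<Longrightarrow> ip H x y = ip L2 (analysis x) f"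
    using synthesis_exists[OF f] by force
  have "synthesis_op H W \<Lambda> f = y"
    unfolding synthesis_op_def
    using synthesis_partial[OF f y] H.metric.limitin_metric_unique trivial_limit_sequentially
    by (intro the_equality) blast+
  then show "synthesis_op H W \<Lambda> f \<in> carrier H"
    and "x \<in> carrier H \<Longrightarrow> ip H x (synthesis_op H W \<Lambda> f) = ip L2 (analysis x) f"
    using y by auto
qed

text \<open>The vector y is \<open>T g\<close>, described by its inner products because
  \<open>exact\<close> below is given in this form.\<close>

lemma synthesis_lipschitz:
  obtains C where "0 \<le> C"
    "\<And>f g y. f \<in> carrier L2 \<Longrightarrow> g \<in> carrier L2 \<Longrightarrow> y \<in> carrier H \<Longrightarrow>
       (\<And>x. x \<in> carrier H \<Longrightarrow> ip H x y = ip L2 (analysis x) g) \<Longrightarrow>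
       hdist H y (synthesis_op H W \<Lambda> f) \<le> C * hdist L2 g f"
proof -
  obtain C where C: "0 \<le> C" "\<And>x. x \<in> carrier H \<Longrightarrow> hnorm L2 (analysis x) \<le> C * hnorm H x"
    using analysis_bounded by blast
  have "hdist H y (synthesis_op H W \<Lambda> f) \<le> C * hdist L2 g f"
    if f: "f \<in> carrier L2" and g: "g \<in> carrier L2" and y: "y \<in> carrier H"
      and ip_y: "\<And>x. x \<in> carrier H \<Longrightarrow> ip H x y = ip L2 (analysis x) g" for f g y
  proof -
    have diff: "g \<ominus>\<^bsub>L2\<^esub> f \<in> carrier L2" using f g by (intro L2.M.minus_closed)
    note T = synthesis_op[OF f]
    have "hnorm H (y \<ominus>\<^bsub>H\<^esub> synthesis_op H W \<Lambda> f) \<le> C * hnorm L2 (g \<ominus>\<^bsub>L2\<^esub> f)"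
    proof (rule H.hnorm_le_by_ip)
      fix x assume x: "x \<in> carrier H"
      have "ip H x (y \<ominus>\<^bsub>H\<^esub> synthesis_op H W \<Lambda> f) = ip L2 (analysis x) (g \<ominus>\<^bsub>L2\<^esub> f)"
        using H.ip_diff_right[OF y T(1) x] L2.ip_diff_right[OF g f analysis_in[OF x]] ip_y[OF x]
            T(2)[OF x] by simp
      also have "cmod \<dots> \<le> hnorm L2 (analysis x) * hnorm L2 (g \<ominus>\<^bsub>L2\<^esub> f)"
        by (intro L2.Cauchy_Schwarz analysis_in x diff)
      also have "\<dots> \<le> C * hnorm H x * hnorm L2 (g \<ominus>\<^bsub>L2\<^esub> f)"
        by (intro mult_right_mono C x L2.hnorm_nonneg diff)
      finally show "cmod (ip H x (y \<ominus>\<^bsub>H\<^esub> synthesis_op H W \<Lambda> f))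
          \<le> C * hnorm L2 (g \<ominus>\<^bsub>L2\<^esub> f) * hnorm H x"
        by (simp add: mult_ac)
    qed (use y T(1) C L2.hnorm_nonneg[OF diff] in auto)
    then show ?thesis using H.hdist_eq[OF y T(1)] L2.hdist_eq[OF g f] by simp
  qed
  then show ?thesis using that C by blast
qed

end

section \<open>Arithmetic on codes\<close>

lemma rat_enum_eq: "rat_enum n = real_of_int (int_decode (fst (prod_decode n))) / real (Suc (snd
    (prod_decode n)))"
  by (simp add: rat_enum_def split: prod.split)

text \<open>The enumeration stores a denominator as its predecessor. Fractions are not reduced, so a
  rational number has many codes and the operations below respect values only.\<close>

definition rat_code :: "int \<Rightarrow> nat \<Rightarrow> nat" where
  "rat_code i m = prod_encode (int_encode i, m - 1)"

lemma rat_enum_code: "0 < m \<Longrightarrow> rat_enum (rat_code i m) = real_of_int i / real m"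
  by (simp add: rat_enum_eq rat_code_def del: of_nat_Suc)

definition radd :: "nat \<Rightarrow> nat \<Rightarrow> nat" where
  "radd a b = rat_code
     (int_decode (fst (prod_decode a)) * int (Suc (snd (prod_decode b))) +
      int_decode (fst (prod_decode b)) * int (Suc (snd (prod_decode a))))
     (Suc (snd (prod_decode a)) * Suc (snd (prod_decode b)))"

definition rmul :: "nat \<Rightarrow> nat \<Rightarrow> nat" where
  "rmul a b = rat_code (int_decode (fst (prod_decode a)) * int_decode (fst (prod_decode b)))
     (Suc (snd (prod_decode a)) * Suc (snd (prod_decode b)))"

definition rneg :: "nat \<Rightarrow> nat" where
  "rneg a = rat_code (- int_decode (fst (prod_decode a))) (Suc (snd (prod_decode a)))"

definition rless :: "nat \<Rightarrow> nat \<Rightarrow> bool" where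
  "rless a b \<longleftrightarrow> int_decode (fst (prod_decode a)) * int (Suc (snd (prod_decode b)))
     < int_decode (fst (prod_decode b)) * int (Suc (snd (prod_decode a)))"

lemma rat_enum_radd: "rat_enum (radd a b) = rat_enum a + rat_enum b"
proof -
  have "0 < m \<Longrightarrow> 0 < n \<Longrightarrow> rat_enum (rat_code (i * int n + j * int m) (m * n)) =
      real_of_int i / real m + real_of_int j / real n" for i j m n
    by (subst rat_enum_code) (simp_all add: field_simps)
  then show ?thesis unfolding radd_def rat_enum_eq[of a] rat_enum_eq[of b] by blast
qed

lemma rat_enum_rmul: "rat_enum (rmul a b) = rat_enum a * rat_enum b"
proof -
  have "0 < m \<Longrightarrow> 0 < n \<Longrightarrow> rat_enum (rat_code (i * j) (m * n)) =
      real_of_int i / real m * (real_of_int j / real n)" for i j m n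
    by (subst rat_enum_code) simp_all
  then show ?thesis unfolding rmul_def rat_enum_eq[of a] rat_enum_eq[of b] by blast
qed

lemma rat_enum_rneg: "rat_enum (rneg a) = - rat_enum a"
  unfolding rneg_def by (subst rat_enum_code) (simp_all add: rat_enum_eq del: of_nat_Suc)

lemma rless_iff: "rless a b \<longleftrightarrow> rat_enum a < rat_enum b"
proof -
  have "i / real (Suc m) < j / real (Suc n) \<longleftrightarrow> i * real (Suc n) < j * real (Suc m)" for i j :: real
      and m n
    by (simp add: divide_less_eq less_divide_eq mult.commute del: of_nat_Suc)
  then have "rat_enum a < rat_enum b \<longleftrightarrow>
      real_of_int (int_decode (fst (prod_decode a)) * int (Suc (snd (prod_decode b))))
      < real_of_int (int_decode (fst (prod_decode b)) * int (Suc (snd (prod_decode a))))"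
    unfolding rat_enum_eq of_int_mult of_int_of_nat_eq .
  then show ?thesis unfolding rless_def of_int_less_iff by blast
qed

lemma computable_rat_code [computable_intros]:
  "computable f \<Longrightarrow> computable g \<Longrightarrow> computable (\<lambda>x. rat_code (f x) (g x))"
  unfolding rat_code_def by (intro computable_intros)

lemma computable_radd [computable_intros]:
  assumes "computable f" and "computable g"
  shows "computable (\<lambda>x. radd (f x) (g x))"
  unfolding radd_def by (intro computable_intros assms)

lemma computable_rmul [computable_intros]:
  assumes "computable f" and "computable g"
  shows "computable (\<lambda>x. rmul (f x) (g x))"
  unfolding rmul_def by (intro computable_intros assms)

lemma computable_rneg [computable_intros]:
  assumes "computable f"
  shows "computable (\<lambda>x. rneg (f x))"
  unfolding rneg_def by (intro computable_intros assms)

lemma computable_rless [computable_intros]: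
  assumes "computable f" and "computable g"
  shows "computable (\<lambda>x. rless (f x) (g x))"
  unfolding rless_def by (intro computable_intros assms)

subsection \<open>Scalars\<close>

text \<open>The field is fixed, so the distinction between the two cases is made outside the
  computation.\<close>

definition sadd :: "complex set \<Rightarrow> nat \<Rightarrow> nat \<Rightarrow> nat" where
  "sadd K a b = (if K = \<real> then radd a b else
     prod_encode (radd (fst (prod_decode a)) (fst (prod_decode b)), radd (snd (prod_decode a)) (snd
         (prod_decode b))))"

definition smul :: "complex set \<Rightarrow> nat \<Rightarrow> nat \<Rightarrow> nat" where
  "smul K a b = (if K = \<real> then rmul a b else
     prod_encode
       (radd (rmul (fst (prod_decode a)) (fst (prod_decode b)))
          (rneg (rmul (snd (prod_decode a)) (snd (prod_decode b)))),
        radd (rmul (fst (prod_decode a)) (snd (prod_decode b)))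
          (rmul (snd (prod_decode a)) (fst (prod_decode b)))))"

lemma scalar_enum_eq:
  "scalar_enum K n = (if K = \<real> then of_real (rat_enum n)
     else Complex (rat_enum (fst (prod_decode n))) (rat_enum (snd (prod_decode n))))"
  by (simp add: scalar_enum_def split: prod.split)

lemma scalar_enum_sadd: "scalar_enum K (sadd K a b) = scalar_enum K a + scalar_enum K b"
  by (simp add: scalar_enum_eq sadd_def rat_enum_radd complex_eq_iff)

lemma scalar_enum_smul: "scalar_enum K (smul K a b) = scalar_enum K a * scalar_enum K b"
  by (simp add: scalar_enum_eq smul_def rat_enum_radd rat_enum_rmul rat_enum_rneg complex_eq_iff)

lemma computable_sadd [computable_intros]:
  assumes "computable f" and "computable g"
  shows "computable (\<lambda>x. sadd K (f x) (g x))"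
  unfolding sadd_def by (cases "K = \<real>") (simp_all only: if_True if_False,
      (intro computable_intros assms)+)

lemma computable_smul [computable_intros]:
  assumes "computable f" and "computable g"
  shows "computable (\<lambda>x. smul K (f x) (g x))"
  unfolding smul_def by (cases "K = \<real>") (simp_all only: if_True if_False,
      (intro computable_intros assms)+)

lemma rat_enum_0: "rat_enum 0 = 0"
proof -
  have "prod_decode 0 = (0, 0)" by (simp add: prod_decode_def prod_decode_aux.simps)
  moreover have "int_decode 0 = 0" by (simp add: int_decode_def sum_decode_def)
  ultimately show ?thesis by (simp add: rat_enum_eq)
qed

text \<open>This makes 0 a suitable default when coefficient lists of different lengths are
  padded.\<close>

lemma scalar_enum_0: "scalar_enum K 0 = 0"
proof -
  have "prod_decode 0 = (0, 0)" by (simp add: prod_decode_def prod_decode_aux.simps)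
  then show ?thesis by (simp add: scalar_enum_eq rat_enum_0 complex_eq_iff)
qed

lemma rat_enum_abs_le: "\<bar>rat_enum n\<bar> \<le> real n"
proof -
  have "\<bar>int_decode k\<bar> \<le> int k" for k
  proof -
    have "odd k \<Longrightarrow> Suc (k div 2) \<le> k" by presburger
    then have "odd k \<Longrightarrow> 1 + int (k div 2) \<le> int k" by linarith
    then show ?thesis by (auto simp: int_decode_def sum_decode_def)
  qed
  then have "\<bar>real_of_int (int_decode k)\<bar> \<le> real k" for k by
      (metis of_int_abs of_int_le_iff of_int_of_nat_eq)
  moreover have "real (fst (prod_decode n)) \<le> real n"
    using le_prod_encode_1[of "fst (prod_decode n)" "snd (prod_decode n)"] by simp
  ultimately have i: "\<bar>real_of_int (int_decode (fst (prod_decode n)))\<bar> \<le> real n" by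
      (meson order_trans)
  have "\<bar>j / real (Suc k)\<bar> \<le> \<bar>j\<bar>" for j :: real and k
  proof -
    have "\<bar>j\<bar> * 1 \<le> \<bar>j\<bar> * real (Suc k)" by (rule mult_left_mono) simp_all
    then show ?thesis by (simp add: abs_divide divide_le_eq)
  qed
  from order_trans[OF this i] show ?thesis unfolding rat_enum_eq .
qed

text \<open>A crude bound that can be read off the code; the accuracy of the algorithm is chosen
  with it. In the complex case it rests on a pair code being at least the sum of the
  components.\<close>

lemma scalar_enum_norm_le: "cmod (scalar_enum K n) \<le> real n"
proof (cases "K = \<real>")
  case True
  then show ?thesis by (simp add: scalar_enum_eq rat_enum_abs_le)
next
  case False
  obtain a b where ab: "prod_decode n = (a, b)" by fastforce
  have n: "n = triangle (a + b) + a" using prod_decode_inverse[of n, unfolded ab] by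
      (simp add: prod_encode_def)
  have "k \<le> triangle k" for k by (induction k) auto
  from this[of "a + b"] have "a + b \<le> n" unfolding n by simp
  have "cmod (scalar_enum K n) \<le> \<bar>rat_enum a\<bar> + \<bar>rat_enum b\<bar>"
    using cmod_le[of "Complex (rat_enum a) (rat_enum b)"] False ab by (simp add: scalar_enum_eq)
  also have "\<dots> \<le> real a + real b" by (intro add_mono rat_enum_abs_le)
  also have "\<dots> \<le> real n" using \<open>a + b \<le> n\<close> by simp
  finally show ?thesis .
qed

lemma rat_enum_dense:
  assumes "0 < (\<delta>::real)" shows "\<exists>n. \<bar>rat_enum n - x\<bar> < \<delta>"
proof -
  obtain N where N: "1 / real (Suc N) < \<delta>" using assms nat_approx_posE by blast
  define i where "i = \<lfloor>x * real (Suc N)\<rfloor>"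
  have r: "rat_enum (rat_code i (Suc N)) = real_of_int i / real (Suc N)" by
      (rule rat_enum_code) simp
  have "\<bar>real_of_int i - x * real (Suc N)\<bar> \<le> 1"
    unfolding i_def using of_int_floor_le[of "x * real (Suc N)"] real_of_int_floor_add_one_ge[of "x
        * real (Suc N)"]
    by linarith
  moreover have "rat_enum (rat_code i (Suc N)) - x = (real_of_int i - x * real (Suc N)) / real (Suc
      N)"
    unfolding r by (simp add: diff_divide_distrib del: of_nat_Suc)
  ultimately have "\<bar>rat_enum (rat_code i (Suc N)) - x\<bar> \<le> 1 / real (Suc N)"
    by (simp add: divide_right_mono del: of_nat_Suc)
  then show ?thesis using N by (intro exI[of _ "rat_code i (Suc N)"]) linarith
qed

lemma scalar_enum_dense:
  assumes K: "K = \<real> \<or> K = UNIV" and c: "c \<in> K" and \<delta>: "0 < \<delta>"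
  shows "\<exists>n. cmod (scalar_enum K n - c) < \<delta>"
proof (cases "K = \<real>")
  case True
  then obtain x where x: "c = of_real x" using c by (auto elim: Reals_cases)
  obtain n where "\<bar>rat_enum n - x\<bar> < \<delta>" using rat_enum_dense[OF \<delta>] by blast
  then have "cmod (scalar_enum K n - c) < \<delta>"
    using True by (simp add: scalar_enum_eq x flip: of_real_diff)
  then show ?thesis by blast
next
  case False
  obtain a where a: "\<bar>rat_enum a - Re c\<bar> < \<delta> / 2" using rat_enum_dense[of "\<delta> / 2"] \<delta> by auto
  obtain b where b: "\<bar>rat_enum b - Im c\<bar> < \<delta> / 2" using rat_enum_dense[of "\<delta> / 2"] \<delta> by auto
  have "cmod (scalar_enum K (prod_encode (a, b)) - c) \<le> \<bar>rat_enum a - Re c\<bar> + \<bar>rat_enum b - Im c\<bar>"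
    using cmod_le[of "scalar_enum K (prod_encode (a, b)) - c"] False by (simp add: scalar_enum_eq)
  also have "\<dots> < \<delta>" using a b by argo
  finally show ?thesis by blast
qed

subsection \<open>Vectors\<close>

text \<open>The sum of the lengths is a simple common bound for both; the surplus entries code the
  scalar 0.\<close>

definition vadd :: "complex set \<Rightarrow> nat \<Rightarrow> nat \<Rightarrow> nat" where
  "vadd K n m = list_encode (map
     (\<lambda>i. sadd K (nth_default 0 (list_decode n) i) (nth_default 0 (list_decode m) i))
     [0..<length (list_decode n) + length (list_decode m)])"

definition vscale :: "complex set \<Rightarrow> nat \<Rightarrow> nat \<Rightarrow> nat" where
  "vscale K a n = list_encode (map (smul K a) (list_decode n))"

lemma computable_vadd [computable_intros]:
  assumes f: "computable f" and g: "computable g"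
  shows "computable (\<lambda>x. vadd K (f x) (g x))"
proof -
  have "computable (\<lambda>z. vadd K (fst z) (snd z))"
    unfolding vadd_def by (intro computable_intros)
  then show ?thesis by (rule computable_comp2[OF _ assms])
qed

lemma computable_vscale [computable_intros]:
  assumes f: "computable f" and g: "computable g"
  shows "computable (\<lambda>x. vscale K (f x) (g x))"
proof -
  have "computable (\<lambda>z. vscale K (fst z) (snd z))"
    unfolding vscale_def by (intro computable_intros)
  then show ?thesis by (rule computable_comp2[OF _ assms])
qed

context ip_space
begin

lemma scalar_enum_in [simp, intro]: "scalar_enum K n \<in> K"
  using scalars by (auto simp: scalar_enum_eq)

lemma lincomb_padded:
  assumes e: "range e \<subseteq> carrier V" and L: "length (list_decode n) \<le> L"
  shows "lincomb_enum K V e n = (\<Oplus>i\<in>{..<L}. scalar_enum K (nth_default 0 (list_decode n) i) \<odot> e i)"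
proof -
  have e_in: "e i \<in> carrier V" for i using e by blast
  show ?thesis
    unfolding lincomb_enum_def
  proof (rule M.add.finprod_mono_neutral_cong_left)
    show "{..<length (list_decode n)} \<subseteq> {..<L}" using L by auto
    show "scalar_enum K (nth_default 0 (list_decode n) i) \<odot> e i = \<zero>"
      if "i \<in> {..<L} - {..<length (list_decode n)}" for i
      using that e_in[of i] smult_l_null[of "e i"] by (simp add: nth_default_def scalar_enum_0)
    show "scalar_enum K (list_decode n ! i) \<odot> e i = scalar_enum K (nth_default 0 (list_decode n) i)
        \<odot> e i"
      if "i \<in> {..<length (list_decode n)}" for i
      using that by (simp add: nth_default_def)
  qed (simp_all add: e_in)
qed

lemma lincomb_in [simp]: "range e \<subseteq> carrier V \<Longrightarrow> lincomb_enum K V e n \<in> carrier V"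
  unfolding lincomb_enum_def by (intro M.finsum_closed) auto

lemma lincomb_zero: "lincomb_enum K V e 0 = \<zero>"
  by (simp add: lincomb_enum_def)

lemma lincomb_vadd:
  assumes e: "range e \<subseteq> carrier V"
  shows "lincomb_enum K V e (vadd K n m) = lincomb_enum K V e n \<oplus> lincomb_enum K V e m"
proof -
  let ?L = "length (list_decode n) + length (list_decode m)"
  have e_in: "e i \<in> carrier V" for i using e by blast
  let ?x = "\<lambda>i. scalar_enum K (nth_default 0 (list_decode n) i)"
  let ?y = "\<lambda>i. scalar_enum K (nth_default 0 (list_decode m) i)"
  have "lincomb_enum K V e (vadd K n m) = (\<Oplus>i\<in>{..<?L}. scalar_enum K (list_decode (vadd K n m) ! i)
      \<odot> e i)"
    by (simp add: lincomb_enum_def vadd_def)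
  also have "\<dots> = (\<Oplus>i\<in>{..<?L}. ?x i \<odot> e i \<oplus> ?y i \<odot> e i)"
  proof (rule M.finsum_cong')
    fix i assume "i \<in> {..<?L}"
    then have "scalar_enum K (list_decode (vadd K n m) ! i) = ?x i + ?y i"
      by (simp add: vadd_def scalar_enum_sadd)
    then show "scalar_enum K (list_decode (vadd K n m) ! i) \<odot> e i = ?x i \<odot> e i \<oplus> ?y i \<odot> e i"
      using smult_l_distr[of "?x i" "?y i" "e i"] e_in by simp
  qed (simp_all add: e_in)
  also have "\<dots> = (\<Oplus>i\<in>{..<?L}. ?x i \<odot> e i) \<oplus> (\<Oplus>i\<in>{..<?L}. ?y i \<odot> e i)"
    by (rule M.finsum_addf) (simp_all add: e_in)
  also have "\<dots> = lincomb_enum K V e n \<oplus> lincomb_enum K V e m"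
    using lincomb_padded[OF e, of n ?L] lincomb_padded[OF e, of m ?L] by simp
  finally show ?thesis .
qed

lemma lincomb_vscale:
  assumes e: "range e \<subseteq> carrier V"
  shows "lincomb_enum K V e (vscale K a n) = scalar_enum K a \<odot> lincomb_enum K V e n"
proof -
  have e_in: "e i \<in> carrier V" for i using e by blast
  have "lincomb_enum K V e (vscale K a n) =
      (\<Oplus>i\<in>{..<length (list_decode n)}. scalar_enum K (list_decode (vscale K a n) ! i) \<odot> e i)"
    by (simp add: lincomb_enum_def vscale_def)
  also have "\<dots> = (\<Oplus>i\<in>{..<length (list_decode n)}. scalar_enum K a \<odot> (scalar_enum K (list_decode n !
      i) \<odot> e i))"
  proof (rule M.finsum_cong')
    fix i assume "i \<in> {..<length (list_decode n)}"
    then have "scalar_enum K (list_decode (vscale K a n) ! i)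
        = scalar_enum K a * scalar_enum K (list_decode n ! i)"
      by (simp add: vscale_def scalar_enum_smul)
    then show "scalar_enum K (list_decode (vscale K a n) ! i) \<odot> e i =
        scalar_enum K a \<odot> (scalar_enum K (list_decode n ! i) \<odot> e i)"
      using smult_assoc1[of "scalar_enum K a" "scalar_enum K (list_decode n ! i)" "e i"] e_in
          by simp
  qed (simp_all add: e_in)
  also have "\<dots> = scalar_enum K a \<odot> lincomb_enum K V e n"
    unfolding lincomb_enum_def
    by (rule finsum_smult_ldistr[symmetric]) (simp_all add: e_in)
  finally show ?thesis .
qed

lemma lincomb_dense:
  assumes fund: "fundamental K V e" and x: "x \<in> carrier V" and \<epsilon>: "0 < \<epsilon>"
  shows "\<exists>n. hdist V (lincomb_enum K V e n) x < \<epsilon>"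
proof -
  have e: "range e \<subseteq> carrier V" and clos: "(htopology V) closure_of (hspan K V e) = carrier V"
    using fund by (auto simp: fundamental_def)
  have e_in: "e i \<in> carrier V" for i using e by blast
  have "x \<in> (htopology V) closure_of (hspan K V e)" using x clos by simp
  then have "\<forall>r>0. \<exists>y\<in>hspan K V e. y \<in> metric.mball x r"
    unfolding metric.metric_closure_of by blast
  then obtain y where y: "y \<in> hspan K V e" "y \<in> metric.mball x (\<epsilon> / 2)"
    using half_gt_zero[OF \<epsilon>] by blast
  then obtain n c where c: "y = (\<Oplus>i\<in>{..<n}. c i \<odot> e i)" "range c \<subseteq> K"
    unfolding hspan_def by blast
  then have cK: "c i \<in> K" for i by blast
  define B where "B = (\<Sum>i<n. hnorm V (e i))"
  have B: "0 \<le> B" unfolding B_def using e_in by (intro sum_nonneg) simp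
  \<comment> \<open>The summand 1 guards against \<open>B = 0\<close>, which occurs for
    \<open>n = 0\<close>.\<close>
  define \<delta> where "\<delta> = \<epsilon> / 2 / (B + 1)"
  have \<delta>: "0 < \<delta>" "\<delta> * B < \<epsilon> / 2"
  proof -
    show "0 < \<delta>" unfolding \<delta>_def using \<epsilon> B by simp
    have "B + 1 \<noteq> 0" using B by linarith
    then have "\<delta> * (B + 1) = \<epsilon> / 2"
      using nonzero_eq_divide_eq[of "B + 1" \<delta> "\<epsilon> / 2"] \<delta>_def by blast
    then show "\<delta> * B < \<epsilon> / 2" using \<open>0 < \<delta>\<close> by (simp add: distrib_left)
  qed
  obtain s where s: "\<And>i. cmod (scalar_enum K (s i) - c i) < \<delta>"
    using scalar_enum_dense[OF scalars cK \<delta>(1)] by metis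
  define m where "m = list_encode (map s [0..<n])"
  have lin: "lincomb_enum K V e m = (\<Oplus>i\<in>{..<n}. scalar_enum K (s i) \<odot> e i)"
    unfolding lincomb_enum_def m_def by (simp, intro M.finsum_cong') (auto simp: e_in)
  have y_in: "y \<in> carrier V" unfolding c(1) by (intro M.finsum_closed) (auto simp: e_in cK)
  have m_in: "lincomb_enum K V e m \<in> carrier V" using e by simp
  have diff: "scalar_enum K (s i) \<odot> e i \<ominus> c i \<odot> e i = (scalar_enum K (s i) - c i) \<odot> e i" for i
  proof -
    have "\<ominus> (c i \<odot> e i) = (- c i) \<odot> e i"
      using smult_assoc1[of "-1" "c i" "e i"] e_in cK by (simp add: a_inv_eq_smult)
    then show ?thesis
      using smult_l_distr[of "scalar_enum K (s i)" "- c i" "e i"] e_in cK by (simp add: a_minus_def)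
  qed
  have "hdist V (lincomb_enum K V e m) y = hnorm V (\<Oplus>i\<in>{..<n}. scalar_enum K (s i) \<odot> e i \<ominus> c i \<odot> e
      i)"
    unfolding hdist_eq[OF m_in y_in] unfolding lin c(1)
    by (subst finsum_diff) (auto simp: e_in cK)
  also have "\<dots> \<le> (\<Sum>i<n. hnorm V (scalar_enum K (s i) \<odot> e i \<ominus> c i \<odot> e i))"
    by (rule hnorm_finsum) (simp_all add: e_in cK)
  also have "\<dots> \<le> (\<Sum>i<n. \<delta> * hnorm V (e i))"
    unfolding diff using s e_in cK by (intro sum_mono)
        (simp add: hnorm_smult mult_right_mono less_imp_le)
  also have "\<dots> = \<delta> * B" by (simp add: B_def sum_distrib_left)
  finally have "hdist V (lincomb_enum K V e m) y < \<epsilon> / 2" using \<delta>(2) by (rule le_less_trans)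
  moreover have "hdist V (lincomb_enum K V e m) x \<le> hdist V (lincomb_enum K V e m) y + hdist V y x"
    by (rule metric.triangle[OF m_in y_in x])
  ultimately have "hdist V (lincomb_enum K V e m) x < \<epsilon>"
    using y(2) metric.commute[of x y] unfolding metric.in_mball by argo
  then show ?thesis by blast
qed

subsection \<open>Cauchy names\<close>

lemma hilbert_rep_carrier: "hilbert_rep K V e p x \<Longrightarrow> x \<in> carrier V"
  unfolding hilbert_rep_def cauchy_rep_def by (erule conjE, erule metric.limitin_mspace)

lemma hilbert_rep_dist:
  assumes e: "range e \<subseteq> carrier V" and p: "hilbert_rep K V e p x"
  shows "hdist V (lincomb_enum K V e (p k)) x \<le> (1 / 2) ^ k"
proof -
  let ?a = "\<lambda>k. lincomb_enum K V e (p k)"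
  have x: "x \<in> carrier V" using p by (rule hilbert_rep_carrier)
  have a: "?a k \<in> carrier V" for k using e by simp
  note p' = p[unfolded hilbert_rep_def cauchy_rep_def metric.limitin_metric_dist_null]
  have lim: "(\<lambda>l. hdist V (?a l) x) \<longlonglongrightarrow> 0"
    by (rule p'[THEN conjunct2, THEN conjunct2, THEN conjunct2])
  have cau: "hdist V (?a k) (?a l) < (1 / 2) ^ k" if "k < l" for l
    by (rule p'[THEN conjunct1, rule_format, OF that])
  have step: "hdist V (?a k) x \<le> (1 / 2) ^ k + hdist V (?a l) x" if "k < l" for l
    by (rule order_trans[OF metric.triangle[OF a a x] add_right_mono[OF less_imp_le[OF cau[OF
        that]]]])
  have ev: "\<forall>\<^sub>F l in sequentially. hdist V (?a k) x \<le> (1 / 2) ^ k + hdist V (?a l) x"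
    by (rule eventually_mono[OF eventually_gt_at_top[of k] step])
  have "(\<lambda>l. (1 / 2) ^ k + hdist V (?a l) x) \<longlonglongrightarrow> (1 / 2) ^ k + 0"
    by (intro tendsto_add tendsto_const lim)
  from tendsto_lowerbound[OF this ev trivial_limit_sequentially] show ?thesis by simp
qed

text \<open>Through its constant name, a rational combination can be fed to an associate of an
  operator.\<close>

lemma hilbert_rep_const:
  assumes e: "range e \<subseteq> carrier V"
  shows "hilbert_rep K V e (\<lambda>_. n) (lincomb_enum K V e n)"
  unfolding hilbert_rep_def cauchy_rep_def metric.limitin_metric_dist_null using e by simp

text \<open>The exponent \<open>k + 2\<close> leaves room: two such errors sum to half of the bound
  that a name has to meet strictly.\<close>

lemma hilbert_repI:
  assumes e: "range e \<subseteq> carrier V" and x: "x \<in> carrier V"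
    and near: "\<And>k. hdist V (lincomb_enum K V e (p k)) x \<le> (1 / 2) ^ (k + 2)"
  shows "hilbert_rep K V e p x"
  unfolding hilbert_rep_def cauchy_rep_def metric.limitin_metric_dist_null
proof (intro conjI allI impI)
  let ?a = "\<lambda>k. lincomb_enum K V e (p k)"
  have a: "?a k \<in> carrier V" for k using e by simp
  fix k l :: nat assume "k < l"
  have "hdist V (?a k) (?a l) \<le> hdist V (?a k) x + hdist V (?a l) x"
    using metric.triangle'[OF a x a] by simp
  also have "\<dots> \<le> (1 / 2) ^ (k + 2) + (1 / 2) ^ (l + 2)" by (intro add_mono near)
  also have "\<dots> \<le> (1 / 2) ^ (k + 2) + (1 / 2) ^ (k + 2)"
    using \<open>k < l\<close> by (intro add_left_mono power_decreasing) auto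
  also have "\<dots> < (1 / 2 :: real) ^ k" by simp
  finally show "hdist V (?a k) (?a l) < (1 / 2) ^ k" .
next
  show "x \<in> carrier V" by (rule x)
  show "\<forall>\<^sub>F k in sequentially. lincomb_enum K V e (p k) \<in> carrier V" using e by simp
  have "(\<lambda>k. (1 / 2) ^ (k + 2)) \<longlonglongrightarrow> (0::real)"
    using LIMSEQ_ignore_initial_segment[OF LIMSEQ_power_zero[of "1 / 2 :: real"], of 2] by simp
  note small = this
  show "(\<lambda>k. hdist V (lincomb_enum K V e (p k)) x) \<longlonglongrightarrow> 0"
    by (rule tendsto_sandwich[OF always_eventually always_eventually tendsto_const small]) (use near
        in auto)
qed

end

section \<open>Names of reals, and realizers of computable sequences\<close>

lemma real_rep_dist:
  assumes "real_rep p x"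
  shows "\<bar>rat_enum (p k) - x\<bar> \<le> (1 / 2) ^ k"
proof -
  note p = assms[unfolded real_rep_def cauchy_rep_def limitin_iff_tendsto]
  have lim: "(\<lambda>l. rat_enum (p l)) \<longlonglongrightarrow> x" by (rule p[THEN conjunct2])
  have cau: "dist (rat_enum (p k)) (rat_enum (p l)) < (1 / 2) ^ k" if "k < l" for l
    by (rule p[THEN conjunct1, rule_format, OF that])
  have "(\<lambda>l. dist (rat_enum (p k)) (rat_enum (p l))) \<longlonglongrightarrow> dist (rat_enum (p k)) x"
    by (intro tendsto_dist tendsto_const lim)
  moreover have "\<forall>\<^sub>F l in sequentially. dist (rat_enum (p k)) (rat_enum (p l)) \<le> (1 / 2) ^ k"
    by (rule eventually_mono[OF eventually_gt_at_top[of k] less_imp_le[OF cau]])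
  ultimately have "dist (rat_enum (p k)) x \<le> (1 / 2) ^ k"
    by (rule tendsto_upperbound[OF _ _ trivial_limit_sequentially])
  then show ?thesis by (simp add: dist_real_def)
qed

text \<open>A number has many names. Feeding the machine with \<open>first_entry n\<close> selects
  one of them and makes the resulting names a single computable function of n and the
  position.\<close>

lemma computable_seq_realizer:
  assumes "computable_seq \<delta> x"
  shows "\<exists>g. computable (\<lambda>z. g (fst z) (snd z)) \<and> (\<forall>n. \<delta> n (g n) (x n))"
proof -
  obtain F where F: "type2_computable F" "\<And>p n. nat_rep p n \<Longrightarrow> \<exists>q. F p = Some q \<and> \<delta> n q (x n)"
    using assms unfolding computable_seq_def by blast
  obtain M where M: "wf_machine M" "\<And>p q. F p = Some q \<longleftrightarrow> transforms M p q"
    using F(1) unfolding type2_computable_def by blast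
  have "\<exists>q. transforms M (first_entry n) q \<and> \<delta> n q (x n)" for n
    using F(2)[of "first_entry n" n] M(2) by (simp add: nat_rep_def first_entry_def)
  then obtain g where g: "\<And>n. transforms M (first_entry n) (g n)" "\<And>n. \<delta> n (g n) (x n)" by metis
  then show ?thesis using computable_transforms[OF M(1), of g] by blast
qed

lemma computable_double_seq_realizer:
  assumes "computable_double_seq \<delta> x"
  shows "\<exists>g. computable (\<lambda>z. g (fst z) (snd z)) \<and> (\<forall>i k. \<delta> i k (g (prod_encode (i, k))) (x i k))"
proof -
  obtain g where g: "computable (\<lambda>z. g (fst z) (snd z))"
    "\<forall>m. (case prod_decode m of (i, k) \<Rightarrow> \<delta> i k) (g m) (case prod_decode m of (i, k) \<Rightarrow> x i k)"
    using computable_seq_realizer[OF assms[unfolded computable_double_seq_def]] by blast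
  have "\<delta> i k (g (prod_encode (i, k))) (x i k)" for i k
    using g(2)[rule_format, of "prod_encode (i, k)"] by simp
  then show ?thesis using g(1) by blast
qed

section \<open>The synthesis operator is computable\<close>

text \<open>The bound is expressed by the approximation x and not by X, so an algorithm can evaluate
  it.\<close>

lemma square_approx:
  assumes "\<bar>x - X\<bar> \<le> \<epsilon>" and "\<epsilon> \<le> (1::real)"
  shows "\<bar>X\<^sup>2 - x\<^sup>2\<bar> \<le> \<epsilon> * (x\<^sup>2 + 2)"
proof -
  have "\<bar>X + x\<bar> \<le> 2 * \<bar>x\<bar> + 1" using assms by argo
  also have "\<dots> \<le> x\<^sup>2 + 2"
    using zero_le_power2[of "\<bar>x\<bar> - 1"] by (simp add: power2_diff)
  finally have "\<bar>X - x\<bar> * \<bar>X + x\<bar> \<le> \<epsilon> * (x\<^sup>2 + 2)"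
    using assms by (intro mult_mono) auto
  moreover have "X\<^sup>2 - x\<^sup>2 = (X - x) * (X + x)" by (simp add: power2_eq_square algebra_simps)
  ultimately show ?thesis by (simp add: abs_mult)
qed

text \<open>Together with \<open>scalar_enum_norm_le\<close>, the code of a combination bounds the
  sum of the moduli of its coefficients.\<close>

lemma sum_list_le_list_encode: "sum_list xs \<le> list_encode xs"
proof (induction xs)
  case (Cons x xs)
  have "k \<le> triangle k" for k by (induction k) auto
  from this[of "x + list_encode xs"] have "x + list_encode xs \<le> prod_encode (x, list_encode xs)"
    by (simp add: prod_encode_def)
  then show ?case using Cons by simp
qed simp

definition reps :: "nat \<Rightarrow> nat" where
  "reps j = rat_code 1 (2 ^ j)"

lemma rat_enum_reps: "rat_enum (reps j) = (1 / 2) ^ j"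
  unfolding reps_def by (subst rat_enum_code) (simp_all add: power_one_over)

lemma computable_reps [computable_intros]: "computable f \<Longrightarrow> computable (\<lambda>x. reps (f x))"
  unfolding reps_def by (intro computable_intros)

lemma computable_assoc_query:
  assumes "computable a" and "computable b" and "computable c"
  shows "computable (\<lambda>x. assoc_query (\<lambda>_. a x) (b x) (c x))"
  unfolding assoc_query_def by (intro computable_intros assms computable_comp[OF assms(1)])

lemma two_power_half: "(2::real) ^ m * (1 / 2) ^ (n + m) = (1 / 2) ^ n"
  by (simp add: power_add power_one_over)

text \<open>Computable functions on numbers in place of the computability hypotheses:
  \<open>gH\<close> and \<open>gW\<close> approximate distances in H and in the spaces of the
  family, \<open>ge\<close> names the basis vectors, \<open>gL\<close> holds associates of the
  operators, and \<open>gN\<close> approximates the norms of the adjoint images.\<close>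

locale realized_frame = frame K W H \<Lambda>
  for K and W :: "nat \<Rightarrow> 'b hspace" and H :: "'a hspace" and \<Lambda> +
  fixes e\<^sub>H :: "nat \<Rightarrow> 'a" and h e :: "nat \<Rightarrow> nat \<Rightarrow> 'b" and gH gW ge gL gN :: "nat \<Rightarrow> nat \<Rightarrow> nat"
  assumes fund_H: "fundamental K H e\<^sub>H"
    and fund_W: "fundamental K (W i) (h i)"
    and basis: "orthonormal_basis K (W i) (e i)"
    and gH_computable: "computable (\<lambda>z. gH (fst z) (snd z))"
    and gH: "real_rep (gH (prod_encode (n, m))) (hdist H (lincomb_enum K H e\<^sub>H n) (lincomb_enum K H
        e\<^sub>H m))"
    and gW_computable: "computable (\<lambda>z. gW (fst z) (snd z))"
    and gW: "real_rep (gW (prod_encode (i, prod_encode (n, m))))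
               (hdist (W i) (lincomb_enum K (W i) (h i) n) (lincomb_enum K (W i) (h i) m))"
    and ge_computable: "computable (\<lambda>z. ge (fst z) (snd z))"
    and ge: "hilbert_rep K (W i) (h i) (ge (prod_encode (i, k))) (e i k)"
    and gL_computable: "computable (\<lambda>z. gL (fst z) (snd z))"
    and gL: "fun_rep (hilbert_rep K H e\<^sub>H) (hilbert_rep K (W i) (h i)) (gL i) (\<Lambda> i)"
    and gN_computable: "computable (\<lambda>z. gN (fst z) (snd z))"
    and gN: "real_rep (gN (prod_encode (i, k))) (hnorm H (adj i (e i k)))"
begin

abbreviation \<alpha> :: "nat \<Rightarrow> 'a" where
  "\<alpha> \<equiv> lincomb_enum K H e\<^sub>H"

abbreviation \<beta> :: "nat \<Rightarrow> nat \<Rightarrow> 'b" where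
  "\<beta> i \<equiv> lincomb_enum K (W i) (h i)"

lemma range_e\<^sub>H: "range e\<^sub>H \<subseteq> carrier H"
  using fund_H by (simp add: fundamental_def)

lemma range_h: "range (h i) \<subseteq> carrier (W i)"
  using fund_W[of i] by (simp add: fundamental_def)

lemma e_in [simp]: "e i k \<in> carrier (W i)"
  using basis[of i] by (auto simp: orthonormal_basis_def fundamental_def)

lemma hnorm_e: "(hnorm (W i) (e i k))\<^sup>2 = 1"
  using basis[of i] W.hnorm_sq[OF e_in] by (simp add: orthonormal_basis_def)

lemma \<alpha>_in [simp]: "\<alpha> n \<in> carrier H"
  by (rule H.lincomb_in[OF range_e\<^sub>H])

lemma \<beta>_in [simp]: "\<beta> i n \<in> carrier (W i)"
  by (rule W.lincomb_in[OF range_h])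

text \<open>Evaluating the associate of \<open>\<Lambda> i\<close> at the constant name of \<open>\<alpha> n\<close>.\<close>

definition image_code :: "nat \<Rightarrow> nat \<Rightarrow> nat \<Rightarrow> nat" where
  "image_code i n j = gL i (assoc_query (\<lambda>_. n) j (LEAST k. 0
      < gL i (assoc_query (\<lambda>_. n) j k))) - 1"

lemma assoc_defined: "\<exists>k. 0 < gL i (assoc_query (\<lambda>_. n) j k)"
  and image_code: "hilbert_rep K (W i) (h i) (image_code i n) (\<Lambda> i (\<alpha> n))"
proof -
  obtain r where r: "assoc_fun (gL i) (\<lambda>_. n) = Some r" "hilbert_rep K (W i) (h i) r (\<Lambda> i (\<alpha> n))"
    using gL[of i] H.hilbert_rep_const[OF range_e\<^sub>H, of n] unfolding fun_rep_def by blast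
  have all: "\<forall>j. \<exists>k. 0 < gL i (assoc_query (\<lambda>_. n) j k)"
    using r(1) unfolding assoc_fun_def by (metis option.distinct(1))
  then show "\<exists>k. 0 < gL i (assoc_query (\<lambda>_. n) j k)" by blast
  have "r = image_code i n"
    using r(1) all unfolding assoc_fun_def by (simp add: image_code_def fun_eq_iff)
  then show "hilbert_rep K (W i) (h i) (image_code i n) (\<Lambda> i (\<alpha> n))" using r(2) by simp
qed

text \<open>The search for a prefix length succeeds for all arguments, because every
  \<open>\<alpha> n\<close> has its constant name and each associate is defined there.\<close>

lemma computable_image_code:
  assumes "computable f" and "computable g" and "computable k"
  shows "computable (\<lambda>x. image_code (f x) (g x) (k x))"
proof -
  let ?q = "\<lambda>z n. assoc_query (\<lambda>_. fst (snd z)) (snd (snd z)) n"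
  let ?n = "\<lambda>z. LEAST n. 0 < gL (fst z) (?q z n)"
  have "computable (\<lambda>z. 0 < gL (fst (fst z)) (?q (fst z) (snd z)))"
    by (intro computable_intros computable_comp2[OF gL_computable] computable_assoc_query)
  then have "computable ?n"
    by (rule computable_Least) (intro surj_enc_prod surj_enc_nat assoc_defined)+
  then have "computable (\<lambda>z. gL (fst z) (?q z (?n z)) - 1)"
    by (intro computable_diff_nat computable_const computable_comp2[OF gL_computable]
        computable_assoc_query
        computable_fst computable_snd computable_id)
  from computable_comp3[OF this[folded image_code_def] assms] show ?thesis .
qed

subsection \<open>Approximating the vectors \<open>\<Lambda>\<^sub>i\<^sup>* e\<^sub>i\<^sub>k\<close>\<close>

abbreviation idx :: "nat \<Rightarrow> nat" where
  "idx t \<equiv> fst (prod_decode t)"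

definition vec :: "nat \<Rightarrow> 'a" where
  "vec t = adj (idx t) (e (idx t) (snd (prod_decode t)))"

text \<open>The four functions from here on approximate, up to \<open>(1 / 2) ^ j\<close>, the
  quantities in \<open>dist_vec\<close>: the norms of \<open>\<alpha> n\<close>, of
  \<open>vec t\<close> and of the image of \<open>\<alpha> n\<close>, and the distance of this image
  to the basis vector. Code 0 is the zero vector, so norms are distances to it. Two or three errors
  combine in \<open>qu\<close> and \<open>qd\<close>; the index \<open>j + 2\<close> makes each of
  them at most a quarter.\<close>

definition qa :: "nat \<Rightarrow> nat \<Rightarrow> nat" where
  "qa n j = gH (prod_encode (n, 0)) j"

definition qv :: "nat \<Rightarrow> nat \<Rightarrow> nat" where
  "qv t j = gN t j"

definition qu :: "nat \<Rightarrow> nat \<Rightarrow> nat \<Rightarrow> nat" where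
  "qu t n j = gW (prod_encode (idx t, prod_encode (image_code (idx t) n (j + 2), 0))) (j + 2)"

definition qd :: "nat \<Rightarrow> nat \<Rightarrow> nat \<Rightarrow> nat" where
  "qd t n j = gW (prod_encode (idx t, prod_encode (image_code (idx t) n (j + 2), ge t (j + 2)))) (j
      + 2)"

lemma vec_in [simp]: "vec t \<in> carrier H"
  by (simp add: vec_def)

lemma qa: "\<bar>rat_enum (qa n j) - hnorm H (\<alpha> n)\<bar> \<le> (1 / 2) ^ j"
  using real_rep_dist[OF gH[of n 0], of j] by (simp add: qa_def H.lincomb_zero H.hdist_zero)

lemma qv: "\<bar>rat_enum (qv t j) - hnorm H (vec t)\<bar> \<le> (1 / 2) ^ j"
  using real_rep_dist[OF gN[of "idx t" "snd (prod_decode t)"], of j] by (simp add: qv_def vec_def)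

lemma quarter: "(1 / 2 :: real) ^ (j + 2) = (1 / 2) ^ j / 4"
  by (simp add: power_add)

lemma qu: "\<bar>rat_enum (qu t n j) - hnorm (W (idx t)) (\<Lambda> (idx t) (\<alpha> n))\<bar> \<le> (1 / 2) ^ j"
proof -
  let ?i = "idx t"
  let ?b = "\<beta> ?i (image_code ?i n (j + 2))"
  let ?x = "\<Lambda> ?i (\<alpha> n)"
  define \<epsilon> :: real where "\<epsilon> = (1 / 2) ^ j"
  have \<epsilon>: "0 < \<epsilon>" by (simp add: \<epsilon>_def)
  have 1: "\<bar>rat_enum (qu t n j) - hnorm (W ?i) ?b\<bar> \<le> \<epsilon> / 4"
    using real_rep_dist[OF gW[of ?i "image_code ?i n (j + 2)" 0], of "j + 2"]
    unfolding quarter \<epsilon>_def by (simp add: qu_def W.lincomb_zero W.hdist_zero)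
  have 2: "hdist (W ?i) ?b ?x \<le> \<epsilon> / 4"
    using W.hilbert_rep_dist[OF range_h image_code, of ?i n "j + 2"] unfolding quarter \<epsilon>_def .
  have "\<bar>hnorm (W ?i) ?b - hnorm (W ?i) ?x\<bar> \<le> hdist (W ?i) ?b ?x"
    using W.metric.mdist_reverse_triangle[where i = ?i and x = ?b and y = "\<zero>\<^bsub>W ?i\<^esub>" and z = ?x]
    by (simp add: W.hdist_zero W.metric.commute[where i = ?i and x = "\<zero>\<^bsub>W ?i\<^esub>" and y = ?x])
  then show ?thesis using 1 2 \<epsilon> unfolding \<epsilon>_def[symmetric] by argo
qed

lemma qd: "\<bar>rat_enum (qd t n j) - hdist (W (idx t)) (\<Lambda> (idx t) (\<alpha> n)) (e (idx t) (snd (prod_decode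
    t)))\<bar> \<le> (1 / 2) ^ j"
proof -
  let ?i = "idx t"
  let ?b = "\<beta> ?i (image_code ?i n (j + 2))"
  let ?c = "\<beta> ?i (ge t (j + 2))"
  let ?x = "\<Lambda> ?i (\<alpha> n)"
  let ?e = "e ?i (snd (prod_decode t))"
  define \<epsilon> :: real where "\<epsilon> = (1 / 2) ^ j"
  have \<epsilon>: "0 < \<epsilon>" by (simp add: \<epsilon>_def)
  have 1: "\<bar>rat_enum (qd t n j) - hdist (W ?i) ?b ?c\<bar> \<le> \<epsilon> / 4"
    using real_rep_dist[OF gW[of ?i "image_code ?i n (j + 2)" "ge t (j + 2)"], of "j + 2"]
    unfolding quarter \<epsilon>_def by (simp add: qd_def)
  have 2: "hdist (W ?i) ?b ?x \<le> \<epsilon> / 4"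
    using W.hilbert_rep_dist[OF range_h image_code, of ?i n "j + 2"] unfolding quarter \<epsilon>_def .
  have 3: "hdist (W ?i) ?c ?e \<le> \<epsilon> / 4"
    using W.hilbert_rep_dist[OF range_h ge[of ?i "snd (prod_decode t)"], of "j + 2"]
    unfolding quarter \<epsilon>_def by simp
  have in_W: "?b \<in> carrier (W ?i)" "?c \<in> carrier (W ?i)" "?x \<in> carrier (W ?i)" "?e \<in> carrier (W ?i)"
      by simp_all
  have 4: "hdist (W ?i) ?b ?c \<le> hdist (W ?i) ?b ?x + hdist (W ?i) ?x ?c"
    by (rule W.metric.triangle) (fact in_W)+
  have 5: "hdist (W ?i) ?x ?c \<le> hdist (W ?i) ?x ?e + hdist (W ?i) ?c ?e"
    by (rule W.metric.triangle') (fact in_W)+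
  have 6: "hdist (W ?i) ?x ?e \<le> hdist (W ?i) ?b ?x + hdist (W ?i) ?b ?e"
    by (rule W.metric.triangle'') (fact in_W)+
  have 7: "hdist (W ?i) ?b ?e \<le> hdist (W ?i) ?b ?c + hdist (W ?i) ?c ?e"
    by (rule W.metric.triangle) (fact in_W)+
  show ?thesis using 1 2 3 4 5 6 7 \<epsilon> unfolding \<epsilon>_def[symmetric] by argo
qed

text \<open>
  The square of the distance of \<open>\<alpha> n\<close> and \<open>\<Lambda>\<^sub>i\<^sup>* e\<^sub>i\<^sub>k\<close>, by polarization in \<open>H\<^sub>i\<close>. The vector
  \<open>\<Lambda>\<^sub>i\<^sup>* e\<^sub>i\<^sub>k\<close> occurs only through its norm.
\<close>

lemma dist_vec:
  "(hdist H (\<alpha> n) (vec t))\<^sup>2 = (hnorm H (\<alpha> n))\<^sup>2 + (hnorm H (vec t))\<^sup>2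
     + (hdist (W (idx t)) (\<Lambda> (idx t) (\<alpha> n)) (e (idx t) (snd (prod_decode t))))\<^sup>2
     - (hnorm (W (idx t)) (\<Lambda> (idx t) (\<alpha> n)))\<^sup>2 - 1"
  using H.hdist_sq[OF \<alpha>_in[of n] vec_in[of t]]
    W.hdist_sq[of "\<Lambda> (idx t) (\<alpha> n)" "idx t" "e (idx t) (snd (prod_decode t))"]
    ip_adj[of "e (idx t) (snd (prod_decode t))" "idx t" "\<alpha> n"] hnorm_e[of "idx t" "snd (prod_decode
        t)"]
  by (simp add: vec_def)

text \<open>Tests whether the square in \<open>dist_vec\<close> is below the square of
  \<open>(1 / 2) ^ s\<close>, with the total error of the four approximate squares added on the
  left. By \<open>square_approx\<close> each contributes a summand 2, whence the 8. The negative
  terms stand on the right.\<close>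

definition accept :: "nat \<Rightarrow> nat \<Rightarrow> nat \<Rightarrow> nat \<Rightarrow> bool" where
  "accept t s n j \<longleftrightarrow>
     rless (radd (radd (radd (rmul (qa n j) (qa n j)) (rmul (qd t n j) (qd t n j))) (rmul (qv t j)
         (qv t j)))
             (rmul (reps j) (radd (radd (radd (radd (rmul (qa n j) (qa n j)) (rmul (qd t n j)
                 (qd t n j)))
                (rmul (qv t j) (qv t j))) (rmul (qu t n j) (qu t n j))) (rat_code 8 1))))
           (radd (rmul (qu t n j) (qu t n j)) (radd (rat_code 1 1) (reps (2 * s))))"

lemma accept_iff:
  "accept t s n j \<longleftrightarrow>
     (rat_enum (qa n j))\<^sup>2 + (rat_enum (qd t n j))\<^sup>2 + (rat_enum (qv t j))\<^sup>2 +
       (1 / 2) ^ j * ((rat_enum (qa n j))\<^sup>2 + (rat_enum (qd t n j))\<^sup>2 + (rat_enum (qv t j))\<^sup>2 +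
           (rat_enum (qu t n j))\<^sup>2 + 8)
     < (rat_enum (qu t n j))\<^sup>2 + (1 + ((1 / 2) ^ s)\<^sup>2)"
proof -
  have "rat_enum (rat_code 8 1) = 8" "rat_enum (rat_code 1 1) = 1"
    by (subst rat_enum_code; simp)+
  then show ?thesis
    unfolding accept_def rless_iff rat_enum_radd rat_enum_rmul rat_enum_reps
    by (simp only: power2_eq_square mult_2 power_add)
qed

lemma accept_sound:
  assumes "accept t s n j"
  shows "hdist H (\<alpha> n) (vec t) \<le> (1 / 2) ^ s"
proof -
  define \<epsilon> :: real where "\<epsilon> = (1 / 2) ^ j"
  define a where "a = rat_enum (qa n j)"
  define d where "d = rat_enum (qd t n j)"
  define u where "u = rat_enum (qu t n j)"
  define v where "v = rat_enum (qv t j)"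
  define A where "A = hnorm H (\<alpha> n)"
  define D where "D = hdist (W (idx t)) (\<Lambda> (idx t) (\<alpha> n)) (e (idx t) (snd (prod_decode t)))"
  define U where "U = hnorm (W (idx t)) (\<Lambda> (idx t) (\<alpha> n))"
  define N where "N = hnorm H (vec t)"
  have \<epsilon>: "\<epsilon> \<le> 1" by (simp add: \<epsilon>_def power_le_one)
  have 1: "\<bar>A\<^sup>2 - a\<^sup>2\<bar> \<le> \<epsilon> * (a\<^sup>2 + 2)"
    unfolding A_def a_def by (rule square_approx[OF qa[of n j, folded \<epsilon>_def] \<epsilon>])
  have 2: "\<bar>D\<^sup>2 - d\<^sup>2\<bar> \<le> \<epsilon> * (d\<^sup>2 + 2)"
    unfolding D_def d_def by (rule square_approx[OF qd[of t n j, folded \<epsilon>_def] \<epsilon>])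
  have 3: "\<bar>U\<^sup>2 - u\<^sup>2\<bar> \<le> \<epsilon> * (u\<^sup>2 + 2)"
    unfolding U_def u_def by (rule square_approx[OF qu[of t n j, folded \<epsilon>_def] \<epsilon>])
  have 4: "\<bar>N\<^sup>2 - v\<^sup>2\<bar> \<le> \<epsilon> * (v\<^sup>2 + 2)"
    unfolding N_def v_def by (rule square_approx[OF qv[of t j, folded \<epsilon>_def] \<epsilon>])
  have 5: "a\<^sup>2 + d\<^sup>2 + v\<^sup>2 + \<epsilon> * (a\<^sup>2 + d\<^sup>2 + v\<^sup>2 + u\<^sup>2 + 8) < u\<^sup>2 + (1 + ((1 / 2) ^ s)\<^sup>2)"
    using assms unfolding accept_iff a_def d_def u_def v_def \<epsilon>_def .
  have 6: "(hdist H (\<alpha> n) (vec t))\<^sup>2 = A\<^sup>2 + N\<^sup>2 + D\<^sup>2 - U\<^sup>2 - 1"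
    unfolding A_def D_def U_def N_def by (rule dist_vec)
  have 7: "\<epsilon> * (a\<^sup>2 + d\<^sup>2 + v\<^sup>2 + u\<^sup>2 + 8) =
      \<epsilon> * (a\<^sup>2 + 2) + \<epsilon> * (d\<^sup>2 + 2) + \<epsilon> * (u\<^sup>2 + 2) + \<epsilon> * (v\<^sup>2 + 2)"
    by (simp add: algebra_simps)
  \<comment> \<open>With variables for the squares and products, what remains is purely
    linear.\<close>
  have "X < \<delta>" if "A2 - a2 \<le> pa" "D2 - d2 \<le> pd" "- (U2 - u2) \<le> pu" "N2 - v2 \<le> pv"
    "a2 + d2 + v2 + p < u2 + (1 + \<delta>)" "X = A2 + N2 + D2 - U2 - 1" "p = pa + pd + pu + pv"
    for X \<delta> A2 D2 U2 N2 a2 d2 u2 v2 pa pd pu pv p :: real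
    using that by linarith
  from this[OF abs_le_D1[OF 1] abs_le_D1[OF 2] abs_le_D2[OF 3] abs_le_D1[OF 4] 5 6 7] have "(hdist H
      (\<alpha> n) (vec t))\<^sup>2 < ((1 / 2) ^ s)\<^sup>2" .
  then show ?thesis by (rule power2_le_imp_le[OF less_imp_le]) simp
qed

lemma approx_tendsto:
  assumes "\<And>j. \<bar>f j - x\<bar> \<le> (1 / 2 :: real) ^ j"
  shows "f \<longlonglongrightarrow> x"
proof -
  have "(\<lambda>j. f j - x) \<longlonglongrightarrow> 0"
    by (rule tendsto_rabs_zero_cancel,
        rule tendsto_sandwich[OF always_eventually always_eventually tendsto_const
            LIMSEQ_power_zero[of "1 / 2 :: real"]])
      (use assms in auto)
  then show ?thesis by (rule LIM_zero_cancel)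
qed

text \<open>The error term of the test vanishes as j grows, so a strict inequality between the exact
  quantities is detected at some accuracy.\<close>

lemma accept_complete:
  assumes "hdist H (\<alpha> n) (vec t) < (1 / 2) ^ s"
  shows "\<exists>j. accept t s n j"
proof -
  define A where "A = hnorm H (\<alpha> n)"
  define D where "D = hdist (W (idx t)) (\<Lambda> (idx t) (\<alpha> n)) (e (idx t) (snd (prod_decode t)))"
  define U where "U = hnorm (W (idx t)) (\<Lambda> (idx t) (\<alpha> n))"
  define N where "N = hnorm H (vec t)"
  let ?l = "\<lambda>j. (rat_enum (qa n j))\<^sup>2 + (rat_enum (qd t n j))\<^sup>2 + (rat_enum (qv t j))\<^sup>2 +
       (1 / 2) ^ j * ((rat_enum (qa n j))\<^sup>2 + (rat_enum (qd t n j))\<^sup>2 + (rat_enum (qv t j))\<^sup>2 +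
           (rat_enum (qu t n j))\<^sup>2 + 8)
       - (rat_enum (qu t n j))\<^sup>2"
  have "?l \<longlonglongrightarrow> A\<^sup>2 + D\<^sup>2 + N\<^sup>2 + 0 * (A\<^sup>2 + D\<^sup>2 + N\<^sup>2 + U\<^sup>2 + 8) - U\<^sup>2"
    unfolding A_def D_def U_def N_def
    by (intro tendsto_diff tendsto_add tendsto_mult tendsto_power tendsto_const LIMSEQ_power_zero
        approx_tendsto qa qd qu qv) simp
  moreover have "A\<^sup>2 + D\<^sup>2 + N\<^sup>2 + 0 * (A\<^sup>2 + D\<^sup>2 + N\<^sup>2 + U\<^sup>2 + 8) - U\<^sup>2 < 1 + ((1 / 2) ^ s)\<^sup>2"
  proof -
    have "(hdist H (\<alpha> n) (vec t))\<^sup>2 < ((1 / 2) ^ s)\<^sup>2"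
      using assms by (intro power_strict_mono) auto
    moreover have "(hdist H (\<alpha> n) (vec t))\<^sup>2 = A\<^sup>2 + N\<^sup>2 + D\<^sup>2 - U\<^sup>2 - 1"
      unfolding A_def D_def U_def N_def by (rule dist_vec)
    ultimately show ?thesis by argo
  qed
  ultimately have "\<forall>\<^sub>F j in sequentially. ?l j < 1 + ((1 / 2) ^ s)\<^sup>2" by (rule order_tendstoD(2))
  then obtain j where "?l j < 1 + ((1 / 2) ^ s)\<^sup>2"
    using eventually_happens'[OF sequentially_bot] by blast
  then have "accept t s n j" unfolding accept_iff by argo
  then show ?thesis by blast
qed

lemma computable_accept:
  "computable (\<lambda>z. accept (fst (fst z)) (snd (fst z)) (fst (prod_decode (snd z))) (snd (prod_decode
      (snd z))))"
  unfolding accept_def qa_def qv_def qu_def qd_def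
  by (intro computable_intros computable_comp2[OF gH_computable] computable_comp2[OF gW_computable]
      computable_comp2[OF gN_computable] computable_comp2[OF ge_computable] computable_image_code)

text \<open>One search over pairs dovetails the candidate vector with the accuracy of the test: for
  a candidate that is too far away no accuracy leads to acceptance.\<close>

definition vcode :: "nat \<Rightarrow> nat \<Rightarrow> nat" where
  "vcode t s = fst (prod_decode (LEAST m. accept t s (fst (prod_decode m)) (snd (prod_decode m))))"

lemma accept_exists: "\<exists>m. accept t s (fst (prod_decode m)) (snd (prod_decode m))"
proof -
  obtain n where "hdist H (\<alpha> n) (vec t) < (1 / 2) ^ s"
    using H.lincomb_dense[OF fund_H vec_in, of "(1 / 2) ^ s" t] by auto
  then obtain j where "accept t s n j" using accept_complete by blast
  then show ?thesis by (intro exI[of _ "prod_encode (n, j)"]) simp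
qed

lemma vcode: "hdist H (\<alpha> (vcode t s)) (vec t) \<le> (1 / 2) ^ s"
  unfolding vcode_def by (rule accept_sound, rule LeastI_ex, rule accept_exists)

lemma computable_vcode:
  assumes "computable f" and "computable g"
  shows "computable (\<lambda>x. vcode (f x) (g x))"
proof -
  have "computable (\<lambda>z. LEAST m. accept (fst z) (snd z) (fst (prod_decode m)) (snd (prod_decode
      m)))"
    by (rule computable_Least[OF computable_accept])
        (intro surj_enc_prod surj_enc_nat accept_exists)+
  then have "computable (\<lambda>z. vcode (fst z) (snd z))"
    unfolding vcode_def by (intro computable_fst computable_prod_decode)
  then show ?thesis by (rule computable_comp2[OF _ assms])
qed

subsection \<open>The algorithm\<close>

text \<open>The entry \<open>snd z\<close> also serves as additional accuracy, since it bounds the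
  sum of the moduli of its coefficients. The start value 0 codes the zero vector.\<close>

definition result :: "nat \<times> nat \<Rightarrow> nat" where
  "result z = fold (\<lambda>t acc. vadd K acc (vscale K (nth_default 0 (list_decode (snd z)) t) (vcode t
      (fst z + snd z + 3))))
     [0..<length (list_decode (snd z))] 0"

lemma computable_result: "computable result"
proof -
  have "computable (\<lambda>z. fold (\<lambda>t acc. vadd K acc (vscale K (nth_default 0 (list_decode (snd z)) t)
      (vcode t (fst z + snd z + 3))))
     [0..<length (list_decode (snd z))] 0)"
    by (intro computable_intros computable_vcode)
  then show ?thesis unfolding result_def[symmetric] .
qed

abbreviation coef :: "nat \<Rightarrow> nat \<Rightarrow> complex" where
  "coef m t \<equiv> scalar_enum K (list_decode m ! t)"

lemma lincomb_result:
  "\<alpha> (result (n, m)) = (\<Oplus>\<^bsub>H\<^esub>t\<in>{..<length (list_decode m)}. coef m t \<odot>\<^bsub>H\<^esub> \<alpha> (vcode t (n + m + 3)))"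
proof -
  let ?xs = "list_decode m"
  let ?f = "\<lambda>t acc. vadd K acc (vscale K (nth_default 0 ?xs t) (vcode t (n + m + 3)))"
  have "\<alpha> (fold ?f [0..<L] 0) = (\<Oplus>\<^bsub>H\<^esub>t\<in>{..<L}. coef m t \<odot>\<^bsub>H\<^esub> \<alpha> (vcode t (n + m + 3)))"
      if "L \<le> length ?xs" for L
    using that
  proof (induction L)
    case 0
    then show ?case by (simp add: H.lincomb_zero)
  next
    case (Suc L)
    have "\<alpha> (fold ?f [0..<Suc L] 0) = \<alpha> (fold ?f [0..<L] 0) \<oplus>\<^bsub>H\<^esub> coef m L \<odot>\<^bsub>H\<^esub> \<alpha> (vcode L (n + m +
        3))"
      using Suc.prems by (simp add: H.lincomb_vadd[OF range_e\<^sub>H] H.lincomb_vscale[OF range_e\<^sub>H]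
          nth_default_def)
    then show ?case using Suc by (simp add: lessThan_Suc H.M.a_comm H.M.finsum_closed)
  qed
  from this[of "length ?xs"] show ?thesis by (simp add: result_def)
qed

lemma l2_fundamental_in: "range (l2_fundamental W e) \<subseteq> carrier L2"
proof -
  have "l2_fundamental W e t \<in> carrier L2" for t
    unfolding l2_fundamental_def case_prod_beta by (rule l2_single(1)[OF e_in])
  then show ?thesis by blast
qed

text \<open>The image under T of the combination with code \<open>m\<close>, which
  \<open>result\<close> approximates.\<close>

definition exact :: "nat \<Rightarrow> 'a" where
  "exact m = (\<Oplus>\<^bsub>H\<^esub>t\<in>{..<length (list_decode m)}. coef m t \<odot>\<^bsub>H\<^esub> vec t)"

lemma exact_in: "exact m \<in> carrier H"
  unfolding exact_def by (intro H.M.finsum_closed) auto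

text \<open>The inner product with a vector \<open>E\<^sub>i\<^sub>k\<close> picks the component i,
  and moving the operator to the other side there gives the inner product with \<open>vec t\<close>.
  This identifies \<open>exact m\<close> as an image under T.\<close>

lemma ip_exact:
  assumes x: "x \<in> carrier H"
  shows "ip H x (exact m) = ip L2 (analysis x) (lincomb_enum K L2 (l2_fundamental W e) m)"
proof -
  have E: "l2_fundamental W e t \<in> carrier L2" for t using l2_fundamental_in by blast
  have Ex: "ip L2 (analysis x) (l2_fundamental W e t) = ip H x (vec t)" for t
    using l2_single(2)[OF e_in analysis_in[OF x], of "idx t" "snd (prod_decode t)"] ip_adj[OF e_in
        x]
    by (simp add: l2_fundamental_def case_prod_beta vec_def analysis_def)
  have "ip H x (exact m) = (\<Sum>t<length (list_decode m). cnj (coef m t) * ip H x (vec t))"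
    unfolding exact_def using x by (subst H.ip_finsum_right) (auto simp: H.ip_smult_right)
  also have "\<dots> = (\<Sum>t<length (list_decode m). ip L2 (analysis x) (coef m t \<odot>\<^bsub>L2\<^esub> l2_fundamental W e
      t))"
    using L2.ip_smult_right[OF L2.scalar_enum_in E analysis_in[OF x]] Ex by simp
  also have "\<dots> = ip L2 (analysis x) (lincomb_enum K L2 (l2_fundamental W e) m)"
    unfolding lincomb_enum_def
    by (rule L2.ip_finsum_right[symmetric])
      (use L2.smult_in[OF L2.scalar_enum_in E] analysis_in[OF x] in blast)+
  finally show ?thesis .
qed

text \<open>Each vector is off by at most \<open>(1 / 2) ^ (n + m + 3)\<close>, weighted with the
  modulus of its coefficient. The moduli sum to at most m, hence to at most \<open>2 ^ m\<close>,
  which uses up the m additional bits.\<close>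

lemma result_exact: "hdist H (\<alpha> (result (n, m))) (exact m) \<le> (1 / 2) ^ (n + 3)"
proof -
  let ?s = "n + m + 3"
  let ?xs = "list_decode m"
  have diff: "coef m t \<odot>\<^bsub>H\<^esub> \<alpha> (vcode t ?s) \<ominus>\<^bsub>H\<^esub> coef m t \<odot>\<^bsub>H\<^esub> vec t
      = coef m t \<odot>\<^bsub>H\<^esub> (\<alpha> (vcode t ?s) \<ominus>\<^bsub>H\<^esub> vec t)" for t
  proof (rule H.ip_eqI)
    show "ip H x (coef m t \<odot>\<^bsub>H\<^esub> \<alpha> (vcode t ?s) \<ominus>\<^bsub>H\<^esub> coef m t \<odot>\<^bsub>H\<^esub> vec t)
        = ip H x (coef m t \<odot>\<^bsub>H\<^esub> (\<alpha> (vcode t ?s) \<ominus>\<^bsub>H\<^esub> vec t))" if "x \<in> carrier H" for x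
      using that by (simp add: H.ip_diff_right H.ip_smult_right right_diff_distrib)
  qed simp_all
  have "hdist H (\<alpha> (result (n, m))) (exact m) = hnorm H (\<alpha> (result (n, m)) \<ominus>\<^bsub>H\<^esub> exact m)"
    by (rule H.hdist_eq[OF \<alpha>_in exact_in])
  also have "\<dots> = hnorm H (\<Oplus>\<^bsub>H\<^esub>t\<in>{..<length ?xs}. coef m t \<odot>\<^bsub>H\<^esub> (\<alpha> (vcode t ?s) \<ominus>\<^bsub>H\<^esub> vec t))"
    unfolding lincomb_result exact_def diff[symmetric] by (subst H.finsum_diff) auto
  also have "\<dots> \<le> (\<Sum>t<length ?xs. hnorm H (coef m t \<odot>\<^bsub>H\<^esub> (\<alpha> (vcode t ?s) \<ominus>\<^bsub>H\<^esub> vec t)))"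
    by (rule H.hnorm_finsum) auto
  also have "\<dots> \<le> (\<Sum>t<length ?xs. real (?xs ! t) * (1 / 2) ^ ?s)"
  proof (rule sum_mono)
    fix t
    have "hnorm H (coef m t \<odot>\<^bsub>H\<^esub> (\<alpha> (vcode t ?s) \<ominus>\<^bsub>H\<^esub> vec t))
        = cmod (coef m t) * hdist H (\<alpha> (vcode t ?s)) (vec t)"
      by (simp add: H.hnorm_smult H.hdist_eq)
    also have "\<dots> \<le> real (?xs ! t) * (1 / 2) ^ ?s"
      by (rule mult_mono[OF scalar_enum_norm_le vcode]) simp_all
    finally show "hnorm H (coef m t \<odot>\<^bsub>H\<^esub> (\<alpha> (vcode t ?s) \<ominus>\<^bsub>H\<^esub> vec t))
        \<le> real (?xs ! t) * (1 / 2) ^ ?s" .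
  qed
  also have "\<dots> = real (sum_list ?xs) * (1 / 2) ^ ?s"
    by (simp add: sum_list_sum_nth atLeast0LessThan sum_distrib_right)
  also have "\<dots> \<le> real (2 ^ m) * (1 / 2) ^ ?s"
  proof (rule mult_right_mono)
    have "sum_list ?xs \<le> m" using sum_list_le_list_encode[of ?xs] by simp
    also have "m \<le> 2 ^ m" by (rule less_imp_le[OF less_exp])
    finally show "real (sum_list ?xs) \<le> real (2 ^ m)" by (rule of_nat_mono)
  qed simp
  also have "\<dots> = (1 / 2) ^ (n + 3)" 
  proof -
    have "?s = n + 3 + m" by simp
    then show ?thesis using two_power_half[of m "n + 3"] by (simp only: of_nat_power of_nat_numeral)
  qed
  finally show ?thesis .
qed

theorem computable_synthesis:
  "computable_map (hilbert_rep K L2 (l2_fundamental W e)) (hilbert_rep K H e\<^sub>H) (synthesis_op H W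
      \<Lambda>)"
proof -
  obtain C where C: "0 \<le> C"
    "\<And>f g y. f \<in> carrier L2 \<Longrightarrow> g \<in> carrier L2 \<Longrightarrow> y \<in> carrier H \<Longrightarrow>
       (\<And>x. x \<in> carrier H \<Longrightarrow> ip H x y = ip L2 (analysis x) g) \<Longrightarrow>
       hdist H y (synthesis_op H W \<Lambda> f) \<le> C * hdist L2 g f"
    using synthesis_lipschitz by blast
  \<comment> \<open>The machine depends on \<open>b\<close>, so existence of such a number suffices
    and C need not be computed.\<close>
  obtain b :: nat where b: "C < 2 ^ b" using real_arch_pow[of 2 C] by auto
  obtain F where F: "type2_computable F" "\<And>p. F p = Some (\<lambda>n. result (n, p (n + (b + 3))))"
    using stream_computable[OF computable_result, of "b + 3"] by blast
  have "hilbert_rep K H e\<^sub>H (\<lambda>n. result (n, p (n + (b + 3)))) (synthesis_op H W \<Lambda> f)"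
    if p: "hilbert_rep K L2 (l2_fundamental W e) p f" for p f
  proof (rule H.hilbert_repI[OF range_e\<^sub>H])
    have f: "f \<in> carrier L2" using p by (rule L2.hilbert_rep_carrier)
    show T: "synthesis_op H W \<Lambda> f \<in> carrier H" by (rule synthesis_op(1)[OF f])
    fix k
    let ?m = "p (k + (b + 3))"
    let ?g = "lincomb_enum K L2 (l2_fundamental W e) ?m"
    \<comment> \<open>The budget: one such error for replacing f by the combination in its name and
      one for evaluating T on it add up to the bound in \<open>hilbert_repI\<close>.\<close>
    define \<epsilon> :: real where "\<epsilon> = (1 / 2) ^ (k + 3)"
    have g: "?g \<in> carrier L2" by (rule L2.lincomb_in[OF l2_fundamental_in])
    have "hdist H (exact ?m) (synthesis_op H W \<Lambda> f) \<le> C * hdist L2 ?g f"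
      by (rule C(2)[OF f g exact_in ip_exact])
    also have "\<dots> \<le> 2 ^ b * (1 / 2) ^ (k + (b + 3))"
      using b L2.hilbert_rep_dist[OF l2_fundamental_in p] by (intro mult_mono)
          (simp_all del: l2_simps)
    also have "\<dots> = \<epsilon>" 
    proof -
      have "k + (b + 3) = k + 3 + b" by simp
      then show ?thesis unfolding \<epsilon>_def using two_power_half[of b "k + 3"] by (simp only:)
    qed
    finally have 1: "hdist H (exact ?m) (synthesis_op H W \<Lambda> f) \<le> \<epsilon>" .
    have 2: "hdist H (\<alpha> (result (k, ?m))) (exact ?m) \<le> \<epsilon>"
      unfolding \<epsilon>_def by (rule result_exact)
    have 3: "hdist H (\<alpha> (result (k, ?m))) (synthesis_op H W \<Lambda> f)
        \<le> hdist H (\<alpha> (result (k, ?m))) (exact ?m) + hdist H (exact ?m) (synthesis_op H W \<Lambda> f)"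
      by (rule H.metric.triangle[OF \<alpha>_in exact_in T])
    have "(1 / 2) ^ (k + 2) = \<epsilon> + \<epsilon>" by (simp add: \<epsilon>_def power_add power3_eq_cube)
    then show "hdist H (\<alpha> (result (k, ?m))) (synthesis_op H W \<Lambda> f) \<le> (1 / 2) ^ (k + 2)"
      using 1 2 3 by argo
  qed
  then show ?thesis unfolding computable_map_def using F by blast
qed

end

theorem theorem3p11:
  fixes K :: "complex set"
    and H :: "'a hspace" and e\<^sub>H :: "nat \<Rightarrow> 'a"
    and W :: "nat \<Rightarrow> 'b hspace" and h e :: "nat \<Rightarrow> nat \<Rightarrow> 'b"
    and \<Lambda> :: "nat \<Rightarrow> 'a \<Rightarrow> 'b"
  assumes "computable_hilbert_space K H e\<^sub>H"
    and "computable_hilbert_space_seq K W h"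
    and "\<And>i. orthonormal_basis K (W i) (e i)"
    and "computable_double_seq (\<lambda>i k. hilbert_rep K (W i) (h i)) e"
    and "g_frame K H W \<Lambda>"
    and "computable_seq (\<lambda>i. fun_rep (hilbert_rep K H e\<^sub>H) (hilbert_rep K (W i) (h i))) \<Lambda>"
    and "computable_double_seq (\<lambda>i k. real_rep) (\<lambda>i k. hnorm H (adjoint_op H (W i) (\<Lambda> i) (e i k)))"
  shows "computable_map (hilbert_rep K (l2_sum W) (l2_fundamental W e)) (hilbert_rep K H e\<^sub>H)
           (synthesis_op H W \<Lambda>)"
proof -
  have H: "hilbert_space K H" "fundamental K H e\<^sub>H"
    and H_dist: "computable_double_seq (\<lambda>_ _. real_rep) (\<lambda>n m. hdist H (lincomb_enum K H e\<^sub>H n)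
        (lincomb_enum K H e\<^sub>H m))"
    using assms(1) unfolding computable_hilbert_space_def by blast+
  have W: "hilbert_space K (W i)" "fundamental K (W i) (h i)" for i
    using assms(2) unfolding computable_hilbert_space_seq_def computable_hilbert_space_def by blast+
  have W_dist: "computable_double_seq (\<lambda>_ _. real_rep) (\<lambda>i s. case prod_decode s of (n, m) \<Rightarrow>
          hdist (W i) (lincomb_enum K (W i) (h i) n) (lincomb_enum K (W i) (h i) m))"
    using assms(2) unfolding computable_hilbert_space_seq_def by blast
  obtain gH where gH: "computable (\<lambda>z. gH (fst z) (snd z))"
    "\<And>n m. real_rep (gH (prod_encode (n, m))) (hdist H (lincomb_enum K H e\<^sub>H n) (lincomb_enum K H
        e\<^sub>H m))"
    using computable_double_seq_realizer[OF H_dist] by blast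
  obtain gW where gW: "computable (\<lambda>z. gW (fst z) (snd z))"
    "\<And>i s. real_rep (gW (prod_encode (i, s))) (case prod_decode s of (n, m) \<Rightarrow>
          hdist (W i) (lincomb_enum K (W i) (h i) n) (lincomb_enum K (W i) (h i) m))"
    using computable_double_seq_realizer[OF W_dist] by blast
  have gW': "real_rep (gW (prod_encode (i, prod_encode (n, m))))
      (hdist (W i) (lincomb_enum K (W i) (h i) n) (lincomb_enum K (W i) (h i) m))" for i n m
    using gW(2)[of i "prod_encode (n, m)"] by simp
  obtain ge where ge: "computable (\<lambda>z. ge (fst z) (snd z))"
    "\<And>i k. hilbert_rep K (W i) (h i) (ge (prod_encode (i, k))) (e i k)"
    using computable_double_seq_realizer[OF assms(4)] by blast
  obtain gL where gL: "computable (\<lambda>z. gL (fst z) (snd z))"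
    "\<And>i. fun_rep (hilbert_rep K H e\<^sub>H) (hilbert_rep K (W i) (h i)) (gL i) (\<Lambda> i)"
    using computable_seq_realizer[OF assms(6)] by blast
  obtain gN where gN: "computable (\<lambda>z. gN (fst z) (snd z))"
    "\<And>i k. real_rep (gN (prod_encode (i, k))) (hnorm H (adjoint_op H (W i) (\<Lambda> i) (e i k)))"
    using computable_double_seq_realizer[OF assms(7)] by blast
  interpret ip_family K W by (rule ip_family.intro) (rule ip_spaceI[OF W(1)])
  interpret frame K W H \<Lambda>
    by (rule frame.intro[OF ip_family_axioms], rule frame_axioms.intro) (fact H(1), fact assms(5))
  interpret realized_frame K W H \<Lambda> e\<^sub>H h e gH gW ge gL gN
    by (rule realized_frame.intro[OF frame_axioms], rule realized_frame_axioms.intro)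
      (fact H W assms(3) gH gW(1) gW' ge gL gN)+
  show ?thesis by (rule computable_synthesis)
qed

end
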